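(* Let $d\ge2$. Suppose $q\in[0,1]$ is such that, for some $\alpha\ge1$ and constants $C,\gamma\in(0,\infty)$, $$\mathbb{P}_q(T_L>CL^\alpha)\le e^{-\gamma L}\quad\text{for all integers }L\ge1,$$ where $T_L$ is the erosion time of the cube of side $L$ (defined in the context). \begin{enumerate} \item If $\alpha=1$ and an integer $L_0\ge4$ is given, there exists $\epsilon>0$ with the following property. For any $\epsilon_0\in(0,\epsilon)$, there exists $C_1>0$ such that $$\mathbb{P}_{\epsilon_0,q,L_0}\bigl(\sigma^s_0=-1\text{ for some }s\ge t\bigr)\le\exp\left(-C_1\frac{t}{\log^2t}\right)\quad\text{for all large }t>0.$$ \item If $\alpha>1$ and $\delta>0$ is given, there exists $\epsilon>0$ with the following property. For any $\epsilon_0\in(0,\epsilon)$ and any integer $L_0\ge1$ with $$L_0\le K\,\epsilon_0^{-\frac{2\delta}{(d-1)(\alpha-1)}},\qquad K=\frac{(2e)^{\frac{\alpha}{(\alpha-1)(d-1)}}}{(32de)^{\frac1{\alpha-1}}},$$ there exists $C_2>0$ such that $$\mathbb{P}_{\epsilon_0,q,L_0}\bigl(\sigma^s_0=-1\text{ for some }s\ge t\bigr)\le\exp\left(-C_2\frac{t^{1/\alpha}}{\log^{\alpha+3\delta}t}\right)\quad\text{for all large }t>0.$$ \end{enumerate}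
   Context: Dynamics (zero-temperature Glauber dynamics with $q$-biased tie breaking) on $\mathbb{Z}^d$: the state at time $t\ge0$ is $\sigma^t=(\sigma^t_x)_{x\in\mathbb{Z}^d}\in\{-1,+1\}^{\mathbb{Z}^d}$. Write $y\sim x$ if $x,y$ are nearest neighbors, and let $e^t_x=-\sum_{y\sim x}\sigma^t_x\sigma^t_y$. Each vertex $x$ has an independent rate-1 Poisson clock, and a sequence $(\xi_x^i)_{i\in\mathbb{N}}$ of tie-breaking variables, i.i.d. over $x$ and $i$ and independent of everything else, with $\mathbb{P}(\xi^i_x=+1)=q=1-\mathbb{P}(\xi^i_x=-1)$. When the clock at $x$ rings for the $i$-th time, at time $t$, the spin at $x$ is updated: $\sigma^t_x=\sigma^{t-}_x$ if $e^{t-}_x<0$; $\sigma^t_x=-\sigma^{t-}_x$ if $e^{t-}_x>0$; and $\sigma^t_x=\xi^i_x$ if $e^{t-}_x=0$. Spins change only at such updates. For an integer $L\ge1$ let $\Lambda_L=\{0,\ldots,L-1\}^d$. $T_L$ is the time for the configuration in $\Lambda_L$ to reach all $+1$ when the dynamics is run from the initial configuration that is $-1$ on $\Lambda_L$ and $+1$ outside $\Lambda_L$; $\mathbb{P}_q$ is the law of the dynamics from this deterministic initial configuration. For $\epsilon_0\in(0,1)$ and an integer $L_0\ge1$, $\mathbb{P}_{\epsilon_0,q,L_0}$ is the law of the dynamics (together with its initial state) when the initial state is as follows: $\mathbb{Z}^d$ is partitioned into the boxes $L_0i+\Lambda_{L_0}$, $i\in\mathbb{Z}^d$, and, independently for each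 box, all spins in the box are $+1$ with probability $1-\epsilon_0$ and all spins in the box are $-1$ with probability $\epsilon_0$. "For all large $t$" means for all $t\ge t_*$, for some finite $t_*$ that may depend on all the other parameters. *)

theory Defs
  imports "HOL-Probability.Probability"
begin

type_synonym 'd site = "int ^ 'd"

text \<open>Spins are the integers $-1$ and $+1$.\<close>

type_synonym 'd config = "'d site \<Rightarrow> int"

definition nearest_neighbor :: "'d::finite site \<Rightarrow> 'd site \<Rightarrow> bool" where
  "nearest_neighbor x y \<longleftrightarrow> (\<Sum>k\<in>UNIV. \<bar>x $ k - y $ k\<bar>) = 1"

lemma finite_nearest_neighbors: "finite {y. nearest_neighbor (x :: 'd::finite site) y}"
proof -
  have "{y. nearest_neighbor x y} \<subseteq> vec_lambda ` (\<Pi>\<^sub>E k\<in>UNIV. {x $ k - 1..x $ k + 1})"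
  proof
    fix y assume "y \<in> {y. nearest_neighbor x y}"
    then have s: "(\<Sum>k\<in>UNIV. \<bar>x $ k - y $ k\<bar>) = 1"
      by (simp add: nearest_neighbor_def)
    have "\<bar>x $ k - y $ k\<bar> \<le> 1" for k
      using member_le_sum[of k UNIV "\<lambda>k. \<bar>x $ k - y $ k\<bar>"] s by simp
    then have "vec_nth y \<in> (\<Pi>\<^sub>E k\<in>UNIV. {x $ k - 1..x $ k + 1})"
      by (auto simp: abs_le_iff algebra_simps)
    then show "y \<in> vec_lambda ` (\<Pi>\<^sub>E k\<in>UNIV. {x $ k - 1..x $ k + 1})"
      using image_eqI[of y vec_lambda "vec_nth y"] by (simp add: vec_nth_inverse)
  qed
  then show ?thesis
    by (rule finite_subset) (intro finite_imageI finite_PiE; simp)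
qed

definition energy :: "'d::finite config \<Rightarrow> 'd site \<Rightarrow> int" where
  "energy \<sigma> x = - (\<Sum>y | nearest_neighbor x y. \<sigma> x * \<sigma> y)"

definition updated_spin :: "'d::finite config \<Rightarrow> 'd site \<Rightarrow> int \<Rightarrow> int" where
  "updated_spin \<sigma> x \<xi> =
     (if energy \<sigma> x < 0 then \<sigma> x else if energy \<sigma> x > 0 then - \<sigma> x else \<xi>)"

text \<open>
  A sample point \<open>(\<tau>, \<xi>)\<close> of the driving noise consists of the waiting times \<open>\<tau> (x, i)\<close>
  between the rings of the clock at \<open>x\<close> and the tie-breaking variables \<open>\<xi> (x, i)\<close>. Rings are
  numbered from \<open>0\<close>, and \<open>\<xi> (x, i)\<close> belongs to the ring numbered \<open>i\<close>. A rate-1 Poisson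
  clock is one whose waiting times are independent and exponential with parameter 1.
\<close>

type_synonym 'd noise = "('d site \<times> nat \<Rightarrow> real) \<times> ('d site \<times> nat \<Rightarrow> int)"

definition ring_time :: "'d::finite noise \<Rightarrow> 'd site \<Rightarrow> nat \<Rightarrow> real" where
  "ring_time \<omega> x i = (\<Sum>j\<le>i. fst \<omega> (x, j))"

definition spin_pmf :: "real \<Rightarrow> int pmf" where
  "spin_pmf p = map_pmf (\<lambda>b. if b then 1 else - 1) (bernoulli_pmf p)"

definition noise_law :: "real \<Rightarrow> 'd::finite noise measure" where
  "noise_law q =
     (\<Pi>\<^sub>M _\<in>UNIV. density lborel (exponential_density 1)) \<Otimes>\<^sub>M
     (\<Pi>\<^sub>M _\<in>UNIV. measure_pmf (spin_pmf q))"

lemma prob_space_noise_law: "prob_space (noise_law q :: 'd::finite noise measure)"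
proof -
  interpret E: product_prob_space "\<lambda>_ :: 'd site \<times> nat. density lborel (exponential_density 1)" UNIV
    using prob_space_exponential_density[of 1]
    by (simp add: product_prob_space_def product_sigma_finite_def product_prob_space_axioms_def
        prob_space_imp_sigma_finite)
  interpret X: product_prob_space "\<lambda>_ :: 'd site \<times> nat. measure_pmf (spin_pmf q)" UNIV
    by unfold_locales
  interpret pair_prob_space
    "\<Pi>\<^sub>M _ :: 'd site \<times> nat\<in>UNIV. density lborel (exponential_density 1)"
    "\<Pi>\<^sub>M _ :: 'd site \<times> nat\<in>UNIV. measure_pmf (spin_pmf q)"
    by unfold_locales
  show ?thesis
    unfolding noise_law_def by unfold_locales
qed

definition left_limit :: "(real \<Rightarrow> 'd::finite config) \<Rightarrow> real \<Rightarrow> 'd config" where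
  "left_limit \<sigma> t y = Lim (at_left t) (\<lambda>s. \<sigma> s y)"

definition glauber_trajectory ::
  "'d::finite noise \<Rightarrow> 'd config \<Rightarrow> (real \<Rightarrow> 'd config) \<Rightarrow> bool" where
  "glauber_trajectory \<omega> \<sigma>\<^sub>0 \<sigma> \<longleftrightarrow>
     \<sigma> 0 = \<sigma>\<^sub>0 \<and>
     (\<forall>x i. ring_time \<omega> x i > 0 \<longrightarrow>
        \<sigma> (ring_time \<omega> x i) x = updated_spin (left_limit \<sigma> (ring_time \<omega> x i)) x (snd \<omega> (x, i))) \<and>
     (\<forall>x s t. 0 \<le> s \<and> s \<le> t \<and> (\<forall>i. ring_time \<omega> x i \<notin> {s<..t}) \<longrightarrow> \<sigma> t x = \<sigma> s x)"

text \<open>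
  For almost every \<open>\<omega>\<close> there is, for each initial configuration of spins, exactly one trajectory
  on $[0,\infty)$ (Harris): almost surely all waiting times are positive, the rings at each site
  have no accumulation point, no two sites ring simultaneously, and tracing the updates
  backwards from a space-time point meets only finitely many rings. So the choice below
  matters only on a null set (and at negative times). That null set is why probabilities of events
  of the dynamics are taken in the completion of the driving measure: such events are
  measurable up to null sets, and \<^const>\<open>measure\<close> is \<open>0\<close> on sets that are not measurable.
\<close>

definition glauber :: "'d::finite noise \<Rightarrow> 'd config \<Rightarrow> real \<Rightarrow> 'd config" where
  "glauber \<omega> \<sigma>\<^sub>0 = (SOME \<sigma>. glauber_trajectory \<omega> \<sigma>\<^sub>0 \<sigma>)"

definition cube :: "nat \<Rightarrow> 'd::finite site set" where
  "cube L = {x. \<forall>k. x $ k \<in> {0..<int L}}"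

definition cube_init :: "nat \<Rightarrow> 'd::finite config" where
  "cube_init L x = (if x \<in> cube L then - 1 else 1)"

text \<open>The value is $\infty$ if the cube never becomes all $+1$.\<close>

definition erosion_time :: "nat \<Rightarrow> 'd::finite noise \<Rightarrow> ereal" where
  "erosion_time L \<omega> =
     Inf (ereal ` {t. 0 \<le> t \<and> (\<forall>x\<in>cube L. glauber \<omega> (cube_init L) t x = 1)})"

text \<open>The block variable \<open>\<eta> i\<close> is the common spin of the sites of the box \<open>L i + cube L\<close>.\<close>

definition block_law :: "real \<Rightarrow> 'd::finite config measure" where
  "block_law \<epsilon> = (\<Pi>\<^sub>M _\<in>UNIV. measure_pmf (spin_pmf (1 - \<epsilon>)))"

definition block_init :: "nat \<Rightarrow> 'd::finite config \<Rightarrow> 'd config" where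
  "block_init L \<eta> x = \<eta> (\<chi> k. x $ k div int L)"

lemma block_init_box:
  assumes "y \<in> cube L"
  shows "block_init L \<eta> ((\<chi> k. int L * i $ k) + y) = \<eta> i"
proof -
  have "(int L * i $ k + y $ k) div int L = i $ k" for k
  proof -
    have "0 \<le> y $ k" "y $ k < int L"
      using assms by (auto simp: cube_def)
    then show ?thesis
      by (simp add: div_pos_pos_trivial)
  qed
  then have "(\<chi> k. ((\<chi> k. int L * i $ k) + y) $ k div int L) = i"
    by (simp add: vec_eq_iff)
  then show ?thesis
    by (simp add: block_init_def)
qed

definition random_init_law :: "real \<Rightarrow> real \<Rightarrow> ('d::finite config \<times> 'd noise) measure" where
  "random_init_law \<epsilon> q = block_law \<epsilon> \<Otimes>\<^sub>M noise_law q"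

end

theory Submission
  imports Defs "HOL-Real_Asymp.Real_Asymp"
begin

text \<open>
  Minus regions disappear because they are sparse and erode before anything can come to their help.
  The proof is a renormalization. A block of side \<open>L\<close> is bad at time \<open>t\<close> if it is not entirely $+1$
  during $[t,2t]$, or rather if an event occurs that implies this and depends only on inputs near the
  block, so that blocks far from each other are independent; \<open>controlled\<close> says that the probability
  of this event is at most \<open>p\<close>.

  The step to a larger scale is \<open>controlled_step\<close>. Around a large block, cover the bad small blocks by
  boxes that are separated by at least two small blocks (\<open>separated_hulls\<close>). A site outside the boxes has
  at most one neighbor in them, and since $d\ge2$ it then has a majority of plus neighbors. So the boxes
  neither grow nor interact, and by monotonicity each disappears at least as fast as a cube of minus
  spins that contains it and is left to itself (\<open>separated_boxes_erode\<close>). If every window of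
  side $4n$ in units of small blocks has at most \<open>n\<close> bad ones, the boxes fit into cubes of side
  $2nL'$, which by hypothesis erode within $T = C (2nL')^\alpha$. Three things can go wrong: some window is
  crowded, with probability about $p^{cn}$; some cube survives, with probability about
  $e^{-2\gamma nL'}$; or influence travels a distance \<open>L\<close> in a time of order \<open>T\<close>, with probability
  about $2^{-L}$ if \<open>L\<close> is a large multiple of \<open>T\<close> (\<open>prob_fast_path_le\<close>). A union
  bound over the positions of the cubes takes care of the dependence of the boxes on the past.

  Writing $p = e^{-\nu}$, a step gives the exponent $c \min (n\nu, nL')$ on scale $L \approx (nL')^\alpha$, provided
  $\ln n$ is small compared with $\nu$. After a first step with $n \approx \ln^2 (1/\epsilon_0)$ the probability is
  smaller than a high power of $1/L$ (\<open>controlled_start\<close>), and then an exponent $L^\beta$ with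
  $\beta < 1/\alpha$ reproduces itself along $L' \approx L^{1/M}$ (\<open>controlled_growth\<close>,
  \<open>controlled_all_scales\<close>). To reach time \<open>t\<close>, take one last step from $L' = (\ln t)^{\alpha+1}$. Its
  exponent is of order $nL'^\beta$ with $n \approx t^{1/\alpha} / L'$, so it loses $L'^{1-\beta} \le \ln^\alpha t$ when
  $(\alpha+1)\beta \ge 1$ (\<open>controlled_at_time\<close>). This is better than what either part asks for.

  Two facts about the dynamics underlie this. First, a trajectory is a recursion along the rings, which
  is well-founded because influence has finite speed; this gives existence, uniqueness and the
  comparison principle (\<open>glauber_skeleton\<close>, \<open>comparison\<close>). Second, Poisson clocks are
  stationary, so that the hypothesis, which concerns cubes at time 0, applies to cubes anywhere at any
  later time (\<open>distr_restart\<close>).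
\<close>

section \<open>Majority updates on the lattice\<close>

definition neighbors :: "'d::finite site \<Rightarrow> 'd site set" where
  "neighbors x = {y. nearest_neighbor x y}"

lemma finite_neighbors [simp]: "finite (neighbors x)"
  by (simp add: neighbors_def finite_nearest_neighbors)

lemma neighbor_coordinate_le:
  assumes "y \<in> neighbors (x :: 'd::finite site)"
  shows "\<bar>y $ k - x $ k\<bar> \<le> 1"
proof -
  have "(\<Sum>k\<in>UNIV. \<bar>x $ k - y $ k\<bar>) = 1"
    using assms by (simp add: neighbors_def nearest_neighbor_def)
  then have "\<bar>x $ k - y $ k\<bar> \<le> 1"
    using member_le_sum[of k UNIV "\<lambda>k. \<bar>x $ k - y $ k\<bar>"] by simp
  then show ?thesis by (simp add: abs_minus_commute)
qed

lemma neighbor_other_coordinates_eq: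
  assumes "y \<in> neighbors (x :: 'd::finite site)" "y $ k \<noteq> x $ k" "j \<noteq> k"
  shows "y $ j = x $ j"
proof -
  have "(\<Sum>k\<in>UNIV. \<bar>x $ k - y $ k\<bar>) = 1"
    using assms by (simp add: neighbors_def nearest_neighbor_def)
  moreover have "(\<Sum>k\<in>{j,k}. \<bar>x $ k - y $ k\<bar>) \<le> (\<Sum>k\<in>UNIV. \<bar>x $ k - y $ k\<bar>)"
    by (rule sum_mono2) auto
  ultimately show ?thesis
    using assms by simp
qed

lemma neighbors_shift_iff:
  "y + v \<in> neighbors (x + v) \<longleftrightarrow> y \<in> neighbors (x :: 'd::finite site)"
  by (simp add: neighbors_def nearest_neighbor_def)

lemma neighbors_shift_image: "neighbors (x + v) = (\<lambda>y. y + v) ` neighbors (x :: 'd::finite site)"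
proof -
  have "y \<in> (\<lambda>y. y + v) ` neighbors x" if "y \<in> neighbors (x + v)" for y
    using neighbors_shift_iff[of "y - v" v x] that by (intro image_eqI[of _ _ "y - v"]) auto
  then show ?thesis
    by (auto simp: neighbors_shift_iff)
qed

lemma sum_neighbors_shift:
  "(\<Sum>y\<in>neighbors (x + v). f y) = (\<Sum>y\<in>neighbors (x :: 'd::finite site). f (y + v))"
  by (simp add: neighbors_shift_image sum.reindex inj_on_def)

lemma card_neighbors_le: "card (neighbors (x :: 'd::finite site)) \<le> 3 ^ CARD('d)"
proof -
  have "neighbors x \<subseteq> vec_lambda ` (\<Pi>\<^sub>E k\<in>UNIV. {x $ k - 1..x $ k + 1})"
  proof
    fix y assume y: "y \<in> neighbors x"
    have "vec_nth y \<in> (\<Pi>\<^sub>E k\<in>UNIV. {x $ k - 1..x $ k + 1})"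
      using neighbor_coordinate_le[OF y] by (auto simp: abs_le_iff algebra_simps)
    then show "y \<in> vec_lambda ` (\<Pi>\<^sub>E k\<in>UNIV. {x $ k - 1..x $ k + 1})"
      using image_eqI[of y vec_lambda "vec_nth y"] by (simp add: vec_nth_inverse)
  qed
  then have "card (neighbors x) \<le> card (vec_lambda ` (\<Pi>\<^sub>E k\<in>UNIV. {x $ k - 1..x $ k + 1}))"
    by (intro card_mono finite_imageI finite_PiE) auto
  also have "\<dots> \<le> card (\<Pi>\<^sub>E k\<in>(UNIV::'d set). {x $ k - 1..x $ k + 1})"
    by (intro card_image_le finite_PiE) auto
  also have "\<dots> = 3 ^ CARD('d)"
    by (simp add: card_PiE)
  finally show ?thesis .
qed

lemma card_neighbors_ge:
  assumes "CARD('d::finite) \<ge> 2"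
  shows "card (neighbors (x :: 'd site)) \<ge> 3"
proof -
  obtain i j :: 'd where ij: "i \<noteq> j"
    using assms card_le_Suc0_iff_eq[of "UNIV :: 'd set"] by auto
  have ax: "(\<Sum>k\<in>UNIV. \<bar>axis i (c::int) $ k\<bar>) = \<bar>c\<bar>" for i :: 'd and c
  proof -
    have "(\<Sum>k\<in>UNIV. \<bar>axis i (c::int) $ k\<bar>) = (\<Sum>k\<in>UNIV. if k = i then \<bar>c\<bar> else 0)"
      by (rule sum.cong) (auto simp: axis_def)
    then show ?thesis by simp
  qed
  have nb: "x + axis i c \<in> neighbors x" if "\<bar>c\<bar> = 1" for i and c :: int
    using ax[of i c] that by (simp add: neighbors_def nearest_neighbor_def)
  have ne: "axis i (1::int) \<noteq> axis i (-1)" "axis i (1::int) \<noteq> axis j 1" "axis i (-1::int) \<noteq> axis j 1"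
    using ij by (auto simp: axis_eq_axis)
  have "{x + axis i 1, x + axis i (-1), x + axis j 1} \<subseteq> neighbors x"
    using nb by auto
  then have "card {x + axis i 1, x + axis i (-1), x + axis j 1} \<le> card (neighbors x)"
    by (intro card_mono) auto
  then show ?thesis
    using ne by simp
qed

text \<open>
  For spins $\pm1$ the energy rule is a majority vote of the neighbors, and the own spin drops out.
  In this form the rule is visibly monotone in the neighbors.
\<close>

definition majority :: "'d::finite config \<Rightarrow> 'd site \<Rightarrow> int \<Rightarrow> int" where
  "majority \<sigma> x \<xi> =
     (let S = \<Sum>y\<in>neighbors x. \<sigma> y in if S > 0 then 1 else if S < 0 then - 1 else \<xi>)"

lemma updated_spin_eq_majority:
  assumes "\<sigma> x \<in> {1, - 1}"
  shows "updated_spin \<sigma> x \<xi> = majority \<sigma> x \<xi>"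
proof -
  have "energy \<sigma> x = - (\<sigma> x * (\<Sum>y\<in>neighbors x. \<sigma> y))"
    by (simp add: energy_def neighbors_def sum_distrib_left)
  then show ?thesis
    using assms by (auto simp: updated_spin_def majority_def Let_def)
qed

lemma majority_cong:
  "(\<And>y. y \<in> neighbors x \<Longrightarrow> \<sigma> y = \<rho> y) \<Longrightarrow> majority \<sigma> x \<xi> = majority \<rho> x \<xi>"
  by (simp add: majority_def cong: sum.cong)

lemma majority_in_spins: "\<xi> \<in> {1, - 1} \<Longrightarrow> majority \<sigma> x \<xi> \<in> {1, - 1}"
  by (auto simp: majority_def Let_def)

lemma majority_mono:
  assumes "\<xi> \<in> {1, - 1}" "\<And>y. y \<in> neighbors x \<Longrightarrow> \<rho> y \<le> \<sigma> y"
  shows "majority \<rho> x \<xi> \<le> majority \<sigma> x \<xi>"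
proof -
  have "(\<Sum>y\<in>neighbors x. \<rho> y) \<le> (\<Sum>y\<in>neighbors x. \<sigma> y)"
    using assms by (intro sum_mono) auto
  then show ?thesis
    using assms(1) by (auto simp: majority_def Let_def)
qed

lemma majority_all_1:
  assumes "\<And>y. y \<in> neighbors (x :: 'd::finite site) \<Longrightarrow> \<sigma> y = 1"
  shows "majority \<sigma> x \<xi> = 1"
proof -
  have "(\<Sum>j\<in>UNIV. \<bar>axis (undefined :: 'd) (1::int) $ j\<bar>) = (\<Sum>j\<in>UNIV. if j = (undefined :: 'd) then 1 else 0)"
    by (rule sum.cong) (auto simp: axis_def)
  then have "x + axis undefined 1 \<in> neighbors x"
    by (simp add: neighbors_def nearest_neighbor_def)
  then have "neighbors x \<noteq> {}" by blast
  then have "card (neighbors x) > 0" by (simp add: card_gt_0_iff)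
  then show ?thesis using assms by (simp add: majority_def)
qed

lemma majority_shift: "majority \<sigma> (x + v) \<xi> = majority (\<lambda>y. \<sigma> (y + v)) x \<xi>"
  by (simp add: majority_def sum_neighbors_shift)

text \<open>A site has at least three neighbors when $d\ge2$, so a single minus neighbor loses the vote.\<close>

lemma majority_eq_1:
  fixes x :: "'d::finite site"
  assumes d: "CARD('d) \<ge> 2"
    and spins: "\<And>y. y \<in> neighbors x \<Longrightarrow> \<sigma> y \<in> {1, - 1}"
    and one: "\<And>y z. y \<in> neighbors x \<Longrightarrow> z \<in> neighbors x \<Longrightarrow> \<sigma> y \<noteq> 1 \<Longrightarrow> \<sigma> z \<noteq> 1 \<Longrightarrow> y = z"
  shows "majority \<sigma> x \<xi> = 1"
proof -
  let ?A = "{y\<in>neighbors x. \<sigma> y \<noteq> 1}"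
  have "card ?A \<le> Suc 0"
    using one by (subst card_le_Suc0_iff_eq) auto
  moreover have "(\<Sum>y\<in>neighbors x. \<sigma> y) = (\<Sum>y\<in>neighbors x. 1 - 2 * (if \<sigma> y \<noteq> 1 then 1 else 0))"
    using spins by (intro sum.cong) auto
  moreover have "\<dots> = int (card (neighbors x)) - 2 * (\<Sum>y\<in>neighbors x. if \<sigma> y \<noteq> 1 then 1 else 0)"
    by (simp only: sum_subtractf sum_distrib_left) simp
  moreover have "(\<Sum>y\<in>neighbors x. if \<sigma> y \<noteq> 1 then 1 else 0) = int (card ?A)"
    by (subst sum.inter_filter[symmetric]) simp_all
  ultimately have "(\<Sum>y\<in>neighbors x. \<sigma> y) > 0"
    using card_neighbors_ge[OF d, of x] by simp
  then show ?thesis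
    by (simp add: majority_def)
qed

section \<open>Rings of the clocks\<close>

text \<open>
  These count the rings at \<open>x\<close> in $[0,t]$ and in $[0,t)$ if the ring times at \<open>x\<close> increase to infinity.
  A least index, unlike a cardinality, is measurable in \<open>\<omega>\<close> at once.
\<close>

definition rings_upto :: "'d::finite noise \<Rightarrow> 'd site \<Rightarrow> real \<Rightarrow> nat" where
  "rings_upto \<omega> x t = (LEAST i. t < ring_time \<omega> x i)"

definition rings_before :: "'d::finite noise \<Rightarrow> 'd site \<Rightarrow> real \<Rightarrow> nat" where
  "rings_before \<omega> x t = (LEAST i. t \<le> ring_time \<omega> x i)"

definition regular :: "'d::finite noise \<Rightarrow> bool" where
  "regular \<omega> \<longleftrightarrow> (\<forall>p. fst \<omega> p > 0) \<and> (\<forall>x b. \<exists>i. b < ring_time \<omega> x i) \<and> (\<forall>p. snd \<omega> p \<in> {1, - 1})"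

context
  fixes \<omega> :: "'d::finite noise"
  assumes regular: "regular \<omega>"
begin

lemma regular_spin: "snd \<omega> p \<in> {1, - 1}"
  using regular unfolding regular_def by blast

lemma ring_time_less: "i < j \<Longrightarrow> ring_time \<omega> x i < ring_time \<omega> x j"
proof (rule lift_Suc_mono_less[of "ring_time \<omega> x"])
  show "ring_time \<omega> x n < ring_time \<omega> x (Suc n)" for n
    using regular by (simp add: ring_time_def regular_def)
qed

lemma ring_time_less_iff: "ring_time \<omega> x i < ring_time \<omega> x j \<longleftrightarrow> i < j"
  using ring_time_less[of i j x] ring_time_less[of j i x] by (cases i j rule: linorder_cases) auto

lemma ring_time_le_iff: "ring_time \<omega> x i \<le> ring_time \<omega> x j \<longleftrightarrow> i \<le> j"
  using ring_time_less_iff[of x j i] by auto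

lemma ring_time_pos: "ring_time \<omega> x i > 0"
  using regular unfolding ring_time_def regular_def by (intro sum_pos) auto

lemma less_rings_upto_iff: "i < rings_upto \<omega> x t \<longleftrightarrow> ring_time \<omega> x i \<le> t"
proof -
  obtain j where "t < ring_time \<omega> x j"
    using regular unfolding regular_def by blast
  then have *: "t < ring_time \<omega> x (rings_upto \<omega> x t)"
    unfolding rings_upto_def by (rule LeastI)
  show ?thesis
  proof
    show "ring_time \<omega> x i \<le> t" if "i < rings_upto \<omega> x t"
      using not_less_Least[of i "\<lambda>i. t < ring_time \<omega> x i"] that by (simp add: rings_upto_def)
  next
    assume "ring_time \<omega> x i \<le> t"
    with * have "ring_time \<omega> x i < ring_time \<omega> x (rings_upto \<omega> x t)" by simp
    then show "i < rings_upto \<omega> x t" by (simp add: ring_time_less_iff)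
  qed
qed

lemma less_rings_before_iff: "i < rings_before \<omega> x t \<longleftrightarrow> ring_time \<omega> x i < t"
proof -
  obtain j where "t < ring_time \<omega> x j"
    using regular unfolding regular_def by blast
  then have "t \<le> ring_time \<omega> x j" by simp
  then have *: "t \<le> ring_time \<omega> x (rings_before \<omega> x t)"
    unfolding rings_before_def by (rule LeastI)
  show ?thesis
  proof
    show "ring_time \<omega> x i < t" if "i < rings_before \<omega> x t"
      using not_less_Least[of i "\<lambda>i. t \<le> ring_time \<omega> x i"] that by (simp add: rings_before_def)
  next
    assume "ring_time \<omega> x i < t"
    with * have "ring_time \<omega> x i < ring_time \<omega> x (rings_before \<omega> x t)" by simp
    then show "i < rings_before \<omega> x t" by (simp add: ring_time_less_iff)
  qed
qed

lemma rings_upto_le_iff: "rings_upto \<omega> x t \<le> i \<longleftrightarrow> t < ring_time \<omega> x i"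
  using less_rings_upto_iff[of i x t] by auto

lemma rings_before_le_iff: "rings_before \<omega> x t \<le> i \<longleftrightarrow> t \<le> ring_time \<omega> x i"
  using less_rings_before_iff[of i x t] by auto

lemma rings_upto_mono: "s \<le> t \<Longrightarrow> rings_upto \<omega> x s \<le> rings_upto \<omega> x t"
proof (rule ccontr)
  assume "s \<le> t" "\<not> rings_upto \<omega> x s \<le> rings_upto \<omega> x t"
  then show False
    using less_rings_upto_iff[of "rings_upto \<omega> x t" x s] less_rings_upto_iff[of "rings_upto \<omega> x t" x t]
    by auto
qed

lemma rings_upto_le_rings_before: "s < t \<Longrightarrow> rings_upto \<omega> x s \<le> rings_before \<omega> x t"
proof (rule ccontr)
  assume "s < t" "\<not> rings_upto \<omega> x s \<le> rings_before \<omega> x t"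
  then show False
    using less_rings_upto_iff[of "rings_before \<omega> x t" x s] less_rings_before_iff[of "rings_before \<omega> x t" x t]
    by auto
qed

lemma rings_upto_ring_time [simp]: "rings_upto \<omega> x (ring_time \<omega> x i) = Suc i"
proof (rule antisym)
  show "rings_upto \<omega> x (ring_time \<omega> x i) \<le> Suc i"
    unfolding rings_upto_le_iff ring_time_less_iff by simp
  show "Suc i \<le> rings_upto \<omega> x (ring_time \<omega> x i)"
    unfolding Suc_le_eq less_rings_upto_iff by simp
qed

lemma rings_before_ring_time [simp]: "rings_before \<omega> x (ring_time \<omega> x i) = i"
proof (rule antisym)
  show "rings_before \<omega> x (ring_time \<omega> x i) \<le> i"
    unfolding rings_before_le_iff by simp
  show "i \<le> rings_before \<omega> x (ring_time \<omega> x i)"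
    using less_rings_before_iff[of "rings_before \<omega> x (ring_time \<omega> x i)" x "ring_time \<omega> x i"]
    by (simp add: ring_time_less_iff)
qed

lemma rings_upto_0 [simp]: "rings_upto \<omega> x 0 = 0"
  using rings_upto_le_iff[of x 0 0] ring_time_pos by auto

lemma finite_rings: "finite D \<Longrightarrow> finite {(x, i). x \<in> D \<and> ring_time \<omega> x i < t}"
proof -
  assume "finite D"
  then have "finite (SIGMA x:D. {..<rings_before \<omega> x t})" by auto
  moreover have "{(x, i). x \<in> D \<and> ring_time \<omega> x i < t} = (SIGMA x:D. {..<rings_before \<omega> x t})"
    by (auto simp: less_rings_before_iff)
  ultimately show ?thesis by simp
qed

end

text \<open>
  The ring \<open>(y, j)\<close> can influence the outcome of \<open>(x, i)\<close> directly. Everything about the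
  dynamics is proved by induction along this relation, which is well-founded on a finite set of
  sites, and almost surely on the whole lattice.
\<close>

definition precedes :: "'d::finite noise \<Rightarrow> 'd site set \<Rightarrow> (('d site \<times> nat) \<times> ('d site \<times> nat)) set" where
  "precedes \<omega> D = {((y, j), (x, i)). x \<in> D \<and> y \<in> D \<and> y \<in> neighbors x \<and> ring_time \<omega> y j < ring_time \<omega> x i}"

lemma wf_precedes_finite:
  assumes "regular \<omega>" "finite D"
  shows "wf (precedes \<omega> D)"
proof -
  let ?f = "\<lambda>(x, i). card {(y, j). y \<in> D \<and> ring_time \<omega> y j < ring_time \<omega> x i}"
  have "precedes \<omega> D \<subseteq> Wellfounded.measure ?f"
  proof (clarsimp simp: precedes_def)
    fix y x and j i :: nat
    assume *: "x \<in> D" "y \<in> D" "ring_time \<omega> y j < ring_time \<omega> x i"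
    show "card {(z, k). z \<in> D \<and> ring_time \<omega> z k < ring_time \<omega> y j}
      < card {(z, k). z \<in> D \<and> ring_time \<omega> z k < ring_time \<omega> x i}"
      using * by (intro psubset_card_mono finite_rings assms) force
  qed
  then show ?thesis
    using wf_measure wf_subset by blast
qed

section \<open>Skeletons of trajectories\<close>

text \<open>
  The spin at a site changes only at rings there, so a trajectory is determined by the spins
  \<open>V x m\<close> that the sites \<open>x\<close> have after their first \<open>m\<close> rings. In these terms the dynamics is a
  recursion without reference to continuous time.
\<close>

definition skeleton_at :: "'d::finite noise \<Rightarrow> ('d site \<Rightarrow> nat \<Rightarrow> int) \<Rightarrow> 'd site \<Rightarrow> nat \<Rightarrow> int" where
  "skeleton_at \<omega> V x i =
     majority (\<lambda>y. V y (rings_before \<omega> y (ring_time \<omega> x i))) x (snd \<omega> (x, i))"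

definition skeleton :: "'d::finite noise \<Rightarrow> 'd config \<Rightarrow> ('d site \<Rightarrow> nat \<Rightarrow> int) \<Rightarrow> bool" where
  "skeleton \<omega> \<sigma>\<^sub>0 V \<longleftrightarrow> (\<forall>x. V x 0 = \<sigma>\<^sub>0 x) \<and> (\<forall>x i. V x (Suc i) = skeleton_at \<omega> V x i)"

lemma skeleton_in_spins:
  assumes "regular \<omega>" "skeleton \<omega> \<sigma>\<^sub>0 V" "\<And>x. \<sigma>\<^sub>0 x \<in> {1, - 1}"
  shows "V x m \<in> {1, - 1}"
proof (cases m)
  case (Suc i)
  then show ?thesis
    using assms(2) majority_in_spins[OF regular_spin[OF assms(1), of "(x, i)"]]
    unfolding skeleton_def skeleton_at_def by metis
qed (use assms in \<open>auto simp: skeleton_def\<close>)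

text \<open>The spin just before \<open>t\<close> is the one after the rings before \<open>t\<close>, since these do not accumulate.\<close>

lemma left_limit_eq:
  assumes reg: "regular \<omega>" and t: "t > 0"
    and const: "\<And>s. 0 \<le> s \<Longrightarrow> \<sigma> s y = V y (rings_upto \<omega> y s)"
  shows "left_limit \<sigma> t y = V y (rings_before \<omega> y t)"
proof -
  define m where "m = rings_before \<omega> y t"
  define a where "a = (if m = 0 then 0 else ring_time \<omega> y (m - 1))"
  have a: "0 \<le> a" "a < t"
    using t less_rings_before_iff[OF reg, of "m - 1" y t] ring_time_pos[OF reg, of y "m - 1"]
    by (auto simp: a_def m_def)
  have "\<sigma> s y = V y m" if s: "a < s" "s < t" for s
  proof -
    have "rings_upto \<omega> y s = m"
    proof (rule antisym)
      show "rings_upto \<omega> y s \<le> m"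
        using rings_upto_le_rings_before[OF reg] s by (simp add: m_def)
      show "m \<le> rings_upto \<omega> y s"
        using s less_rings_upto_iff[OF reg, of "m - 1" y s] by (cases m) (auto simp: a_def)
    qed
    then show ?thesis using const[of s] s a by simp
  qed
  then have "eventually (\<lambda>s. \<sigma> s y = V y m) (at_left t)"
    using a by (auto simp: eventually_at_left_field intro!: exI[of _ a])
  then have "((\<lambda>s. \<sigma> s y) \<longlongrightarrow> V y m) (at_left t)"
    by (rule tendsto_eventually)
  then show ?thesis
    unfolding left_limit_def m_def[symmetric] by (intro tendsto_Lim) auto
qed

lemma glauber_trajectory_imp_skeleton:
  assumes reg: "regular \<omega>" and traj: "glauber_trajectory \<omega> \<sigma>\<^sub>0 \<sigma>" and init: "\<And>x. \<sigma>\<^sub>0 x \<in> {1, - 1}"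
  obtains V where "skeleton \<omega> \<sigma>\<^sub>0 V" "\<And>t x. 0 \<le> t \<Longrightarrow> \<sigma> t x = V x (rings_upto \<omega> x t)"
proof
  define V where "V x m = (case m of 0 \<Rightarrow> \<sigma>\<^sub>0 x | Suc i \<Rightarrow> \<sigma> (ring_time \<omega> x i) x)" for x m
  have const: "\<sigma> t x = \<sigma> s x" if "0 \<le> s" "s \<le> t" "\<And>i. ring_time \<omega> x i \<notin> {s<..t}" for x s t
    using traj that unfolding glauber_trajectory_def by blast
  show V: "\<sigma> t x = V x (rings_upto \<omega> x t)" if t: "0 \<le> t" for t x
  proof (cases "rings_upto \<omega> x t")
    case 0
    then have "\<sigma> t x = \<sigma> 0 x"
      using t rings_upto_le_iff[OF reg, of x t] by (intro const) (auto simp: not_le)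
    then show ?thesis
      using 0 traj by (simp add: V_def glauber_trajectory_def)
  next
    case (Suc i)
    then have i: "ring_time \<omega> x i \<le> t"
      using less_rings_upto_iff[OF reg, of i x t] by simp
    have "\<sigma> t x = \<sigma> (ring_time \<omega> x i) x"
    proof (rule const)
      fix j
      have "j \<le> i \<longleftrightarrow> ring_time \<omega> x j \<le> t"
        using less_rings_upto_iff[OF reg, of j x t] Suc by auto
      then show "ring_time \<omega> x j \<notin> {ring_time \<omega> x i<..t}"
        using ring_time_le_iff[OF reg, of x j i] by auto
    qed (use i ring_time_pos[OF reg, of x i] in auto)
    then show ?thesis by (simp add: Suc V_def)
  qed
  have step: "V x (Suc i) = updated_spin (\<lambda>y. V y (rings_before \<omega> y (ring_time \<omega> x i))) x (snd \<omega> (x, i))" for x i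
  proof -
    have "left_limit \<sigma> (ring_time \<omega> x i) = (\<lambda>y. V y (rings_before \<omega> y (ring_time \<omega> x i)))"
      using left_limit_eq[OF reg ring_time_pos[OF reg], of \<sigma> _ V] V by auto
    moreover have "ring_time \<omega> x i > 0"
      by (rule ring_time_pos[OF reg])
    ultimately show ?thesis
      using traj by (simp add: V_def glauber_trajectory_def)
  qed
  have spins: "V x m \<in> {1, - 1}" for x m
  proof (induction m)
    case (Suc i)
    then show ?case
      using regular_spin[OF reg, of "(x, i)"] step[of x i] rings_before_ring_time[OF reg, of x i]
      by (auto simp: updated_spin_def)
  qed (use init in \<open>auto simp: V_def\<close>)
  have "V x (Suc i) = skeleton_at \<omega> V x i" for x i
    unfolding step skeleton_at_def by (rule updated_spin_eq_majority) (rule spins)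
  then show "skeleton \<omega> \<sigma>\<^sub>0 V"
    by (simp add: skeleton_def V_def[of _ 0])
qed

lemma skeleton_imp_glauber_trajectory:
  assumes reg: "regular \<omega>" and V: "skeleton \<omega> \<sigma>\<^sub>0 V" and init: "\<And>x. \<sigma>\<^sub>0 x \<in> {1, - 1}"
  shows "glauber_trajectory \<omega> \<sigma>\<^sub>0 (\<lambda>t x. V x (rings_upto \<omega> x t))"
  unfolding glauber_trajectory_def
proof (intro conjI allI impI)
  show "(\<lambda>x. V x (rings_upto \<omega> x 0)) = \<sigma>\<^sub>0"
    using V by (auto simp: rings_upto_0[OF reg] skeleton_def)
next
  fix x i
  have "left_limit (\<lambda>t x. V x (rings_upto \<omega> x t)) (ring_time \<omega> x i)
      = (\<lambda>y. V y (rings_before \<omega> y (ring_time \<omega> x i)))"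
    using left_limit_eq[OF reg ring_time_pos[OF reg]] by auto
  then show "V x (rings_upto \<omega> x (ring_time \<omega> x i)) =
    updated_spin (left_limit (\<lambda>t x. V x (rings_upto \<omega> x t)) (ring_time \<omega> x i)) x (snd \<omega> (x, i))"
    using V updated_spin_eq_majority[of "\<lambda>y. V y (rings_before \<omega> y (ring_time \<omega> x i))" x]
      skeleton_in_spins[OF reg V init]
    by (simp add: rings_upto_ring_time[OF reg] skeleton_def skeleton_at_def del: insert_iff)
next
  fix x s t
  assume *: "0 \<le> s \<and> s \<le> t \<and> (\<forall>i. ring_time \<omega> x i \<notin> {s<..t})"
  have "rings_upto \<omega> x t \<le> rings_upto \<omega> x s"
    using * by (metis greaterThanAtMost_iff less_rings_upto_iff[OF reg] linorder_not_less nless_le)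
  then have "rings_upto \<omega> x t = rings_upto \<omega> x s"
    using rings_upto_mono[OF reg] * by (intro antisym) auto
  then show "V x (rings_upto \<omega> x t) = V x (rings_upto \<omega> x s)" by simp
qed

section \<open>Influence along chronological paths\<close>

text \<open>
  A path of influence is listed backwards in time: the head is the influenced site, and the sites
  further down the list ring earlier. The time of the ring at the head bounds the times of the rest,
  which makes the notion recursive.
\<close>

fun chronological :: "'d::finite noise \<Rightarrow> real \<Rightarrow> real \<Rightarrow> 'd site list \<Rightarrow> bool" where
  "chronological \<omega> a s [] \<longleftrightarrow> True"
| "chronological \<omega> a s (x # xs) \<longleftrightarrow>
     (\<exists>i. a < ring_time \<omega> x i \<and> ring_time \<omega> x i < s \<and> (xs = [] \<or> hd xs \<in> neighbors x) \<and>
       chronological \<omega> a (ring_time \<omega> x i) xs)"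

lemma chronological_mono: "chronological \<omega> a s xs \<Longrightarrow> s \<le> t \<Longrightarrow> chronological \<omega> a t xs"
  by (cases xs) force+

lemma chronological_suffix: "chronological \<omega> a s (us @ xs) \<Longrightarrow> chronological \<omega> a s xs"
proof (induction us arbitrary: s)
  case (Cons u us)
  then obtain i where "ring_time \<omega> u i < s" "chronological \<omega> a (ring_time \<omega> u i) (us @ xs)"
    by auto
  then show ?case
    using Cons.IH chronological_mono less_imp_le by blast
qed simp

lemma chronological_prefix: "chronological \<omega> a s (us @ xs) \<Longrightarrow> chronological \<omega> a s us"
proof (induction us arbitrary: s)
  case (Cons u us)
  then show ?case by (cases us) force+
qed simp

lemma chronological_head_distance:
  assumes "chronological \<omega> a s xs" "xs \<noteq> []"
  shows "\<bar>last xs $ k - hd xs $ k\<bar> \<le> int (length xs) - 1"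
  using assms
proof (induction xs arbitrary: s)
  case (Cons x xs)
  show ?case
  proof (cases "xs = []")
    case False
    then obtain i where "hd xs \<in> neighbors x" "chronological \<omega> a (ring_time \<omega> x i) xs"
      using Cons.prems by auto
    then show ?thesis
      using Cons.IH[of "ring_time \<omega> x i"] neighbor_coordinate_le[of "hd xs" x k] False by auto
  qed simp
qed simp

text \<open>
  Between two visits to a site the path can be cut out, because the earlier ring serves the
  remaining path as well. Rings at distinct sites are independent.
\<close>

lemma chronological_distinct:
  assumes "chronological \<omega> a s xs" "xs \<noteq> []"
  obtains ys where "chronological \<omega> a s ys" "ys \<noteq> []" "hd ys = hd xs" "last ys = last xs"
    "distinct ys" "set ys \<subseteq> set xs"
  using assms
proof (induction xs arbitrary: s thesis)
  case (Cons x xs)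
  obtain i where i: "a < ring_time \<omega> x i" "ring_time \<omega> x i < s" "xs = [] \<or> hd xs \<in> neighbors x"
    "chronological \<omega> a (ring_time \<omega> x i) xs"
    using Cons.prems by auto
  show ?case
  proof (cases "xs = []")
    case True
    then show ?thesis using Cons.prems by (intro Cons.prems(1)[of "[x]"]) auto
  next
    case False
    obtain ys where ys: "chronological \<omega> a (ring_time \<omega> x i) ys" "ys \<noteq> []" "hd ys = hd xs"
      "last ys = last xs" "distinct ys" "set ys \<subseteq> set xs"
      using Cons.IH[OF _ i(4) False] by blast
    show ?thesis
    proof (cases "x \<in> set ys")
      case True
      then obtain us ws where us: "ys = us @ x # ws"
        by (meson split_list)
      have "chronological \<omega> a s (x # ws)"
        using ys(1) i(2) chronological_suffix chronological_mono us less_imp_le by metis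
      then show ?thesis
        using ys False by (intro Cons.prems(1)[of "x # ws"]) (auto simp: us)
    next
      case False
      then show ?thesis
        using ys i \<open>xs \<noteq> []\<close> by (intro Cons.prems(1)[of "x # ys"]) auto
    qed
  qed
qed simp

text \<open>Without such a path, nothing at distance \<open>n\<close> influences \<open>x\<close> during $(a,s)$.\<close>

definition fast_path :: "'d::finite noise \<Rightarrow> 'd site set \<Rightarrow> real \<Rightarrow> real \<Rightarrow> nat \<Rightarrow> 'd site \<Rightarrow> bool" where
  "fast_path \<omega> D a s n x \<longleftrightarrow>
     (\<exists>xs. length xs = n \<and> xs \<noteq> [] \<and> hd xs = x \<and> distinct xs \<and> set xs \<subseteq> D \<and> chronological \<omega> a s xs)"

lemma fast_pathI:
  assumes "chronological \<omega> a s xs" "xs \<noteq> []" "hd xs = x" "distinct xs" "set xs \<subseteq> D" "n \<le> length xs" "n > 0"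
  shows "fast_path \<omega> D a s n x"
  unfolding fast_path_def
proof (intro exI conjI)
  show "chronological \<omega> a s (take n xs)"
    using assms(1) chronological_prefix[of \<omega> a s "take n xs" "drop n xs"] by simp
  show "set (take n xs) \<subseteq> D"
    using assms(5) set_take_subset[of n xs] by blast
qed (use assms in auto)

text \<open>
  The comparison principle. If \<open>V\<close> starts below \<open>U\<close> on \<open>D\<close> at time \<open>a\<close> and gets above it later at
  some site of \<open>D\<close>, the reason is a difference at a neighbor shortly before, and so on; going
  backwards in time this can only stop by leaving \<open>D\<close>.
\<close>

lemma comparison:
  assumes reg: "regular \<omega>" and wf: "wf (precedes \<omega> D)"
    and U: "\<And>x i. x \<in> D \<Longrightarrow> rings_upto \<omega> x a \<le> i \<Longrightarrow> skeleton_at \<omega> U x i \<le> U x (Suc i)"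
    and V: "\<And>x i. x \<in> D \<Longrightarrow> rings_upto \<omega> x a \<le> i \<Longrightarrow> V x (Suc i) \<le> skeleton_at \<omega> V x i"
    and init: "\<And>x. x \<in> D \<Longrightarrow> V x (rings_upto \<omega> x a) \<le> U x (rings_upto \<omega> x a)"
    and x: "x \<in> D" "a < ring_time \<omega> x i" and viol: "U x (Suc i) < V x (Suc i)" and s: "ring_time \<omega> x i < s"
  obtains xs y where "chronological \<omega> a s xs" "xs \<noteq> []" "hd xs = x" "set xs \<subseteq> D"
    "y \<in> neighbors (last xs)" "y \<notin> D"
proof -
  have "\<forall>s. x \<in> D \<longrightarrow> a < ring_time \<omega> x i \<longrightarrow> U x (Suc i) < V x (Suc i) \<longrightarrow> ring_time \<omega> x i < s \<longrightarrow>
    (\<exists>xs y. chronological \<omega> a s xs \<and> xs \<noteq> [] \<and> hd xs = x \<and> set xs \<subseteq> D \<and> y \<in> neighbors (last xs) \<and> y \<notin> D)"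
    (is "?P x i")
    using wf
  proof (induction "(x, i)" arbitrary: x i rule: wf_induct_rule)
    case less
    show ?case
    proof (intro allI impI)
      fix s assume x: "x \<in> D" "a < ring_time \<omega> x i" and viol: "U x (Suc i) < V x (Suc i)"
        and s: "ring_time \<omega> x i < s"
      have i: "rings_upto \<omega> x a \<le> i"
        using x by (simp add: rings_upto_le_iff[OF reg])
      let ?b = "\<lambda>y. rings_before \<omega> y (ring_time \<omega> x i)"
      have "skeleton_at \<omega> U x i < skeleton_at \<omega> V x i"
        using U[OF x(1) i] V[OF x(1) i] viol by simp
      then have "\<exists>y\<in>neighbors x. \<not> V y (?b y) \<le> U y (?b y)"
        using majority_mono[OF regular_spin[OF reg, of "(x, i)"], of x "\<lambda>y. V y (?b y)" "\<lambda>y. U y (?b y)"]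
        unfolding skeleton_at_def by fastforce
      then obtain y where y: "y \<in> neighbors x" "U y (?b y) < V y (?b y)" by auto
      show "\<exists>xs y. chronological \<omega> a s xs \<and> xs \<noteq> [] \<and> hd xs = x \<and> set xs \<subseteq> D \<and> y \<in> neighbors (last xs) \<and> y \<notin> D"
      proof (cases "y \<in> D")
        case False
        then show ?thesis
          using x s y by (intro exI[of _ "[x]"] exI[of _ y]) auto
      next
        case True
        have le: "rings_upto \<omega> y a \<le> ?b y"
          by (rule rings_upto_le_rings_before[OF reg x(2)])
        have "?b y \<noteq> rings_upto \<omega> y a"
          using init[OF True] y by auto
        then obtain j where j: "?b y = Suc j" "rings_upto \<omega> y a \<le> j"
          using le by (cases "?b y") auto
        have tj: "a < ring_time \<omega> y j" "ring_time \<omega> y j < ring_time \<omega> x i"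
          using j rings_upto_le_iff[OF reg, of y a j] less_rings_before_iff[OF reg, of j y "ring_time \<omega> x i"]
          by auto
        have "((y, j), (x, i)) \<in> precedes \<omega> D"
          using True x y tj by (simp add: precedes_def)
        from less(1)[OF this] obtain xs z where xs:
          "chronological \<omega> a (ring_time \<omega> x i) xs" "xs \<noteq> []" "hd xs = y" "set xs \<subseteq> D" "z \<in> neighbors (last xs)" "z \<notin> D"
          using True tj y j by auto
        then show ?thesis
          using x s y by (intro exI[of _ "x # xs"] exI[of _ z]) auto
      qed
    qed
  qed
  then show ?thesis
    using x viol s that by blast
qed

text \<open>
  A minus spin near the center of \<open>D\<close> that the lower bound \<open>V\<close> does not explain has come from
  outside \<open>D\<close> and hence along a long path.
\<close>

lemma comparison_fast_path:
  assumes reg: "regular \<omega>" and wf: "wf (precedes \<omega> D)"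
    and U: "\<And>x i. x \<in> D \<Longrightarrow> rings_upto \<omega> x a \<le> i \<Longrightarrow> skeleton_at \<omega> U x i \<le> U x (Suc i)"
    and V: "\<And>x i. x \<in> D \<Longrightarrow> rings_upto \<omega> x a \<le> i \<Longrightarrow> V x (Suc i) \<le> skeleton_at \<omega> V x i"
    and init: "\<And>x. x \<in> D \<Longrightarrow> V x (rings_upto \<omega> x a) \<le> U x (rings_upto \<omega> x a)"
    and D: "\<And>y. (\<forall>k. \<bar>y $ k - x $ k\<bar> \<le> int n) \<Longrightarrow> y \<in> D"
    and fast: "n > 0" "\<not> fast_path \<omega> D a s n x" and t: "a \<le> t" "t < s"
  shows "V x (rings_upto \<omega> x t) \<le> U x (rings_upto \<omega> x t)"
proof (rule ccontr)
  assume not: "\<not> ?thesis"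
  have xD: "x \<in> D" using D by simp
  have "rings_upto \<omega> x t \<noteq> rings_upto \<omega> x a"
    using not init[OF xD] by auto
  then obtain i where i: "rings_upto \<omega> x t = Suc i" "rings_upto \<omega> x a \<le> i"
    using rings_upto_mono[OF reg t(1), of x] by (cases "rings_upto \<omega> x t") auto
  have ti: "a < ring_time \<omega> x i" "ring_time \<omega> x i < s"
    using i rings_upto_le_iff[OF reg, of x a i] less_rings_upto_iff[OF reg, of i x t] t by auto
  have "U x (Suc i) < V x (Suc i)" using not i by simp
  from comparison[OF reg wf U V init xD ti(1) this ti(2)]
  obtain xs y where xs: "chronological \<omega> a s xs" "xs \<noteq> []" "hd xs = x" "set xs \<subseteq> D"
    "y \<in> neighbors (last xs)" "y \<notin> D" by metis
  obtain ys where ys: "chronological \<omega> a s ys" "ys \<noteq> []" "hd ys = x" "last ys = last xs"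
      "distinct ys" "set ys \<subseteq> D"
    using chronological_distinct[OF xs(1,2)] xs by (metis (no_types) order_trans)
  obtain k where "\<not> \<bar>y $ k - x $ k\<bar> \<le> int n"
    using D xs(6) by blast
  then have "n \<le> length ys"
    using chronological_head_distance[OF ys(1,2), of k] neighbor_coordinate_le[OF xs(5), of k] ys by auto
  then have "fast_path \<omega> D a s n x"
    using ys fast by (intro fast_pathI) auto
  then show False using fast by simp
qed

section \<open>Existence and uniqueness of trajectories\<close>

definition finite_influence :: "'d::finite noise \<Rightarrow> bool" where
  "finite_influence \<omega> \<longleftrightarrow> (\<forall>x (H::nat). \<exists>n>0. \<not> fast_path \<omega> UNIV 0 (real H) n x)"

lemma finite_box: "finite {y :: 'd::finite site. \<forall>k. l k \<le> y $ k \<and> y $ k \<le> u k}"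
proof -
  have "{y. \<forall>k. l k \<le> y $ k \<and> y $ k \<le> u k} \<subseteq> vec_lambda ` (\<Pi>\<^sub>E k\<in>UNIV. {l k..u k})"
  proof
    fix y assume "y \<in> {y :: 'd site. \<forall>k. l k \<le> y $ k \<and> y $ k \<le> u k}"
    then have "vec_nth y \<in> (\<Pi>\<^sub>E k\<in>UNIV. {l k..u k})" by auto
    then show "y \<in> vec_lambda ` (\<Pi>\<^sub>E k\<in>UNIV. {l k..u k})"
      using image_eqI[of y vec_lambda "vec_nth y"] by (simp add: vec_nth_inverse)
  qed
  then show ?thesis
    by (rule finite_subset) (intro finite_imageI finite_PiE; simp)
qed

text \<open>
  An infinite chain of influences backwards in time stays near its starting point, since otherwise it
  would contain a long path; so it lives on finitely many sites, which ring finitely often.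
\<close>

lemma wf_precedes_UNIV:
  assumes reg: "regular \<omega>" and inf: "finite_influence \<omega>"
  shows "wf (precedes \<omega> UNIV)"
proof (rule ccontr)
  assume "\<not> wf (precedes \<omega> UNIV)"
  then obtain f where f: "\<And>k. (f (Suc k), f k) \<in> precedes \<omega> UNIV"
    by (auto simp: wf_iff_no_infinite_down_chain)
  define t where "t k = ring_time \<omega> (fst (f k)) (snd (f k))" for k
  have step: "fst (f (Suc k)) \<in> neighbors (fst (f k))" "t (Suc k) < t k" for k
    using f[of k] by (auto simp: precedes_def t_def)
  define x where "x = fst (f 0)"
  obtain H :: nat where H: "t 0 < real H"
    using reals_Archimedean2 by blast
  obtain n where n: "n > 0" "\<not> fast_path \<omega> UNIV 0 (real H) n x"
    using inf unfolding finite_influence_def by blast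
  have chron: "chronological \<omega> 0 s (map (fst \<circ> f) [j..<k])" if "j \<le> k" "t j < s" for j k s
    using that
  proof (induction "k - j" arbitrary: j s)
    case (Suc m)
    then have jk: "j < k" by simp
    have "chronological \<omega> 0 (t j) (map (fst \<circ> f) [Suc j..<k])"
      using Suc jk step(2)[of j] by (intro Suc.hyps(1)) auto
    moreover have "map (fst \<circ> f) [Suc j..<k] = [] \<or> hd (map (fst \<circ> f) [Suc j..<k]) \<in> neighbors (fst (f j))"
      using step(1)[of j] by (cases "Suc j < k") (simp_all add: upt_conv_Cons)
    ultimately show ?case
      using jk Suc.prems ring_time_pos[OF reg, of "fst (f j)" "snd (f j)"]
      by (auto simp: upt_conv_Cons t_def intro!: exI[of _ "snd (f j)"])
  qed simp
  define D where "D = {y. \<forall>k. x $ k - int n \<le> y $ k \<and> y $ k \<le> x $ k + int n}"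
  have D: "fst (f k) \<in> D" for k
  proof -
    have c: "chronological \<omega> 0 (real H) (map (fst \<circ> f) [0..<Suc k])"
      using H by (intro chron) auto
    have "map (fst \<circ> f) [0..<Suc k] \<noteq> []" by simp
    from chronological_distinct[OF c this] obtain ys where ys: "chronological \<omega> 0 (real H) ys" "ys \<noteq> []"
      "hd ys = hd (map (fst \<circ> f) [0..<Suc k])" "last ys = last (map (fst \<circ> f) [0..<Suc k])" "distinct ys"
      by metis
    have hd: "hd ys = x" using ys(3) by (simp add: x_def upt_conv_Cons del: upt_Suc)
    have la: "last ys = fst (f k)" using ys(4) by simp
    have "length ys < n"
    proof (rule ccontr)
      assume "\<not> length ys < n"
      then have "fast_path \<omega> UNIV 0 (real H) n x"
        using ys hd n by (intro fast_pathI[where xs = ys]) auto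
      then show False using n by simp
    qed
    then have "\<bar>fst (f k) $ j - x $ j\<bar> \<le> int n" for j
      using chronological_head_distance[OF ys(1,2), of j] hd la by auto
    then show ?thesis by (auto simp: D_def abs_le_iff algebra_simps)
  qed
  have "(f (Suc k), f k) \<in> precedes \<omega> D" for k
    using f[of k] D[of k] D[of "Suc k"] by (auto simp: precedes_def)
  moreover have "wf (precedes \<omega> D)"
    unfolding D_def by (intro wf_precedes_finite[OF reg] finite_box)
  ultimately show False
    by (auto simp: wf_iff_no_infinite_down_chain)
qed

text \<open>
  The dynamics in \<open>\<Lambda>\<close> with the outside frozen, computed with \<open>n\<close> levels of recursion. The level
  makes this a definition for every \<open>\<omega>\<close>, visibly measurable in \<open>\<omega>\<close> and depending on the noise in
  \<open>\<Lambda>\<close> only; as \<open>n\<close> grows the values stabilize.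
\<close>

fun approximation :: "'d::finite site set \<Rightarrow> 'd config \<Rightarrow> nat \<Rightarrow> 'd noise \<Rightarrow> 'd site \<Rightarrow> nat \<Rightarrow> int" where
  "approximation \<Lambda> \<sigma>\<^sub>0 (Suc n) \<omega> x (Suc i) =
     (if x \<in> \<Lambda> then majority (\<lambda>y. approximation \<Lambda> \<sigma>\<^sub>0 n \<omega> y (rings_before \<omega> y (ring_time \<omega> x i))) x (snd \<omega> (x, i))
      else \<sigma>\<^sub>0 x)"
| "approximation \<Lambda> \<sigma>\<^sub>0 0 \<omega> x i = \<sigma>\<^sub>0 x"
| "approximation \<Lambda> \<sigma>\<^sub>0 n \<omega> x 0 = \<sigma>\<^sub>0 x"

lemma approximation_outside [simp]: "x \<notin> \<Lambda> \<Longrightarrow> approximation \<Lambda> \<sigma>\<^sub>0 n \<omega> x m = \<sigma>\<^sub>0 x"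
  by (cases n; cases m) auto

lemma approximation_0 [simp]: "approximation \<Lambda> \<sigma>\<^sub>0 n \<omega> x 0 = \<sigma>\<^sub>0 x"
  by (cases n) auto

definition local_skeleton :: "'d::finite site set \<Rightarrow> 'd config \<Rightarrow> 'd noise \<Rightarrow> 'd site \<Rightarrow> nat \<Rightarrow> int" where
  "local_skeleton \<Lambda> \<sigma>\<^sub>0 \<omega> x m =
     (THE c. \<forall>\<^sub>F n in sequentially. approximation \<Lambda> \<sigma>\<^sub>0 n \<omega> x m = c)"

context
  fixes \<omega> :: "'d::finite noise" and \<Lambda> :: "'d site set" and \<sigma>\<^sub>0 :: "'d config"
  assumes reg: "regular \<omega>" and wf: "wf (precedes \<omega> \<Lambda>)"
begin

lemma approximation_stabilizes:
  "\<exists>c. \<forall>\<^sub>F n in sequentially. approximation \<Lambda> \<sigma>\<^sub>0 n \<omega> x m = c"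
proof -
  have *: "x \<in> \<Lambda> \<longrightarrow> (\<exists>c. \<forall>\<^sub>F n in sequentially. approximation \<Lambda> \<sigma>\<^sub>0 n \<omega> x (Suc i) = c)" for x i
    using wf
  proof (induction "(x, i)" arbitrary: x i rule: wf_induct_rule)
    case less
    show ?case
    proof
      assume x: "x \<in> \<Lambda>"
      let ?b = "\<lambda>y. rings_before \<omega> y (ring_time \<omega> x i)"
      have "\<exists>c. \<forall>\<^sub>F n in sequentially. approximation \<Lambda> \<sigma>\<^sub>0 n \<omega> y (?b y) = c" if y: "y \<in> neighbors x" for y
      proof (cases "y \<in> \<Lambda> \<and> ?b y \<noteq> 0")
        case True
        then obtain j where j: "?b y = Suc j" by (cases "?b y") auto
        then have "((y, j), (x, i)) \<in> precedes \<omega> \<Lambda>"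
          using x y True less_rings_before_iff[OF reg, of j y "ring_time \<omega> x i"] by (simp add: precedes_def)
        from less(1)[OF this] show ?thesis using True j by simp
      qed auto
      then obtain c where c: "\<And>y. y \<in> neighbors x \<Longrightarrow> \<forall>\<^sub>F n in sequentially. approximation \<Lambda> \<sigma>\<^sub>0 n \<omega> y (?b y) = c y"
        by metis
      have "\<forall>\<^sub>F n in sequentially. \<forall>y\<in>neighbors x. approximation \<Lambda> \<sigma>\<^sub>0 n \<omega> y (?b y) = c y"
        using c by (intro eventually_ball_finite) auto
      then have "\<forall>\<^sub>F n in sequentially. approximation \<Lambda> \<sigma>\<^sub>0 (Suc n) \<omega> x (Suc i) = majority c x (snd \<omega> (x, i))"
        by eventually_elim (use x in \<open>auto intro: majority_cong\<close>)
      then show "\<exists>c. \<forall>\<^sub>F n in sequentially. approximation \<Lambda> \<sigma>\<^sub>0 n \<omega> x (Suc i) = c"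
        using eventually_sequentially_Suc[of "\<lambda>n. approximation \<Lambda> \<sigma>\<^sub>0 n \<omega> x (Suc i) = majority c x (snd \<omega> (x, i))"]
        by blast
    qed
  qed
  show ?thesis
    using *[of x] by (cases m; cases "x \<in> \<Lambda>") auto
qed

lemma eventually_approximation_eq:
  "\<forall>\<^sub>F n in sequentially. approximation \<Lambda> \<sigma>\<^sub>0 n \<omega> x m = local_skeleton \<Lambda> \<sigma>\<^sub>0 \<omega> x m"
proof -
  obtain c where c: "\<forall>\<^sub>F n in sequentially. approximation \<Lambda> \<sigma>\<^sub>0 n \<omega> x m = c"
    using approximation_stabilizes by blast
  have "d = c" if d: "\<forall>\<^sub>F n in sequentially. approximation \<Lambda> \<sigma>\<^sub>0 n \<omega> x m = d" for d
  proof -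
    obtain n where "approximation \<Lambda> \<sigma>\<^sub>0 n \<omega> x m = c \<and> approximation \<Lambda> \<sigma>\<^sub>0 n \<omega> x m = d"
      using eventually_happens'[OF sequentially_bot eventually_conj[OF c d]] by blast
    then show ?thesis by metis
  qed
  then have "local_skeleton \<Lambda> \<sigma>\<^sub>0 \<omega> x m = c"
    unfolding local_skeleton_def using c by (rule the_equality[rotated])
  with c show ?thesis by metis
qed

lemma local_skeleton_eqI:
  assumes c: "\<forall>\<^sub>F n in sequentially. approximation \<Lambda> \<sigma>\<^sub>0 n \<omega> x m = c"
  shows "local_skeleton \<Lambda> \<sigma>\<^sub>0 \<omega> x m = c"
proof -
  obtain n where "approximation \<Lambda> \<sigma>\<^sub>0 n \<omega> x m = local_skeleton \<Lambda> \<sigma>\<^sub>0 \<omega> x m \<and>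
      approximation \<Lambda> \<sigma>\<^sub>0 n \<omega> x m = c"
    using eventually_happens'[OF sequentially_bot eventually_conj[OF eventually_approximation_eq c]] by blast
  then show ?thesis by simp
qed

lemma local_skeleton_0: "local_skeleton \<Lambda> \<sigma>\<^sub>0 \<omega> x 0 = \<sigma>\<^sub>0 x"
  by (rule local_skeleton_eqI) simp

lemma local_skeleton_outside: "x \<notin> \<Lambda> \<Longrightarrow> local_skeleton \<Lambda> \<sigma>\<^sub>0 \<omega> x m = \<sigma>\<^sub>0 x"
  by (rule local_skeleton_eqI) simp

lemma local_skeleton_Suc:
  assumes "x \<in> \<Lambda>"
  shows "local_skeleton \<Lambda> \<sigma>\<^sub>0 \<omega> x (Suc i) = skeleton_at \<omega> (local_skeleton \<Lambda> \<sigma>\<^sub>0 \<omega>) x i"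
proof (rule local_skeleton_eqI)
  let ?b = "\<lambda>y. rings_before \<omega> y (ring_time \<omega> x i)"
  have "\<forall>\<^sub>F n in sequentially. \<forall>y\<in>neighbors x.
      approximation \<Lambda> \<sigma>\<^sub>0 n \<omega> y (?b y) = local_skeleton \<Lambda> \<sigma>\<^sub>0 \<omega> y (?b y)"
    using eventually_approximation_eq by (intro eventually_ball_finite) auto
  then have "\<forall>\<^sub>F n in sequentially. approximation \<Lambda> \<sigma>\<^sub>0 (Suc n) \<omega> x (Suc i)
      = skeleton_at \<omega> (local_skeleton \<Lambda> \<sigma>\<^sub>0 \<omega>) x i"
    by eventually_elim (use assms in \<open>auto simp: skeleton_at_def intro: majority_cong\<close>)
  then show "\<forall>\<^sub>F n in sequentially. approximation \<Lambda> \<sigma>\<^sub>0 n \<omega> x (Suc i)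
      = skeleton_at \<omega> (local_skeleton \<Lambda> \<sigma>\<^sub>0 \<omega>) x i"
    by (rule eventually_sequentially_Suc[THEN iffD1])
qed

end

text \<open>On the whole lattice, a difference between two skeletons has nowhere to come from.\<close>

lemma skeleton_le:
  assumes reg: "regular \<omega>" and wf: "wf (precedes \<omega> UNIV)"
    and U: "skeleton \<omega> \<sigma>\<^sub>0 U" and V: "skeleton \<omega> \<sigma>\<^sub>0 V"
  shows "V x m \<le> U x m"
proof (cases m)
  case (Suc i)
  show ?thesis
  proof (rule ccontr)
    assume "\<not> V x m \<le> U x m"
    then have viol: "U x (Suc i) < V x (Suc i)" using Suc by simp
    have pos: "0 < ring_time \<omega> x i" "ring_time \<omega> x i < ring_time \<omega> x i + 1"
      using ring_time_pos[OF reg] by auto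
    show False
      by (rule comparison[OF reg wf, where a = 0 and U = U and V = V and x = x, OF _ _ _ _ pos(1) viol pos(2)])
        (use U V in \<open>auto simp: skeleton_def rings_upto_0[OF reg]\<close>)
  qed
qed (use U V in \<open>auto simp: skeleton_def\<close>)

text \<open>
  The choice in \<^const>\<open>glauber\<close> is made among actual trajectories, because the limit of the
  approximations on the whole lattice is the skeleton of one.
\<close>

lemma glauber_skeleton:
  assumes reg: "regular \<omega>" and inf: "finite_influence \<omega>" and init: "\<And>x. \<sigma>\<^sub>0 x \<in> {1, - 1}"
  obtains V where "skeleton \<omega> \<sigma>\<^sub>0 V" "\<And>t x. 0 \<le> t \<Longrightarrow> glauber \<omega> \<sigma>\<^sub>0 t x = V x (rings_upto \<omega> x t)"
proof -
  have wf: "wf (precedes \<omega> UNIV)" by (rule wf_precedes_UNIV[OF reg inf])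
  have "skeleton \<omega> \<sigma>\<^sub>0 (local_skeleton UNIV \<sigma>\<^sub>0 \<omega>)"
    using local_skeleton_0[OF reg wf] local_skeleton_Suc[OF reg wf] by (auto simp: skeleton_def)
  from skeleton_imp_glauber_trajectory[OF reg this init]
  have traj: "glauber_trajectory \<omega> \<sigma>\<^sub>0 (glauber \<omega> \<sigma>\<^sub>0)"
    unfolding glauber_def by (rule someI[where P = "glauber_trajectory \<omega> \<sigma>\<^sub>0"])
  show ?thesis
    by (rule glauber_trajectory_imp_skeleton[OF reg traj init]) (rule that)
qed

section \<open>Erosion of a cube\<close>

lemma finite_cube [simp]: "finite (cube L :: 'd::finite site set)"
proof -
  have "cube L \<subseteq> {y :: 'd site. \<forall>k. 0 \<le> y $ k \<and> y $ k \<le> int L}"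
    by (auto simp: cube_def less_imp_le)
  then show ?thesis
    by (rule finite_subset) (rule finite_box)
qed

text \<open>
  A neighbor of \<open>x\<close> inside a box that does not contain \<open>x\<close> is one step away in the coordinate
  that keeps \<open>x\<close> out.
\<close>

lemma box_neighbor_unique:
  fixes x y z :: "'d::finite site"
  assumes "x \<notin> {x. \<forall>k. l k \<le> x $ k \<and> x $ k \<le> u k}"
    and y: "y \<in> neighbors x" "y \<in> {x. \<forall>k. l k \<le> x $ k \<and> x $ k \<le> u k}"
    and z: "z \<in> neighbors x" "z \<in> {x. \<forall>k. l k \<le> x $ k \<and> x $ k \<le> u k}"
  shows "y = z"
proof -
  obtain k where k: "\<not> (l k \<le> x $ k \<and> x $ k \<le> u k)" using assms(1) by auto
  have b: "l k \<le> y $ k" "y $ k \<le> u k" "l k \<le> z $ k" "z $ k \<le> u k"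
    using y z by auto
  have ne: "y $ k \<noteq> x $ k" "z $ k \<noteq> x $ k" using k b by auto
  have "y $ k = z $ k"
    using k b neighbor_coordinate_le[OF y(1), of k] neighbor_coordinate_le[OF z(1), of k] by linarith
  moreover have "y $ j = z $ j" if "j \<noteq> k" for j
    using neighbor_other_coordinates_eq[OF y(1) ne(1) that] neighbor_other_coordinates_eq[OF z(1) ne(2) that]
    by simp
  ultimately show ?thesis
    unfolding vec_eq_iff by metis
qed

lemma cube_eq_box: "cube L = {x :: 'd::finite site. \<forall>k. 0 \<le> x $ k \<and> x $ k \<le> int L - 1}"
  by (auto simp: cube_def)

text \<open>
  The outside of a cube of minus spins stays $+1$ by itself, so freezing it is no restriction, and
  the dynamics is one of finitely many sites.
\<close>

abbreviation "cube_skeleton L \<equiv> local_skeleton (cube L) (cube_init L)"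

definition erodes :: "nat \<Rightarrow> real \<Rightarrow> 'd::finite noise \<Rightarrow> bool" where
  "erodes L c \<omega> \<longleftrightarrow> (\<forall>\<^sub>F n in sequentially. \<forall>x\<in>cube L.
     approximation (cube L) (cube_init L) n \<omega> x (rings_upto \<omega> x c) = 1)"

lemma cube_init_in_spins: "cube_init L x \<in> {1, - 1}"
  by (simp add: cube_init_def)

context
  fixes \<omega> :: "'d::finite noise" and L :: nat
  assumes reg: "regular \<omega>"
begin

lemmas wf_cube = wf_precedes_finite[OF reg finite_cube[of L]]

lemma cube_skeleton_0: "cube_skeleton L \<omega> x 0 = cube_init L x"
  by (rule local_skeleton_0[OF reg wf_cube])

lemma cube_skeleton_outside: "x \<notin> cube L \<Longrightarrow> cube_skeleton L \<omega> x m = 1"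
  using local_skeleton_outside[OF reg wf_cube] by (simp add: cube_init_def)

lemma cube_skeleton_Suc:
  "x \<in> cube L \<Longrightarrow> cube_skeleton L \<omega> x (Suc i) = skeleton_at \<omega> (cube_skeleton L \<omega>) x i"
  by (rule local_skeleton_Suc[OF reg wf_cube])

lemma cube_skeleton_in_spins: "cube_skeleton L \<omega> x m \<in> {1, - 1}"
proof (cases "x \<in> cube L")
  case True
  show ?thesis
  proof (cases m)
    case (Suc i)
    then show ?thesis
      using cube_skeleton_Suc[OF True, of i] majority_in_spins[OF regular_spin[OF reg, of "(x, i)"]]
      unfolding skeleton_at_def by metis
  qed (use cube_init_in_spins in \<open>auto simp: cube_skeleton_0 simp del: insert_iff\<close>)
qed (simp add: cube_skeleton_outside)

lemma cube_skeleton_is_skeleton: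
  assumes d: "CARD('d) \<ge> 2"
  shows "skeleton \<omega> (cube_init L) (cube_skeleton L \<omega>)"
proof -
  have "skeleton_at \<omega> (cube_skeleton L \<omega>) x i = 1" if "x \<notin> cube L" for x i
    unfolding skeleton_at_def
  proof (rule majority_eq_1[OF d])
    fix y z
    let ?V = "\<lambda>y. cube_skeleton L \<omega> y (rings_before \<omega> y (ring_time \<omega> x i))"
    assume *: "y \<in> neighbors x" "z \<in> neighbors x" "?V y \<noteq> 1" "?V z \<noteq> 1"
    then have "y \<in> cube L" "z \<in> cube L" using cube_skeleton_outside by metis+
    then show "y = z"
      using box_neighbor_unique[of x "\<lambda>_. 0" "\<lambda>_. int L - 1" y z] * that unfolding cube_eq_box by metis
  qed (rule cube_skeleton_in_spins)
  then show ?thesis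
    unfolding skeleton_def using cube_skeleton_0 cube_skeleton_Suc cube_skeleton_outside by metis
qed

lemma erodes_iff:
  "erodes L c \<omega> \<longleftrightarrow> (\<forall>x\<in>cube L. cube_skeleton L \<omega> x (rings_upto \<omega> x c) = 1)"
proof -
  have ev: "\<forall>\<^sub>F n in sequentially. \<forall>x\<in>cube L.
    approximation (cube L) (cube_init L) n \<omega> x (rings_upto \<omega> x c) = cube_skeleton L \<omega> x (rings_upto \<omega> x c)"
    using eventually_approximation_eq[OF reg wf_cube] by (intro eventually_ball_finite) auto
  show ?thesis
  proof
    assume "erodes L c \<omega>"
    then obtain n where "\<forall>x\<in>cube L. approximation (cube L) (cube_init L) n \<omega> x (rings_upto \<omega> x c) = 1"
      "\<forall>x\<in>cube L. approximation (cube L) (cube_init L) n \<omega> x (rings_upto \<omega> x c)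
        = cube_skeleton L \<omega> x (rings_upto \<omega> x c)"
      using eventually_happens'[OF sequentially_bot eventually_conj[OF ev, unfolded erodes_def]]
      unfolding erodes_def by blast
    then show "\<forall>x\<in>cube L. cube_skeleton L \<omega> x (rings_upto \<omega> x c) = 1" by simp
  next
    assume "\<forall>x\<in>cube L. cube_skeleton L \<omega> x (rings_upto \<omega> x c) = 1"
    then show "erodes L c \<omega>"
      unfolding erodes_def using ev by (auto elim: eventually_mono)
  qed
qed

text \<open>All neighbors of a site are $+1$ after the cube has eroded, so it stays eroded.\<close>

lemma eroded_forever:
  assumes er: "erodes L c \<omega>" and m: "rings_upto \<omega> x c \<le> m"
  shows "cube_skeleton L \<omega> x m = 1"
proof -
  have er': "cube_skeleton L \<omega> x (rings_upto \<omega> x c) = 1" for x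
    using er cube_skeleton_outside unfolding erodes_iff by blast
  have *: "rings_upto \<omega> x c \<le> i \<longrightarrow> cube_skeleton L \<omega> x (Suc i) = 1" for x i
    using wf_cube
  proof (induction "(x, i)" arbitrary: x i rule: wf_induct_rule)
    case less
    show ?case
    proof
      assume i: "rings_upto \<omega> x c \<le> i"
      show "cube_skeleton L \<omega> x (Suc i) = 1"
      proof (cases "x \<in> cube L")
        case True
        let ?b = "\<lambda>y. rings_before \<omega> y (ring_time \<omega> x i)"
        have "cube_skeleton L \<omega> y (?b y) = 1" if y: "y \<in> neighbors x" for y
        proof (cases "y \<in> cube L \<and> ?b y \<noteq> rings_upto \<omega> y c")
          case False
          then show ?thesis using er'[of y] cube_skeleton_outside by metis
        next
          case T: True
          have "c < ring_time \<omega> x i" using i by (simp add: rings_upto_le_iff[OF reg])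
          from rings_upto_le_rings_before[OF reg this, of y] T
          obtain j where j: "?b y = Suc j" "rings_upto \<omega> y c \<le> j" by (cases "?b y") auto
          then have "((y, j), (x, i)) \<in> precedes \<omega> (cube L)"
            using True T y less_rings_before_iff[OF reg, of j y "ring_time \<omega> x i"] by (simp add: precedes_def)
          from less(1)[OF this] show ?thesis using j by simp
        qed
        then have "majority (\<lambda>y. cube_skeleton L \<omega> y (?b y)) x (snd \<omega> (x, i)) = 1"
          by (rule majority_all_1)
        then show ?thesis
          using cube_skeleton_Suc[OF True] by (simp add: skeleton_at_def)
      qed (simp add: cube_skeleton_outside)
    qed
  qed
  show ?thesis
    using er'[of x] *[of x "m - 1"] m by (cases "m = rings_upto \<omega> x c") auto
qed

lemma erodes_mono: "erodes L c \<omega> \<Longrightarrow> c \<le> c' \<Longrightarrow> erodes L c' \<omega>"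
  using eroded_forever rings_upto_mono[OF reg] unfolding erodes_iff by blast

lemma glauber_cube:
  assumes d: "CARD('d) \<ge> 2" and inf: "finite_influence \<omega>" and t: "0 \<le> t"
  shows "glauber \<omega> (cube_init L) t x = cube_skeleton L \<omega> x (rings_upto \<omega> x t)"
proof -
  obtain V where V: "skeleton \<omega> (cube_init L) V"
    "\<And>t x. 0 \<le> t \<Longrightarrow> glauber \<omega> (cube_init L) t x = V x (rings_upto \<omega> x t)"
    by (rule glauber_skeleton[OF reg inf, of "cube_init L", OF cube_init_in_spins]) (rule that)
  have "V x m = cube_skeleton L \<omega> x m" for x m
    using skeleton_le[OF reg wf_precedes_UNIV[OF reg inf]] V(1) cube_skeleton_is_skeleton[OF d]
    by (intro antisym) blast+
  then show ?thesis using V(2)[OF t] by simp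
qed

text \<open>
  The time of erosion is attained: the finitely many sites of the cube do not ring during some
  interval after \<open>c\<close>.
\<close>

lemma erosion_time_le_iff:
  assumes d: "CARD('d) \<ge> 2" and inf: "finite_influence \<omega>" and c: "0 \<le> c"
  shows "erosion_time L \<omega> \<le> ereal c \<longleftrightarrow> erodes L c \<omega>"
proof -
  let ?E = "{t. 0 \<le> t \<and> (\<forall>x\<in>cube L. glauber \<omega> (cube_init L) t x = 1)}"
  have E: "?E = {t. 0 \<le> t \<and> erodes L t \<omega>}"
    using glauber_cube[OF d inf] by (auto simp: erodes_iff)
  show ?thesis
  proof
    assume "erodes L c \<omega>"
    then show "erosion_time L \<omega> \<le> ereal c"
      unfolding erosion_time_def E using c by (intro Inf_lower) auto
  next
    assume le: "erosion_time L \<omega> \<le> ereal c"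
    define e where "e = Min (insert 1 ((\<lambda>x. ring_time \<omega> x (rings_upto \<omega> x c) - c) ` cube L))"
    have "c < ring_time \<omega> x (rings_upto \<omega> x c)" for x
      using rings_upto_le_iff[OF reg, of x c "rings_upto \<omega> x c"] by simp
    then have e: "e > 0" unfolding e_def by (subst Min_gr_iff) auto
    have e2: "c + e \<le> ring_time \<omega> x (rings_upto \<omega> x c)" if "x \<in> cube L" for x
    proof -
      have "e \<le> ring_time \<omega> x (rings_upto \<omega> x c) - c"
        unfolding e_def using that by (intro Min_le) auto
      then show ?thesis by simp
    qed
    have "erosion_time L \<omega> < ereal (c + e)"
      using order.strict_trans1[OF le, of "ereal (c + e)"] e by simp
    then obtain t where t: "0 \<le> t" "erodes L t \<omega>" "t < c + e"
      unfolding erosion_time_def E Inf_less_iff by auto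
    show "erodes L c \<omega>"
    proof (cases "t \<le> c")
      case True
      then show ?thesis using t erodes_mono by blast
    next
      case False
      have "rings_upto \<omega> x t = rings_upto \<omega> x c" if "x \<in> cube L" for x
        using False t(3) e2[OF that] rings_upto_mono[OF reg, of c t x]
        by (intro antisym) (auto simp: rings_upto_le_iff[OF reg])
      then show ?thesis using t(2) by (simp add: erodes_iff)
    qed
  qed
qed

end

section \<open>Restarting the dynamics\<close>

text \<open>
  The noise seen from the site \<open>v\<close> after time \<open>t\<close>. The first waiting time is what remains of the
  current one, and the ring numbers are shifted by an amount that depends on the site.
\<close>

definition restart :: "'d::finite site \<Rightarrow> real \<Rightarrow> 'd noise \<Rightarrow> 'd noise" where
  "restart v t \<omega> =
     ((\<lambda>(x, i). if i = 0 then ring_time \<omega> (x + v) (rings_upto \<omega> (x + v) t) - t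
                else fst \<omega> (x + v, rings_upto \<omega> (x + v) t + i)),
      (\<lambda>(x, i). snd \<omega> (x + v, rings_upto \<omega> (x + v) t + i)))"

lemma ring_time_restart:
  "ring_time (restart v t \<omega>) x i = ring_time \<omega> (x + v) (rings_upto \<omega> (x + v) t + i) - t"
proof (induction i)
  case 0
  show ?case
    unfolding ring_time_def[of "restart v t \<omega>"] by (simp add: restart_def)
next
  case (Suc i)
  have "ring_time \<omega>' x (Suc i) = ring_time \<omega>' x i + fst \<omega>' (x, Suc i)" for \<omega>' :: "'a noise" and x i
    by (simp add: ring_time_def)
  then show ?case using Suc by (simp add: restart_def)
qed

lemma snd_restart: "snd (restart v t \<omega>) (x, i) = snd \<omega> (x + v, rings_upto \<omega> (x + v) t + i)"
  by (simp add: restart_def)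

lemma regular_restart:
  assumes reg: "regular \<omega>"
  shows "regular (restart v t \<omega>)"
proof -
  have "t < ring_time \<omega> x (rings_upto \<omega> x t)" for x
    using rings_upto_le_iff[OF reg, of x t "rings_upto \<omega> x t"] by simp
  moreover have "\<exists>i. b < ring_time (restart v t \<omega>) x i" for b x
  proof -
    obtain i where "b + t < ring_time \<omega> (x + v) i"
      using reg unfolding regular_def by blast
    also have "ring_time \<omega> (x + v) i \<le> ring_time \<omega> (x + v) (rings_upto \<omega> (x + v) t + i)"
      by (simp add: ring_time_le_iff[OF reg])
    finally show ?thesis by (auto simp: ring_time_restart intro!: exI[of _ i])
  qed
  ultimately show ?thesis
    using reg unfolding regular_def by (auto simp: restart_def)
qed

lemma rings_before_restart:
  assumes reg: "regular \<omega>"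
  shows "rings_before (restart v t \<omega>) x s = rings_before \<omega> (x + v) (t + s) - rings_upto \<omega> (x + v) t"
proof -
  have "i < rings_before (restart v t \<omega>) x s \<longleftrightarrow> i < rings_before \<omega> (x + v) (t + s) - rings_upto \<omega> (x + v) t" for i
    unfolding less_rings_before_iff[OF regular_restart[OF reg]] ring_time_restart less_diff_conv
    using less_rings_before_iff[OF reg, of "rings_upto \<omega> (x + v) t + i" "x + v" "t + s"]
    by (simp add: add.commute less_diff_eq) (metis add.commute diff_less_eq)
  then show ?thesis by (metis linorder_neqE_nat order_less_irrefl)
qed

lemma rings_upto_restart:
  assumes reg: "regular \<omega>"
  shows "rings_upto (restart v t \<omega>) x s = rings_upto \<omega> (x + v) (t + s) - rings_upto \<omega> (x + v) t"
proof -
  have "i < rings_upto (restart v t \<omega>) x s \<longleftrightarrow> i < rings_upto \<omega> (x + v) (t + s) - rings_upto \<omega> (x + v) t" for i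
    unfolding less_rings_upto_iff[OF regular_restart[OF reg]] ring_time_restart less_diff_conv
    using less_rings_upto_iff[OF reg, of "rings_upto \<omega> (x + v) t + i" "x + v" "t + s"]
    by (simp add: add.commute diff_le_eq)
  then show ?thesis by (metis linorder_neqE_nat order_less_irrefl)
qed

text \<open>
  The evolution after time \<open>t\<close> of a cube with corner \<open>v\<close> that is all $-1$ at time \<open>t\<close>, in the
  coordinates and ring numbers of the original noise.
\<close>

definition restarted_cube :: "nat \<Rightarrow> 'd::finite site \<Rightarrow> real \<Rightarrow> 'd noise \<Rightarrow> 'd site \<Rightarrow> nat \<Rightarrow> int" where
  "restarted_cube L v t \<omega> y m = cube_skeleton L (restart v t \<omega>) (y - v) (m - rings_upto \<omega> y t)"

lemma restarted_cube_Suc: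
  assumes reg: "regular \<omega>" and y: "y - v \<in> cube L" and i: "rings_upto \<omega> y t \<le> i"
  shows "restarted_cube L v t \<omega> y (Suc i) = skeleton_at \<omega> (restarted_cube L v t \<omega>) y i"
proof -
  let ?\<omega> = "restart v t \<omega>" and ?N = "\<lambda>y. rings_upto \<omega> y t"
  have "restarted_cube L v t \<omega> y (Suc i) = cube_skeleton L ?\<omega> (y - v) (Suc (i - ?N y))"
    using i by (simp add: restarted_cube_def Suc_diff_le)
  also have "\<dots> = skeleton_at ?\<omega> (cube_skeleton L ?\<omega>) (y - v) (i - ?N y)"
    by (rule cube_skeleton_Suc[OF regular_restart[OF reg] y])
  also have "\<dots> = majority (\<lambda>z. restarted_cube L v t \<omega> (z + v) (rings_before \<omega> (z + v) (ring_time \<omega> y i)))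
      (y - v) (snd \<omega> (y, i))"
    using i by (simp add: skeleton_at_def snd_restart restarted_cube_def rings_before_restart[OF reg] ring_time_restart)
  also have "\<dots> = majority (\<lambda>z. restarted_cube L v t \<omega> z (rings_before \<omega> z (ring_time \<omega> y i)))
      (y - v + v) (snd \<omega> (y, i))"
    by (rule majority_shift[symmetric])
  finally show ?thesis by (simp add: skeleton_at_def)
qed

text \<open>
  If the minus spins at time \<open>t\<close> are covered by well separated boxes \<open>Q i\<close>, then the boxes cannot
  help each other: a site between them sees at most one minus neighbor. So the configuration
  stays above the superposition of the erosions of the separate cubes that contain the boxes.
\<close>

lemma separated_boxes_erode:
  fixes \<omega> :: "'d::finite noise" and l u :: "'i \<Rightarrow> 'd \<Rightarrow> int"
  defines "Q \<equiv> \<lambda>i. {y :: 'd site. \<forall>k. l i k \<le> y $ k \<and> y $ k \<le> u i k}"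
  assumes d: "CARD('d) \<ge> 2" and reg: "regular \<omega>" and D: "finite D"
    and far: "\<And>i j y z. i \<in> I \<Longrightarrow> j \<in> I \<Longrightarrow> y \<in> Q i \<Longrightarrow> z \<in> Q j \<Longrightarrow>
      (\<And>k. \<bar>y $ k - z $ k\<bar> \<le> 2) \<Longrightarrow> i = j"
    and cube: "\<And>i y. i \<in> I \<Longrightarrow> y \<in> Q i \<Longrightarrow> y - v i \<in> cube L"
    and er: "\<And>i. i \<in> I \<Longrightarrow> erodes L T (restart (v i) t \<omega>)"
    and U: "\<And>x m. U x m \<in> {1, - 1}" "\<And>x i. skeleton_at \<omega> U x i \<le> U x (Suc i)"
    and init: "\<And>x. x \<in> D \<Longrightarrow> (\<And>i. i \<in> I \<Longrightarrow> x \<notin> Q i) \<Longrightarrow> U x (rings_upto \<omega> x t) = 1"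
    and ball: "\<And>y. (\<forall>k. \<bar>y $ k - x $ k\<bar> \<le> int n) \<Longrightarrow> y \<in> D"
    and fast: "n > 0" "\<not> fast_path \<omega> D t s n x"
    and r: "0 \<le> T" "t + T \<le> r" "r < s"
  shows "U x (rings_upto \<omega> x r) = 1"
proof -
  define idx where "idx y = (SOME i. i \<in> I \<and> y \<in> Q i)" for y
  have idx: "idx y = i" if "i \<in> I" "y \<in> Q i" for i y
  proof -
    have "idx y \<in> I \<and> y \<in> Q (idx y)"
      unfolding idx_def by (rule someI[of _ i]) (use that in auto)
    then show ?thesis using far[of "idx y" i y y] that by simp
  qed
  \<comment> \<open>the superposition of the erosions: by separation a site belongs to at most one box\<close>
  define W where "W y m = (if \<exists>i\<in>I. y \<in> Q i then restarted_cube L (v (idx y)) t \<omega> y m else 1)" for y m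
  have W_in: "W y m = restarted_cube L (v i) t \<omega> y m" if "i \<in> I" "y \<in> Q i" for i y m
    using idx[OF that] that by (auto simp: W_def)
  have W_out: "W y m = 1" if "\<And>i. i \<in> I \<Longrightarrow> y \<notin> Q i" for y m
    using that by (auto simp: W_def)
  have rc_spin: "restarted_cube L w t \<omega> y m \<in> {1, - 1}" for w y m
    unfolding restarted_cube_def by (rule cube_skeleton_in_spins[OF regular_restart[OF reg]])
  have W_spin: "W y m \<in> {1, - 1}" for y m
    using rc_spin by (simp add: W_def del: insert_iff) simp
  have le1: "c \<le> 1" "- 1 \<le> c" if "c \<in> {1, - 1}" for c :: int using that by auto
  have sub: "W y (Suc m) \<le> skeleton_at \<omega> W y m" if m: "rings_upto \<omega> y t \<le> m" for y m
  proof (cases "\<exists>i\<in>I. y \<in> Q i")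
    case True
    then obtain i where i: "i \<in> I" "y \<in> Q i" by auto
    have "W y (Suc m) = skeleton_at \<omega> (restarted_cube L (v i) t \<omega>) y m"
      unfolding W_in[OF i] by (rule restarted_cube_Suc[OF reg cube[OF i] m])
    also have "\<dots> \<le> skeleton_at \<omega> W y m"
      unfolding skeleton_at_def
    proof (rule majority_mono[OF regular_spin[OF reg]])
      fix z assume z: "z \<in> neighbors y"
      have close: "\<bar>y $ k - z $ k\<bar> \<le> 2" for k
        using neighbor_coordinate_le[OF z, of k] by linarith
      let ?b = "rings_before \<omega> z (ring_time \<omega> y m)"
      show "restarted_cube L (v i) t \<omega> z ?b \<le> W z ?b"
      proof (cases "\<exists>j\<in>I. z \<in> Q j")
        case True
        then obtain j where j: "j \<in> I" "z \<in> Q j" by auto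
        then have "i = j" using far[OF i(1) j(1) i(2) j(2) close] by simp
        then show ?thesis using W_in[OF j] by simp
      next
        case False
        then have "W z ?b = 1" using W_out by blast
        then show ?thesis using le1(1)[OF rc_spin] by metis
      qed
    qed
    finally show ?thesis .
  next
    case False
    then have "W y (Suc m) = 1" using W_out by blast
    moreover have "skeleton_at \<omega> W y m = 1"
      unfolding skeleton_at_def
    proof (rule majority_eq_1[OF d])
      fix z z'
      let ?b = "\<lambda>z. rings_before \<omega> z (ring_time \<omega> y m)"
      assume *: "z \<in> neighbors y" "z' \<in> neighbors y" "W z (?b z) \<noteq> 1" "W z' (?b z') \<noteq> 1"
      obtain i where i: "i \<in> I" "z \<in> Q i" using W_out *(3) by blast
      obtain j where j: "j \<in> I" "z' \<in> Q j" using W_out *(4) by blast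
      have "\<bar>z $ k - z' $ k\<bar> \<le> 2" for k
        using neighbor_coordinate_le[OF *(1), of k] neighbor_coordinate_le[OF *(2), of k] by linarith
      then have "i = j" using far[OF i(1) j(1) i(2) j(2)] by blast
      then show "z = z'"
        using box_neighbor_unique[of y "l i" "u i" z z'] * i j False unfolding Q_def by blast
    qed (rule W_spin)
    ultimately show ?thesis by simp
  qed
  have start: "W y (rings_upto \<omega> y t) \<le> U y (rings_upto \<omega> y t)" if y: "y \<in> D" for y
  proof (cases "\<exists>i\<in>I. y \<in> Q i")
    case True
    then obtain i where i: "i \<in> I" "y \<in> Q i" by auto
    have "W y (rings_upto \<omega> y t) = - 1"
      unfolding W_in[OF i] restarted_cube_def using cube[OF i] cube_skeleton_0[OF regular_restart[OF reg]]
      by (simp add: cube_init_def)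
    then show ?thesis using le1(2)[OF U(1)] by metis
  next
    case False
    then show ?thesis using W_out init[OF y] by fastforce
  qed
  have "W x (rings_upto \<omega> x r) \<le> U x (rings_upto \<omega> x r)"
    by (rule comparison_fast_path[OF reg wf_precedes_finite[OF reg D], where a = t and s = s and n = n])
      (use sub start U ball fast r in auto)
  moreover have "W x (rings_upto \<omega> x r) = 1"
  proof (cases "\<exists>i\<in>I. x \<in> Q i")
    case True
    then obtain i where i: "i \<in> I" "x \<in> Q i" by auto
    have "rings_upto (restart (v i) t \<omega>) (x - v i) T \<le> rings_upto (restart (v i) t \<omega>) (x - v i) (r - t)"
      using r by (intro rings_upto_mono[OF regular_restart[OF reg]]) auto
    then show ?thesis
      unfolding W_in[OF i] restarted_cube_def
      by (intro eroded_forever[OF regular_restart[OF reg] er[OF i(1)]])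
        (simp add: rings_upto_restart[OF reg])
  qed (use W_out in blast)
  ultimately show ?thesis
    using le1(1)[OF U(1), of x "rings_upto \<omega> x r"] by simp
qed

section \<open>A Poisson clock is stationary\<close>

abbreviation exp_law :: "real measure" where
  "exp_law \<equiv> density lborel (exponential_density 1)"

interpretation exp_law: prob_space exp_law
  by (rule prob_space_exponential_density) simp

interpretation clock: sequence_space exp_law
  by unfold_locales

lemma exp_law_le:
  assumes "0 \<le> t"
  shows "measure exp_law {..t} = 1 - exp (- t)"
proof -
  have "distributed exp_law lborel (\<lambda>x. x) (exponential_density 1)"
    by (auto simp: distributed_def distr_id2 exponential_density_nonneg)
  from exp_law.exponential_distributedD_le[OF this assms] show ?thesis
    by (simp add: atMost_def)
qed

lemma AE_exp_law_pos: "AE s in exp_law. s > 0"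
proof -
  have "AE s in lborel. s \<noteq> (0::real)"
    by (rule AE_lborel_singleton)
  then show ?thesis
    by (subst AE_density) (auto simp: exponential_density_def elim: eventually_mono)
qed

lemma exp_law_memoryless:
  fixes g :: "real \<Rightarrow> ennreal"
  assumes [measurable]: "g \<in> borel_measurable borel" and t: "0 \<le> t"
  shows "(\<integral>\<^sup>+s. g (s - t) * indicator {t<..} s \<partial>exp_law) = ennreal (exp (- t)) * (\<integral>\<^sup>+s. g s \<partial>exp_law)"
proof -
  have "(\<integral>\<^sup>+s. g (s - t) * indicator {t<..} s \<partial>exp_law)
      = (\<integral>\<^sup>+s. ennreal (exponential_density 1 s) * (g (s - t) * indicator {t<..} s) \<partial>lborel)"
    by (rule nn_integral_density) auto
  also have "\<dots> = (\<integral>\<^sup>+s. ennreal (exponential_density 1 (t + s)) * (g s * indicator {0<..} s) \<partial>lborel)"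
    by (subst nn_integral_real_affine[of _ 1 t]) (auto simp: indicator_def intro!: nn_integral_cong)
  also have "\<dots> = (\<integral>\<^sup>+s. ennreal (exp (- t)) * (ennreal (exponential_density 1 s) * g s) \<partial>lborel)"
  proof (rule nn_integral_cong_AE)
    have "AE s in lborel. s \<noteq> (0::real)"
      by (rule AE_lborel_singleton)
    then show "AE s in lborel. ennreal (exponential_density 1 (t + s)) * (g s * indicator {0<..} s)
        = ennreal (exp (- t)) * (ennreal (exponential_density 1 s) * g s)"
    proof eventually_elim
      fix s :: real assume "s \<noteq> 0"
      then consider "s < 0" | "s > 0" by linarith
      then show "ennreal (exponential_density 1 (t + s)) * (g s * indicator {0<..} s)
        = ennreal (exp (- t)) * (ennreal (exponential_density 1 s) * g s)"
      proof cases
        case 2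
        then have "exponential_density 1 (t + s) = exp (- t) * exponential_density 1 s"
          using t by (simp add: exponential_density_def flip: exp_add)
        then show ?thesis
          using 2 by (simp add: ennreal_mult exponential_density_nonneg mult.assoc)
      qed (simp add: exponential_density_def)
    qed
  qed
  also have "\<dots> = ennreal (exp (- t)) * (\<integral>\<^sup>+s. ennreal (exponential_density 1 s) * g s \<partial>lborel)"
    by (rule nn_integral_cmult) auto
  also have "(\<integral>\<^sup>+s. ennreal (exponential_density 1 s) * g s \<partial>lborel) = (\<integral>\<^sup>+s. g s \<partial>exp_law)"
    by (rule nn_integral_density[symmetric]) auto
  finally show ?thesis .
qed

text \<open>The counterparts of \<^const>\<open>rings_upto\<close> and \<^const>\<open>restart\<close> for a single clock.\<close>

definition ring_count :: "real \<Rightarrow> (nat \<Rightarrow> real) \<Rightarrow> nat" where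
  "ring_count t \<tau> = (LEAST i. t < (\<Sum>j\<le>i. \<tau> j))"

definition clock_shift :: "real \<Rightarrow> (nat \<Rightarrow> real) \<Rightarrow> nat \<Rightarrow> real" where
  "clock_shift t \<tau> i =
     (if i = 0 then (\<Sum>j\<le>ring_count t \<tau>. \<tau> j) - t else \<tau> (ring_count t \<tau> + i))"

lemma measurable_ring_count [measurable]:
  "(\<lambda>(t, \<tau>). ring_count t \<tau>) \<in> measurable (borel \<Otimes>\<^sub>M clock.S) (count_space UNIV)"
  unfolding ring_count_def by measurable

lemma measurable_clock_shift [measurable]:
  "(\<lambda>(t, \<tau>). clock_shift t \<tau>) \<in> measurable (borel \<Otimes>\<^sub>M clock.S) clock.S"
proof (rule measurable_PiM_single')
  fix i :: nat
  have "(\<lambda>p. if i = 0 then (\<Sum>j\<le>k. snd p j) - fst p else snd p (k + i)) \<in> measurable (borel \<Otimes>\<^sub>M clock.S) exp_law" for k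
    by measurable
  from measurable_compose_countable[OF this measurable_ring_count]
  show "(\<lambda>p. (case p of (t, \<tau>) \<Rightarrow> clock_shift t \<tau>) i) \<in> measurable (borel \<Otimes>\<^sub>M clock.S) exp_law"
    by (simp add: clock_shift_def case_prod_beta' cong: if_cong)
qed (auto simp: space_PiM)

lemma measurable_clock_shift_fixed: "clock_shift t \<in> measurable clock.S clock.S"
  using measurable_compose[OF measurable_Pair1'[of t borel clock.S] measurable_clock_shift] by simp

text \<open>Ring times bounded by \<open>b\<close> would have all waiting times at most \<open>b\<close>.\<close>

lemma AE_clock_regular: "AE \<tau> in clock.S. (\<forall>i. \<tau> i > 0) \<and> (\<forall>b. \<exists>i. b < (\<Sum>j\<le>i. \<tau> j))"
proof -
  have pos: "AE \<tau> in clock.S. \<forall>i. \<tau> i > 0"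
    unfolding AE_all_countable by (intro allI clock.AE_component) (auto intro: AE_exp_law_pos)
  have "AE \<tau> in clock.S. \<exists>i. real b < \<tau> i" for b :: nat
  proof -
    let ?A = "{\<tau> \<in> space clock.S. \<forall>i. \<tau> i \<le> real b}"
    have [measurable]: "?A \<in> sets clock.S" by measurable
    have le: "emeasure clock.S ?A \<le> ennreal ((1 - exp (- real b)) ^ k)" for k
    proof -
      have "?A \<subseteq> prod_emb UNIV (\<lambda>_. exp_law) {..<k} (Pi\<^sub>E {..<k} (\<lambda>_. {..real b}))"
        by (auto simp: prod_emb_def space_PiM)
      then have "emeasure clock.S ?A \<le> emeasure clock.S (prod_emb UNIV (\<lambda>_. exp_law) {..<k} (Pi\<^sub>E {..<k} (\<lambda>_. {..real b})))"
        by (intro emeasure_mono) (auto intro!: measurable_prod_emb sets_PiM_I_finite)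
      also have "\<dots> = (\<Prod>i<k. emeasure exp_law {..real b})"
        by (intro clock.emeasure_PiM_emb) auto
      also have "\<dots> = ennreal ((1 - exp (- real b)) ^ k)"
        by (simp add: exp_law.emeasure_eq_measure exp_law_le ennreal_power)
      finally show ?thesis .
    qed
    have "(\<lambda>k. ennreal ((1 - exp (- real b)) ^ k)) \<longlonglongrightarrow> ennreal 0"
      by (intro tendsto_ennrealI LIMSEQ_realpow_zero) auto
    then have "emeasure clock.S ?A \<le> ennreal 0"
      by (rule LIMSEQ_le_const) (use le in auto)
    then have "?A \<in> null_sets clock.S" by (auto simp: null_sets_def)
    then have "AE \<tau> in clock.S. \<tau> \<notin> ?A" by (rule AE_not_in)
    then show ?thesis
      using AE_space by eventually_elim (auto simp: not_le)
  qed
  then have "AE \<tau> in clock.S. \<forall>b::nat. \<exists>i. real b < \<tau> i"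
    by (simp add: AE_all_countable)
  with pos show ?thesis
  proof eventually_elim
    fix \<tau> :: "nat \<Rightarrow> real" assume pos: "\<forall>i. \<tau> i > 0" and *: "\<forall>b::nat. \<exists>i. real b < \<tau> i"
    have "\<exists>i. b < (\<Sum>j\<le>i. \<tau> j)" for b
    proof -
      obtain i where "real (nat \<lceil>b\<rceil>) < \<tau> i" using * by blast
      then have "b < \<tau> i" by linarith
      also have "\<tau> i \<le> (\<Sum>j\<le>i. \<tau> j)"
        using pos by (intro member_le_sum) (auto intro: less_imp_le)
      finally show ?thesis by blast
    qed
    with pos show "(\<forall>i. \<tau> i > 0) \<and> (\<forall>b. \<exists>i. b < (\<Sum>j\<le>i. \<tau> j))" by blast
  qed
qed

lemma sum_case_nat: "(\<Sum>j\<le>Suc i. case_nat s \<tau> j) = s + (\<Sum>j\<le>i. \<tau> j)"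
  by (subst sum.atMost_Suc_shift) simp

lemma clock_shift_before_first_ring:
  assumes "t < s"
  shows "clock_shift t (case_nat s \<tau>) = case_nat (s - t) \<tau>"
proof -
  have "ring_count t (case_nat s \<tau>) = 0"
    unfolding ring_count_def using assms by (intro Least_equality) auto
  then show ?thesis
    by (auto simp: clock_shift_def fun_eq_iff split: nat.split)
qed

lemma clock_shift_after_first_ring:
  assumes "s \<le> t" "\<exists>i. t - s < (\<Sum>j\<le>i. \<tau> j)"
  shows "clock_shift t (case_nat s \<tau>) = clock_shift (t - s) \<tau>"
proof -
  obtain k where "t - s < (\<Sum>j\<le>k. \<tau> j)" using assms by blast
  then have "ring_count t (case_nat s \<tau>) = Suc (ring_count (t - s) \<tau>)"
    unfolding ring_count_def using assms(1)
    by (subst Least_Suc[of _ "Suc k"]) (auto simp: sum_case_nat diff_less_eq algebra_simps simp del: sum.atMost_Suc)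
  then show ?thesis
    by (auto simp: clock_shift_def fun_eq_iff sum_case_nat simp del: sum.atMost_Suc)
qed

text \<open>
  Conditioning on the first waiting time gives a renewal equation for the law of the shifted
  clock. The stationary law solves it, and a bounded solution is unique: iterating the equation
  for the difference gains a factor below $1$ every time.
\<close>

lemma distr_clock_shift:
  assumes t: "0 \<le> t"
  shows "distr clock.S clock.S (clock_shift t) = clock.S"
proof (rule measure_eqI)
  fix A assume "A \<in> sets (distr clock.S clock.S (clock_shift t))"
  then have A [measurable]: "A \<in> sets clock.S" by simp
  define f where "f r = measure clock.S {\<tau> \<in> space clock.S. clock_shift r \<tau> \<in> A}" for r
  define a where "a = measure clock.S A"
  have ms [measurable]: "{\<tau> \<in> space clock.S. clock_shift r \<tau> \<in> A} \<in> sets clock.S" for r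
    using measurable_sets[OF measurable_clock_shift_fixed A] by (simp add: vimage_def Int_def conj_commute)
  have fe: "ennreal (f r) = (\<integral>\<^sup>+\<tau>. indicator A (clock_shift r \<tau>) \<partial>clock.S)" for r
  proof -
    have "(\<integral>\<^sup>+\<tau>. indicator A (clock_shift r \<tau>) \<partial>clock.S)
        = (\<integral>\<^sup>+\<tau>. indicator {\<tau> \<in> space clock.S. clock_shift r \<tau> \<in> A} \<tau> \<partial>clock.S)"
      by (intro nn_integral_cong) (auto simp: indicator_def)
    then show ?thesis
      by (simp add: f_def clock.P.emeasure_eq_measure)
  qed
  have fm [measurable]: "f \<in> borel_measurable borel"
  proof -
    have "(\<lambda>r. \<integral>\<^sup>+\<tau>. indicator A (clock_shift r \<tau>) \<partial>clock.S) \<in> borel_measurable borel"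
      using measurable_clock_shift by measurable
    then have "(\<lambda>r. ennreal (f r)) \<in> borel_measurable borel" by (simp add: fe)
    then have "(\<lambda>r. enn2real (ennreal (f r))) \<in> borel_measurable borel" by measurable
    moreover have "(\<lambda>r. enn2real (ennreal (f r))) = f"
      by (auto simp: f_def)
    ultimately show ?thesis by simp
  qed
  have renewal: "f r = exp (- r) * a + (\<integral>s. indicator {..r} s * f (r - s) \<partial>exp_law)" if r: "0 \<le> r" for r
  proof -
    have [measurable]: "(\<lambda>(s, \<tau>). case_nat s \<tau>) \<in> measurable (exp_law \<Otimes>\<^sub>M clock.S) clock.S"
      by measurable
    have c [measurable]: "(\<lambda>\<tau>. indicator A (clock_shift r \<tau>)) \<in> borel_measurable clock.S"
      using measurable_clock_shift_fixed by measurable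
    have "ennreal (f r) = (\<integral>\<^sup>+\<tau>. indicator A (clock_shift r \<tau>) \<partial>(distr (exp_law \<Otimes>\<^sub>M clock.S) clock.S (\<lambda>(s, \<tau>). case_nat s \<tau>)))"
      by (simp add: fe clock.PiM_iter)
    also have "\<dots> = (\<integral>\<^sup>+p. indicator A (clock_shift r (case_nat (fst p) (snd p))) \<partial>(exp_law \<Otimes>\<^sub>M clock.S))"
      by (subst nn_integral_distr) (auto simp: case_prod_beta')
    also have "\<dots> = (\<integral>\<^sup>+s. \<integral>\<^sup>+\<tau>. indicator A (clock_shift r (case_nat s \<tau>)) \<partial>clock.S \<partial>exp_law)"
      by (subst clock.P.nn_integral_fst[symmetric]) (auto simp: case_prod_beta')
    also have "\<dots> = (\<integral>\<^sup>+s. (\<integral>\<^sup>+\<tau>. indicator A (case_nat (s - r) \<tau>) \<partial>clock.S) * indicator {r<..} s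
        + indicator {..r} s * ennreal (f (r - s)) \<partial>exp_law)"
    proof (intro nn_integral_cong)
      fix s :: real
      show "(\<integral>\<^sup>+\<tau>. indicator A (clock_shift r (case_nat s \<tau>)) \<partial>clock.S) =
        (\<integral>\<^sup>+\<tau>. indicator A (case_nat (s - r) \<tau>) \<partial>clock.S) * indicator {r<..} s
        + indicator {..r} s * ennreal (f (r - s))"
      proof (cases "r < s")
        case True
        then show ?thesis by (simp add: clock_shift_before_first_ring)
      next
        case False
        then have "(\<integral>\<^sup>+\<tau>. indicator A (clock_shift r (case_nat s \<tau>)) \<partial>clock.S)
            = (\<integral>\<^sup>+\<tau>. indicator A (clock_shift (r - s) \<tau>) \<partial>clock.S)"
        proof (intro nn_integral_cong_AE)
          show "AE \<tau> in clock.S. indicator A (clock_shift r (case_nat s \<tau>)) = (indicator A (clock_shift (r - s) \<tau>) :: ennreal)"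
            using AE_clock_regular
            by eventually_elim (use False in \<open>simp add: clock_shift_after_first_ring\<close>)
        qed
        then show ?thesis using False by (simp add: fe)
      qed
    qed
    also have "\<dots> = (\<integral>\<^sup>+s. (\<integral>\<^sup>+\<tau>. indicator A (case_nat (s - r) \<tau>) \<partial>clock.S) * indicator {r<..} s \<partial>exp_law)
        + (\<integral>\<^sup>+s. indicator {..r} s * ennreal (f (r - s)) \<partial>exp_law)"
      by (intro nn_integral_add) measurable
    also have "(\<integral>\<^sup>+s. (\<integral>\<^sup>+\<tau>. indicator A (case_nat (s - r) \<tau>) \<partial>clock.S) * indicator {r<..} s \<partial>exp_law)
        = ennreal (exp (- r)) * (\<integral>\<^sup>+s. \<integral>\<^sup>+\<tau>. indicator A (case_nat s \<tau>) \<partial>clock.S \<partial>exp_law)"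
      by (rule exp_law_memoryless[OF _ r]) measurable
    also have "(\<integral>\<^sup>+s. \<integral>\<^sup>+\<tau>. indicator A (case_nat s \<tau>) \<partial>clock.S \<partial>exp_law)
        = (\<integral>\<^sup>+p. indicator A (case_nat (fst p) (snd p)) \<partial>(exp_law \<Otimes>\<^sub>M clock.S))"
      by (subst clock.P.nn_integral_fst[symmetric]) (auto simp: case_prod_beta')
    also have "\<dots> = (\<integral>\<^sup>+\<tau>. indicator A \<tau> \<partial>(distr (exp_law \<Otimes>\<^sub>M clock.S) clock.S (\<lambda>(s, \<tau>). case_nat s \<tau>)))"
      by (subst nn_integral_distr) (auto simp: case_prod_beta')
    also have "\<dots> = ennreal a"
      by (simp add: clock.PiM_iter a_def clock.P.emeasure_eq_measure)
    also have "(\<integral>\<^sup>+s. indicator {..r} s * ennreal (f (r - s)) \<partial>exp_law)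
        = (\<integral>\<^sup>+s. ennreal (indicator {..r} s * f (r - s)) \<partial>exp_law)"
      by (intro nn_integral_cong) (auto simp: indicator_def)
    finally have "ennreal (f r) = ennreal (exp (- r)) * ennreal a
        + (\<integral>\<^sup>+s. ennreal (indicator {..r} s * f (r - s)) \<partial>exp_law)" .
    moreover have "(\<integral>\<^sup>+s. ennreal (indicator {..r} s * f (r - s)) \<partial>exp_law)
        = ennreal (\<integral>s. indicator {..r} s * f (r - s) \<partial>exp_law)"
    proof (rule nn_integral_eq_integral)
      show "integrable exp_law (\<lambda>s. indicator {..r} s * f (r - s))"
        by (rule exp_law.integrable_const_bound[of _ 1]) (auto simp: f_def indicator_def)
    qed (auto simp: f_def indicator_def)
    moreover have nn: "0 \<le> (\<integral>s. indicator {..r} s * f (r - s) \<partial>exp_law)"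
      by (rule integral_nonneg_AE) (simp add: f_def)
    ultimately have "ennreal (f r) = ennreal (exp (- r) * a + (\<integral>s. indicator {..r} s * f (r - s) \<partial>exp_law))"
      using nn by (simp add: ennreal_mult' ennreal_plus a_def)
    then show ?thesis
      using nn by (subst (asm) ennreal_inj) (auto simp: a_def f_def)
  qed
  have bound: "\<bar>f r - a\<bar> \<le> (1 - exp (- t)) ^ k" if "0 \<le> r" "r \<le> t" for r k
    using that
  proof (induction k arbitrary: r)
    case 0
    then show ?case by (simp add: f_def a_def abs_le_iff) (smt (verit) clock.P.prob_le_1 measure_nonneg)
  next
    case (Suc k)
    let ?m = "(1 - exp (- t)) ^ k"
    have m: "0 \<le> ?m" using t by simp
    have i1: "integrable exp_law (\<lambda>s. indicator {..r} s * f (r - s))"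
      by (rule exp_law.integrable_const_bound[of _ 1]) (auto simp: f_def indicator_def)
    have i2: "integrable exp_law (\<lambda>s. indicator {..r} s * a)"
      by (rule exp_law.integrable_const_bound[of _ 1]) (auto simp: a_def indicator_def)
    have "(\<integral>s. indicator {..r} s * a \<partial>exp_law) = (1 - exp (- r)) * a"
      using exp_law_le[OF Suc.prems(1)] by simp
    then have "a = exp (- r) * a + (\<integral>s. indicator {..r} s * a \<partial>exp_law)"
      by (simp add: algebra_simps)
    then have "f r - a = (\<integral>s. indicator {..r} s * f (r - s) \<partial>exp_law) - (\<integral>s. indicator {..r} s * a \<partial>exp_law)"
      using renewal[OF Suc.prems(1)] by linarith
    also have "\<dots> = (\<integral>s. indicator {..r} s * f (r - s) - indicator {..r} s * a \<partial>exp_law)"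
      using i1 i2 by simp
    finally have "\<bar>f r - a\<bar> \<le> (\<integral>s. \<bar>indicator {..r} s * f (r - s) - indicator {..r} s * a\<bar> \<partial>exp_law)"
      using integral_abs_bound by metis
    also have "\<dots> \<le> (\<integral>s. indicator {..r} s * ?m \<partial>exp_law)"
    proof (rule integral_mono_AE)
      show "integrable exp_law (\<lambda>s. \<bar>indicator {..r} s * f (r - s) - indicator {..r} s * a\<bar>)"
        using i1 i2 by auto
      show "integrable exp_law (\<lambda>s. indicator {..r} s * ?m)"
        by (rule exp_law.integrable_const_bound[of _ ?m]) (use m in \<open>auto simp: indicator_def\<close>)
      show "AE s in exp_law. \<bar>indicator {..r} s * f (r - s) - indicator {..r} s * a\<bar> \<le> indicator {..r} s * ?m"
        using AE_exp_law_pos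
        by eventually_elim (use Suc.IH Suc.prems m in \<open>auto simp: indicator_def\<close>)
    qed
    also have "\<dots> = (1 - exp (- r)) * ?m"
      using exp_law_le[OF Suc.prems(1)] by simp
    also have "\<dots> \<le> (1 - exp (- t)) * ?m"
      using Suc.prems m by (intro mult_right_mono) auto
    finally show ?case by simp
  qed
  have "(\<lambda>k. (1 - exp (- t)) ^ k) \<longlonglongrightarrow> 0"
    using t by (intro LIMSEQ_realpow_zero) auto
  then have "\<bar>f t - a\<bar> \<le> 0"
    by (rule LIMSEQ_le_const) (use bound[OF t order_refl] in auto)
  then have "f t = a" by simp
  moreover have "clock_shift t -` A \<inter> space clock.S = {\<tau> \<in> space clock.S. clock_shift t \<tau> \<in> A}"
    by auto
  ultimately show "emeasure (distr clock.S clock.S (clock_shift t)) A = emeasure clock.S A"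
    by (simp add: emeasure_distr[OF measurable_clock_shift_fixed A] clock.P.emeasure_eq_measure f_def a_def)
qed simp

section \<open>The restarted noise has the law of the noise\<close>

abbreviation clocks_law :: "('d::finite site \<times> nat \<Rightarrow> real) measure" where
  "clocks_law \<equiv> \<Pi>\<^sub>M _\<in>UNIV. exp_law"

abbreviation spins_law :: "real \<Rightarrow> ('d::finite site \<times> nat \<Rightarrow> int) measure" where
  "spins_law q \<equiv> \<Pi>\<^sub>M _\<in>UNIV. measure_pmf (spin_pmf q)"

abbreviation clock_family_law :: "('d::finite site \<Rightarrow> nat \<Rightarrow> real) measure" where
  "clock_family_law \<equiv> \<Pi>\<^sub>M _\<in>UNIV. clock.S"

lemma prob_space_clocks_law: "prob_space clocks_law"
  by (rule prob_space_PiM) (rule exp_law.prob_space_axioms)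

lemma prob_space_spins_law: "prob_space (spins_law q)"
  by (rule prob_space_PiM) (rule prob_space_measure_pmf)

lemma prob_space_clock_family_law: "prob_space clock_family_law"
  by (rule prob_space_PiM) (rule clock.P.prob_space_axioms)

lemma clock_coordinate_measurable [measurable]:
  "(\<lambda>u. u x i) \<in> measurable clock_family_law exp_law"
  using measurable_compose[OF measurable_component_singleton[of x UNIV "\<lambda>_. clock.S"]
      measurable_component_singleton[of i UNIV "\<lambda>_. exp_law"]] by simp

lemma uncurry_measurable [measurable]:
  "case_prod \<in> measurable clock_family_law (clocks_law :: ('d::finite site \<times> nat \<Rightarrow> real) measure)"
  by (rule measurable_PiM_single') (use clock_coordinate_measurable in \<open>auto simp: space_PiM\<close>)

text \<open>
  A product over sites and ring numbers is an iterated product, which reduces the shift of all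
  clocks to the shift of a single one.
\<close>

lemma clocks_law_eq_distr:
  "(clocks_law :: ('d::finite site \<times> nat \<Rightarrow> real) measure) = distr clock_family_law clocks_law case_prod"
proof (rule measure_eqI_PiM_infinite)
  interpret C: prob_space "clocks_law :: ('d site \<times> nat \<Rightarrow> real) measure" by (rule prob_space_clocks_law)
  show "finite_measure (clocks_law :: ('d site \<times> nat \<Rightarrow> real) measure)" by unfold_locales
  fix A :: "'d site \<times> nat \<Rightarrow> real set" and J :: "('d site \<times> nat) set"
  assume J: "finite J" "J \<subseteq> UNIV" and A: "\<And>p. p \<in> J \<Longrightarrow> A p \<in> sets exp_law"
  define B where "B x = prod_emb UNIV (\<lambda>_::nat. exp_law) {i. (x, i) \<in> J} (Pi\<^sub>E {i. (x, i) \<in> J} (\<lambda>i. A (x, i)))" for x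
  have fin: "finite {i. (x, i) \<in> J}" for x
    by (rule finite_subset[OF _ finite_imageI[OF J(1), of snd]]) force
  have B: "B x \<in> sets clock.S" for x
    unfolding B_def using fin A by (intro measurable_prod_emb sets_PiM_I_finite) auto
  let ?E = "prod_emb UNIV (\<lambda>_. exp_law) J (Pi\<^sub>E J A)"
  have E: "?E \<in> sets (clocks_law :: ('d site \<times> nat \<Rightarrow> real) measure)"
    using J A by (intro measurable_prod_emb sets_PiM_I_finite) auto
  have "emeasure (distr clock_family_law clocks_law case_prod) ?E
      = emeasure clock_family_law (case_prod -` ?E \<inter> space clock_family_law)"
    by (rule emeasure_distr[OF uncurry_measurable E])
  also have "case_prod -` ?E \<inter> space clock_family_law
      = prod_emb UNIV (\<lambda>_. clock.S) (fst ` J) (Pi\<^sub>E (fst ` J) B)"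
    by (force simp: prod_emb_def B_def space_PiM PiE_def Pi_def restrict_def extensional_def)
  also have "emeasure clock_family_law \<dots> = (\<Prod>x\<in>fst ` J. emeasure clock.S (B x))"
    using J B by (intro emeasure_PiM_emb clock.P.prob_space_axioms) auto
  also have "\<dots> = (\<Prod>x\<in>fst ` J. \<Prod>i\<in>{i. (x, i) \<in> J}. emeasure exp_law (A (x, i)))"
    unfolding B_def using fin A by (intro prod.cong refl clock.emeasure_PiM_emb) auto
  also have "\<dots> = (\<Prod>p\<in>(SIGMA x:fst ` J. {i. (x, i) \<in> J}). emeasure exp_law (A p))"
    using J fin by (subst prod.Sigma) (auto simp: case_prod_beta')
  also have "(SIGMA x:fst ` J. {i. (x, i) \<in> J}) = J"
    by force
  also have "(\<Prod>p\<in>J. emeasure exp_law (A p)) = emeasure clocks_law ?E"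
    using J A by (intro emeasure_PiM_emb[symmetric] exp_law.prob_space_axioms) auto
  finally show "emeasure clocks_law ?E = emeasure (distr clock_family_law clocks_law case_prod) ?E" ..
qed simp_all

definition family_shift :: "'d::finite site \<Rightarrow> real \<Rightarrow> ('d site \<Rightarrow> nat \<Rightarrow> real) \<Rightarrow> 'd site \<Rightarrow> nat \<Rightarrow> real" where
  "family_shift v t u x = clock_shift t (u (x + v))"

lemma family_shift_measurable [measurable]:
  "family_shift v t \<in> measurable clock_family_law clock_family_law"
proof (rule measurable_PiM_single')
  fix x
  show "(\<lambda>u. family_shift v t u x) \<in> measurable clock_family_law clock.S"
    unfolding family_shift_def by (rule measurable_compose[OF _ measurable_clock_shift_fixed]) simp
qed (auto simp: space_PiM)

lemma distr_family_shift:
  assumes t: "0 \<le> t"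
  shows "distr clock_family_law clock_family_law (family_shift v t)
    = (clock_family_law :: ('d::finite site \<Rightarrow> nat \<Rightarrow> real) measure)"
proof (rule measure_eqI_PiM_infinite[symmetric])
  interpret C: prob_space "clock_family_law :: ('d site \<Rightarrow> nat \<Rightarrow> real) measure"
    by (rule prob_space_clock_family_law)
  show "finite_measure (clock_family_law :: ('d site \<Rightarrow> nat \<Rightarrow> real) measure)" by unfold_locales
  fix A :: "'d site \<Rightarrow> (nat \<Rightarrow> real) set" and J :: "'d site set"
  assume J: "finite J" "J \<subseteq> UNIV" and A: "\<And>x. x \<in> J \<Longrightarrow> A x \<in> sets clock.S"
  let ?E = "prod_emb UNIV (\<lambda>_. clock.S) J (Pi\<^sub>E J A)"
  let ?B = "\<lambda>x. clock_shift t -` A (x - v) \<inter> space clock.S"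
  have E: "?E \<in> sets (clock_family_law :: ('d site \<Rightarrow> nat \<Rightarrow> real) measure)"
    using J A by (intro measurable_prod_emb sets_PiM_I_finite) auto
  have B: "?B x \<in> sets clock.S" if "x - v \<in> J" for x
    by (rule measurable_sets[OF measurable_clock_shift_fixed A[OF that]])
  have "emeasure (distr clock_family_law clock_family_law (family_shift v t)) ?E
      = emeasure clock_family_law (family_shift v t -` ?E \<inter> space clock_family_law)"
    by (rule emeasure_distr[OF family_shift_measurable E])
  also have "family_shift v t -` ?E \<inter> space clock_family_law
      = prod_emb UNIV (\<lambda>_. clock.S) ((\<lambda>x. x + v) ` J) (Pi\<^sub>E ((\<lambda>x. x + v) ` J) ?B)"
    by (auto simp: prod_emb_def space_PiM PiE_def Pi_def restrict_def extensional_def family_shift_def)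
  also have "emeasure clock_family_law \<dots> = (\<Prod>x\<in>(\<lambda>x. x + v) ` J. emeasure clock.S (?B x))"
    using J B by (intro emeasure_PiM_emb clock.P.prob_space_axioms) (auto simp: measurable_sets[OF measurable_clock_shift_fixed A])
  also have "\<dots> = (\<Prod>x\<in>J. emeasure clock.S (clock_shift t -` A x \<inter> space clock.S))"
    by (subst prod.reindex) (auto simp: inj_on_def)
  also have "\<dots> = (\<Prod>x\<in>J. emeasure clock.S (A x))"
  proof (intro prod.cong refl)
    fix x assume x: "x \<in> J"
    show "emeasure clock.S (clock_shift t -` A x \<inter> space clock.S) = emeasure clock.S (A x)"
      using emeasure_distr[OF measurable_clock_shift_fixed A[OF x], of t] by (simp add: distr_clock_shift[OF t])
  qed
  also have "\<dots> = emeasure clock_family_law ?E"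
    using J A by (intro emeasure_PiM_emb[symmetric] clock.P.prob_space_axioms) auto
  finally show "emeasure clock_family_law ?E = emeasure (distr clock_family_law clock_family_law (family_shift v t)) ?E" ..
qed simp_all

text \<open>The waiting times of \<^const>\<open>restart\<close>, which do not involve the tie-breaking variables.\<close>

definition restart_clocks :: "'d::finite site \<Rightarrow> real \<Rightarrow> ('d site \<times> nat \<Rightarrow> real) \<Rightarrow> 'd site \<times> nat \<Rightarrow> real" where
  "restart_clocks v t \<tau> = (\<lambda>(x, i). clock_shift t (\<lambda>j. \<tau> (x + v, j)) i)"

lemma restart_clocks_measurable [measurable]:
  "restart_clocks v t \<in> measurable clocks_law (clocks_law :: ('d::finite site \<times> nat \<Rightarrow> real) measure)"
proof (rule measurable_PiM_single')
  fix p :: "'d site \<times> nat"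
  have "(\<lambda>\<tau>. (\<lambda>j. \<tau> (fst p + v, j))) \<in> measurable clocks_law clock.S"
    by (rule measurable_PiM_single') (auto simp: space_PiM)
  from measurable_compose[OF measurable_compose[OF this measurable_clock_shift_fixed]
      measurable_component_singleton[of "snd p" UNIV "\<lambda>_. exp_law"]]
  show "(\<lambda>\<tau>. restart_clocks v t \<tau> p) \<in> measurable clocks_law exp_law"
    by (simp add: restart_clocks_def case_prod_beta')
qed (auto simp: space_PiM)

lemma distr_restart_clocks:
  assumes t: "0 \<le> t"
  shows "distr clocks_law clocks_law (restart_clocks v t) = (clocks_law :: ('d::finite site \<times> nat \<Rightarrow> real) measure)"
proof -
  let ?C = "clocks_law :: ('d site \<times> nat \<Rightarrow> real) measure"
  have comm: "restart_clocks v t \<circ> case_prod = case_prod \<circ> family_shift v t"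
    by (auto simp: fun_eq_iff restart_clocks_def family_shift_def)
  have "distr ?C ?C (restart_clocks v t) = distr (distr clock_family_law ?C case_prod) ?C (restart_clocks v t)"
    by (rule arg_cong[OF clocks_law_eq_distr, of "\<lambda>M. distr M ?C (restart_clocks v t)"])
  also have "\<dots> = distr clock_family_law ?C (restart_clocks v t \<circ> case_prod)"
    by (rule distr_distr) measurable
  also have "\<dots> = distr (distr clock_family_law clock_family_law (family_shift v t)) ?C case_prod"
    unfolding comm by (rule distr_distr[symmetric]) measurable
  also have "\<dots> = ?C"
    unfolding distr_family_shift[OF t] by (rule clocks_law_eq_distr[symmetric])
  finally show ?thesis .
qed

lemma noise_law_eq: "noise_law q = clocks_law \<Otimes>\<^sub>M spins_law q"
  by (simp add: noise_law_def)

lemma space_noise_law [simp]: "space (noise_law q) = UNIV"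
  by (simp add: noise_law_eq space_pair_measure space_PiM PiE_UNIV_domain)

lemma waiting_time_measurable [measurable]: "(\<lambda>\<omega>. fst \<omega> p) \<in> borel_measurable (noise_law q)"
proof -
  have "(\<lambda>\<omega>. fst \<omega> p) \<in> measurable (noise_law q) exp_law"
    unfolding noise_law_eq by measurable
  then show ?thesis by simp
qed

lemma tie_variable_measurable [measurable]: "(\<lambda>\<omega>. snd \<omega> p) \<in> measurable (noise_law q) (count_space UNIV)"
proof -
  have "(\<lambda>\<omega>. snd \<omega> p) \<in> measurable (noise_law q) (measure_pmf (spin_pmf q))"
    unfolding noise_law_eq by measurable
  then show ?thesis by simp
qed

lemma rings_upto_eq_ring_count: "rings_upto \<omega> x t = ring_count t (\<lambda>j. fst \<omega> (x, j))"
  by (simp add: rings_upto_def ring_count_def ring_time_def)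

lemma restart_eq:
  "restart v t (\<tau>, \<xi>) = (restart_clocks v t \<tau>,
     \<lambda>p. \<xi> (fst p + v, ring_count t (\<lambda>j. \<tau> (fst p + v, j)) + snd p))"
  by (auto simp: restart_def restart_clocks_def clock_shift_def rings_upto_eq_ring_count ring_time_def fun_eq_iff)

lemma measurable_noiseI:
  assumes "\<And>p. (\<lambda>z. fst (f z) p) \<in> borel_measurable M" "\<And>p. (\<lambda>z. snd (f z) p) \<in> measurable M (count_space UNIV)"
  shows "f \<in> measurable M (noise_law q)"
proof -
  have "(\<lambda>z. fst (f z)) \<in> measurable M clocks_law"
    by (rule measurable_PiM_single') (use assms in \<open>auto simp: space_PiM\<close>)
  moreover have "(\<lambda>z. snd (f z)) \<in> measurable M (spins_law q)"
    by (rule measurable_PiM_single') (use assms in \<open>auto simp: space_PiM\<close>)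
  ultimately have "(\<lambda>z. (fst (f z), snd (f z))) \<in> measurable M (noise_law q)"
    unfolding noise_law_eq by (rule measurable_Pair)
  then show ?thesis by simp
qed

text \<open>
  Given the clocks, the restart merely renumbers the tie-breaking variables by an injection, and this
  does not change their law. So the law of the pair factorizes.
\<close>

lemma distr_restart:
  assumes t: "0 \<le> t"
  shows "restart v t \<in> measurable (noise_law q) (noise_law q)"
    and "distr (noise_law q) (noise_law q) (restart v t) = (noise_law q :: 'd::finite noise measure)"
proof -
  let ?C = "clocks_law :: ('d site \<times> nat \<Rightarrow> real) measure" and ?X = "spins_law q :: ('d site \<times> nat \<Rightarrow> int) measure"
  interpret C: prob_space ?C by (rule prob_space_clocks_law)
  interpret X: prob_space ?X by (rule prob_space_spins_law)
  have count: "(\<lambda>\<omega>. rings_upto \<omega> x t) \<in> measurable (noise_law q) (count_space UNIV)" for x :: "'d site"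
    unfolding rings_upto_def ring_time_def by measurable
  show meas: "restart v t \<in> measurable (noise_law q) (noise_law q :: 'd noise measure)"
  proof (rule measurable_noiseI)
    fix p :: "'d site \<times> nat"
    obtain x i where p: "p = (x, i)" by (cases p)
    have "(\<lambda>\<omega>. if i = 0 then ring_time \<omega> (x + v) k - t else fst \<omega> (x + v, k + i)) \<in> borel_measurable (noise_law q)" for k
      unfolding ring_time_def by measurable
    from measurable_compose_countable[OF this count]
    show "(\<lambda>\<omega>. fst (restart v t \<omega>) p) \<in> borel_measurable (noise_law q)"
      by (simp add: restart_def p cong: if_cong)
    have "(\<lambda>\<omega>. snd \<omega> (x + v, k + i)) \<in> measurable (noise_law q) (count_space UNIV)" for k
      by measurable
    from measurable_compose_countable[OF this count]
    show "(\<lambda>\<omega>. snd (restart v t \<omega>) p) \<in> measurable (noise_law q) (count_space UNIV)"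
      by (simp add: restart_def p)
  qed
  show "distr (noise_law q) (noise_law q) (restart v t) = (noise_law q :: 'd noise measure)"
    unfolding noise_law_eq
  proof (rule pair_measure_eqI[symmetric])
    show "sigma_finite_measure ?C" "sigma_finite_measure ?X" by unfold_locales
    fix A B assume A: "A \<in> sets ?C" and B: "B \<in> sets ?X"
    define reindex where "reindex \<tau> p = (fst p + v, ring_count t (\<lambda>j. \<tau> (fst p + v, j)) + snd p)"
      for \<tau> :: "'d site \<times> nat \<Rightarrow> real" and p :: "'d site \<times> nat"
    have spins: "emeasure ?X {\<xi> \<in> space ?X. (\<lambda>p. \<xi> (reindex \<tau> p)) \<in> B} = emeasure ?X B" for \<tau>
    proof -
      have inj: "inj (reindex \<tau>)" by (auto simp: inj_on_def reindex_def)
      have m: "(\<lambda>\<xi> p. \<xi> (reindex \<tau> p)) \<in> measurable ?X ?X"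
        by (rule measurable_PiM_single') (auto simp: space_PiM)
      have "distr ?X ?X (\<lambda>\<xi> p. \<xi> (reindex \<tau> p)) = ?X"
        using distr_PiM_reindex[of UNIV "\<lambda>_. measure_pmf (spin_pmf q)" "reindex \<tau>" UNIV] inj
        by (simp add: prob_space_measure_pmf restrict_UNIV)
      then have "emeasure ?X B = emeasure (distr ?X ?X (\<lambda>\<xi> p. \<xi> (reindex \<tau> p))) B" by simp
      also have "\<dots> = emeasure ?X ((\<lambda>\<xi> p. \<xi> (reindex \<tau> p)) -` B \<inter> space ?X)"
        by (rule emeasure_distr[OF m B])
      also have "(\<lambda>\<xi> p. \<xi> (reindex \<tau> p)) -` B \<inter> space ?X = {\<xi> \<in> space ?X. (\<lambda>p. \<xi> (reindex \<tau> p)) \<in> B}"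
        by auto
      finally show ?thesis ..
    qed
    have AB: "A \<times> B \<in> sets (?C \<Otimes>\<^sub>M ?X)" using A B by simp
    have meas': "restart v t \<in> measurable (?C \<Otimes>\<^sub>M ?X) (?C \<Otimes>\<^sub>M ?X)"
      using meas by (simp add: noise_law_eq)
    let ?R = "restart v t -` (A \<times> B) \<inter> space (?C \<Otimes>\<^sub>M ?X)"
    have R: "?R \<in> sets (?C \<Otimes>\<^sub>M ?X)" by (rule measurable_sets[OF meas' AB])
    have A': "{\<tau> \<in> space ?C. restart_clocks v t \<tau> \<in> A} \<in> sets ?C"
      using measurable_sets[OF restart_clocks_measurable A] by (simp add: vimage_def Int_def conj_commute)
    have "emeasure (distr (?C \<Otimes>\<^sub>M ?X) (?C \<Otimes>\<^sub>M ?X) (restart v t)) (A \<times> B) = emeasure (?C \<Otimes>\<^sub>M ?X) ?R"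
      by (rule emeasure_distr[OF meas' AB])
    also have "\<dots> = (\<integral>\<^sup>+\<tau>. emeasure ?X (Pair \<tau> -` ?R) \<partial>?C)"
      by (rule X.emeasure_pair_measure_alt[OF R])
    also have "\<dots> = (\<integral>\<^sup>+\<tau>. indicator {\<tau> \<in> space ?C. restart_clocks v t \<tau> \<in> A} \<tau> * emeasure ?X B \<partial>?C)"
    proof (rule nn_integral_cong)
      fix \<tau> assume \<tau>: "\<tau> \<in> space ?C"
      have "Pair \<tau> -` ?R = (if restart_clocks v t \<tau> \<in> A then {\<xi> \<in> space ?X. (\<lambda>p. \<xi> (reindex \<tau> p)) \<in> B} else {})"
        using \<tau> by (auto simp: restart_eq reindex_def space_pair_measure)
      then show "emeasure ?X (Pair \<tau> -` ?R)
          = indicator {\<tau> \<in> space ?C. restart_clocks v t \<tau> \<in> A} \<tau> * emeasure ?X B"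
        using \<tau> spins by (auto simp: indicator_def)
    qed
    also have "\<dots> = emeasure ?C {\<tau> \<in> space ?C. restart_clocks v t \<tau> \<in> A} * emeasure ?X B"
      using A' by (simp add: nn_integral_multc)
    also have "emeasure ?C {\<tau> \<in> space ?C. restart_clocks v t \<tau> \<in> A} = emeasure (distr ?C ?C (restart_clocks v t)) A"
      using A by (subst emeasure_distr) (auto intro!: arg_cong[where f = "emeasure ?C"])
    also have "\<dots> = emeasure ?C A" by (simp add: distr_restart_clocks[OF t])
    finally show "emeasure ?C A * emeasure ?X B = emeasure (distr (?C \<Otimes>\<^sub>M ?X) (?C \<Otimes>\<^sub>M ?X) (restart v t)) (A \<times> B)" ..
  qed simp
qed

lemma AE_regular: "AE \<omega> in (noise_law q :: 'd::finite noise measure). regular \<omega>"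
proof -
  let ?C = "clocks_law :: ('d site \<times> nat \<Rightarrow> real) measure" and ?X = "spins_law q :: ('d site \<times> nat \<Rightarrow> int) measure"
  interpret C: prob_space ?C by (rule prob_space_clocks_law)
  interpret X: prob_space ?X by (rule prob_space_spins_law)
  have fam: "AE u in clock_family_law. \<forall>x::'d site. (\<forall>i. u x i > 0) \<and> (\<forall>b. \<exists>i. b < (\<Sum>j\<le>i. u x j))"
    unfolding AE_all_countable
  proof
    fix x :: "'d site"
    interpret F: product_prob_space "\<lambda>_. clock.S" "UNIV :: 'd site set"
      by unfold_locales
    show "AE u in clock_family_law. (\<forall>i. u x i > 0) \<and> (\<forall>b. \<exists>i. b < (\<Sum>j\<le>i. u x j))"
      by (rule F.AE_component[OF _ AE_clock_regular]) simp
  qed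
  have clk: "AE \<tau> in ?C. \<forall>x. (\<forall>i. \<tau> (x, i) > 0) \<and> (\<forall>b::nat. \<exists>i. real b < (\<Sum>j\<le>i. \<tau> (x, j)))"
    by (subst clocks_law_eq_distr, subst AE_distr_iff) (use fam in \<open>auto elim!: eventually_mono\<close>)
  have spn: "AE \<xi> in ?X. \<forall>p. \<xi> p \<in> {1, - 1}"
    unfolding AE_all_countable
  proof
    fix p :: "'d site \<times> nat"
    interpret P: product_prob_space "\<lambda>_. measure_pmf (spin_pmf q)" "UNIV :: ('d site \<times> nat) set"
      by unfold_locales
    have "AE s in measure_pmf (spin_pmf q). s \<in> {1, - 1}"
      by (auto simp: AE_measure_pmf_iff spin_pmf_def)
    then show "AE \<xi> in ?X. \<xi> p \<in> {1, - 1}"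
      by (rule P.AE_component[rotated]) simp
  qed
  have 1: "AE \<omega> in noise_law q. \<forall>x. (\<forall>i. fst \<omega> (x, i) > 0) \<and> (\<forall>b::nat. \<exists>i. real b < (\<Sum>j\<le>i. fst \<omega> (x :: 'd site, j)))"
    unfolding noise_law_eq
    by (rule AE_distrD[where f = fst and M' = ?C]) (simp, unfold X.distr_pair_fst, rule clk)
  have snd: "distr (?C \<Otimes>\<^sub>M ?X) ?X snd = ?X"
  proof (rule measure_eqI)
    fix B assume "B \<in> sets (distr (?C \<Otimes>\<^sub>M ?X) ?X snd)"
    then have B: "B \<in> sets ?X" by simp
    have "snd -` B \<inter> space (?C \<Otimes>\<^sub>M ?X) = space ?C \<times> B"
      using sets.sets_into_space[OF B] by (auto simp: space_pair_measure)
    then show "emeasure (distr (?C \<Otimes>\<^sub>M ?X) ?X snd) B = emeasure ?X B"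
      using B by (simp add: emeasure_distr X.emeasure_pair_measure_Times C.emeasure_space_1)
  qed simp
  have 2: "AE \<omega> in noise_law q. \<forall>p::'d site \<times> nat. snd \<omega> p \<in> {1, - 1}"
    unfolding noise_law_eq by (rule AE_distrD[where f = snd and M' = ?X]) (simp, unfold snd, rule spn)
  from 1 2 show ?thesis
  proof eventually_elim
    fix \<omega> :: "'d noise"
    assume 1: "\<forall>x. (\<forall>i. fst \<omega> (x, i) > 0) \<and> (\<forall>b::nat. \<exists>i. real b < (\<Sum>j\<le>i. fst \<omega> (x, j)))"
      and 2: "\<forall>p. snd \<omega> p \<in> {1, - 1}"
    have "\<exists>i. b < ring_time \<omega> x i" for x b
    proof -
      obtain n :: nat where "b < real n" using reals_Archimedean2 by blast
      then show ?thesis using 1 unfolding ring_time_def by (meson order_less_trans)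
    qed
    then show "regular \<omega>"
      using 1 2 unfolding regular_def by auto
  qed
qed

lemma ring_in_interval_measurable [measurable]:
  "Measurable.pred (noise_law q) (\<lambda>\<omega>. \<exists>i. s < ring_time \<omega> x i \<and> ring_time \<omega> x i \<le> s + h)"
  unfolding ring_time_def by measurable

text \<open>By stationarity, the wait for the first ring after time \<open>s\<close> is exponential.\<close>

lemma prob_ring_in_interval:
  fixes x :: "'d::finite site"
  assumes s: "0 \<le> s" and h: "0 \<le> h"
  shows "measure (noise_law q) {\<omega>. \<exists>i. s < ring_time \<omega> x i \<and> ring_time \<omega> x i \<le> s + h} \<le> h"
proof -
  let ?N = "noise_law q :: 'd noise measure"
  interpret N: prob_space ?N by (rule prob_space_noise_law)
  interpret C: product_prob_space "\<lambda>_. exp_law" "UNIV :: ('d site \<times> nat) set" by unfold_locales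
  interpret X: prob_space "spins_law q :: ('d site \<times> nat \<Rightarrow> int) measure" by (rule prob_space_spins_law)
  have R [measurable]: "restart 0 s \<in> measurable ?N ?N" by (rule distr_restart(1)[OF s])
  have "measure ?N {\<omega>. \<exists>i. s < ring_time \<omega> x i \<and> ring_time \<omega> x i \<le> s + h}
      \<le> measure ?N (restart 0 s -` {\<omega>. fst \<omega> (x, 0) \<le> h} \<inter> space ?N)"
  proof (rule N.finite_measure_mono_AE)
    show "restart 0 s -` {\<omega>. fst \<omega> (x, 0) \<le> h} \<inter> space ?N \<in> sets ?N"
    proof (rule measurable_sets[OF R])
      have "{\<omega> \<in> space ?N. fst \<omega> (x, 0) \<le> h} \<in> sets ?N" by measurable
      then show "{\<omega>. fst \<omega> (x, 0) \<le> h} \<in> sets ?N" by simp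
    qed
    show "AE \<omega> in ?N. \<omega> \<in> {\<omega>. \<exists>i. s < ring_time \<omega> x i \<and> ring_time \<omega> x i \<le> s + h} \<longrightarrow>
      \<omega> \<in> restart 0 s -` {\<omega>. fst \<omega> (x, 0) \<le> h} \<inter> space ?N"
      using AE_regular
    proof eventually_elim
      fix \<omega> :: "'d noise" assume reg: "regular \<omega>"
      have "fst (restart 0 s \<omega>) (x, 0) \<le> h" if i: "s < ring_time \<omega> x i" "ring_time \<omega> x i \<le> s + h" for i
      proof -
        have "ring_time \<omega> x (rings_upto \<omega> x s) \<le> ring_time \<omega> x i"
          using i by (simp add: ring_time_le_iff[OF reg] rings_upto_le_iff[OF reg])
        then show ?thesis using i by (simp add: restart_def)
      qed
      then show "\<omega> \<in> {\<omega>. \<exists>i. s < ring_time \<omega> x i \<and> ring_time \<omega> x i \<le> s + h} \<longrightarrow>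
        \<omega> \<in> restart 0 s -` {\<omega>. fst \<omega> (x, 0) \<le> h} \<inter> space ?N" by auto
    qed
  qed
  also have "\<dots> = measure (distr ?N ?N (restart 0 s)) {\<omega>. fst \<omega> (x, 0) \<le> h}"
  proof (rule measure_distr[OF R, symmetric])
    have "{\<omega> \<in> space ?N. fst \<omega> (x, 0) \<le> h} \<in> sets ?N" by measurable
    then show "{\<omega>. fst \<omega> (x, 0) \<le> h} \<in> sets ?N" by simp
  qed
  also have "\<dots> = measure ?N {\<omega>. fst \<omega> (x, 0) \<le> h}"
    by (simp add: distr_restart(2)[OF s])
  also have "\<dots> = measure exp_law {..h}"
  proof -
    have "distr ?N exp_law (\<lambda>\<omega>. fst \<omega> (x, 0)) = distr (distr ?N clocks_law fst) exp_law (\<lambda>\<tau>. \<tau> (x, 0))"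
      unfolding noise_law_eq by (subst distr_distr) (auto simp: comp_def)
    also have "\<dots> = exp_law"
      unfolding noise_law_eq X.distr_pair_fst by (rule C.PiM_component) simp
    finally have d: "distr ?N exp_law (\<lambda>\<omega>. fst \<omega> (x, 0)) = exp_law" .
    have "measure (distr ?N exp_law (\<lambda>\<omega>. fst \<omega> (x, 0))) {..h} = measure ?N ((\<lambda>\<omega>. fst \<omega> (x, 0)) -` {..h} \<inter> space ?N)"
      by (rule measure_distr) auto
    then show ?thesis unfolding d by (simp add: vimage_def)
  qed
  also have "\<dots> = 1 - exp (- h)" by (rule exp_law_le[OF h])
  also have "\<dots> \<le> h" using exp_ge_add_one_self[of "- h"] by simp
  finally show ?thesis .
qed

section \<open>Local events\<close>

text \<open>
  All random inputs, indexed by one type and made real-valued: the initial spins of the blocks, the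
  waiting times and the tie-breaking variables. An event is local if it is measurable with
  respect to the inputs in some set; events that are local to disjoint sets are independent.
\<close>

type_synonym 'd sample = "'d config \<times> 'd noise"
type_synonym 'd input = "'d site + (('d site \<times> nat) + ('d site \<times> nat))"

fun input_value :: "'d::finite input \<Rightarrow> 'd sample \<Rightarrow> real" where
  "input_value (Inl i) z = real_of_int (fst z i)"
| "input_value (Inr (Inl p)) z = fst (snd z) p"
| "input_value (Inr (Inr p)) z = real_of_int (snd (snd z) p)"

lemma input_value_fun:
  "input_value (Inl a) = (\<lambda>z. real_of_int (fst z a))"
  "input_value (Inr (Inl p)) = (\<lambda>z. fst (snd z) p)"
  "input_value (Inr (Inr p)) = (\<lambda>z. real_of_int (snd (snd z) p))"
  by auto

definition local_algebra :: "'d::finite input set \<Rightarrow> 'd sample measure" where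
  "local_algebra K = vimage_algebra UNIV (\<lambda>z. restrict (\<lambda>i. input_value i z) K) (\<Pi>\<^sub>M _\<in>K. borel)"

definition noise_at :: "'d::finite site set \<Rightarrow> 'd input set" where
  "noise_at S = {Inr (Inl (x, i)) | x i. x \<in> S} \<union> {Inr (Inr (x, i)) | x i. x \<in> S}"

lemma space_local_algebra [simp]: "space (local_algebra K) = UNIV"
  by (simp add: local_algebra_def)

lemma input_value_local:
  assumes "i \<in> K"
  shows "input_value i \<in> borel_measurable (local_algebra K)"
proof -
  have "(\<lambda>z. restrict (\<lambda>i. input_value i z) K) \<in> measurable (local_algebra K) (\<Pi>\<^sub>M _\<in>K. borel)"
    unfolding local_algebra_def by (rule measurable_vimage_algebra1) (auto simp: space_PiM)
  from measurable_compose[OF this measurable_component_singleton[OF assms]] show ?thesis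
    using assms by simp
qed

lemma sets_local_algebra_subset:
  assumes "\<And>i. i \<in> K \<Longrightarrow> input_value i \<in> borel_measurable N" "space N = UNIV"
  shows "sets (local_algebra K) \<subseteq> sets N"
proof
  fix A assume "A \<in> sets (local_algebra K)"
  then obtain B where B: "B \<in> sets (\<Pi>\<^sub>M _\<in>K. borel :: real measure)"
    "A = (\<lambda>z. restrict (\<lambda>i. input_value i z) K) -` B"
    by (auto simp: local_algebra_def sets_vimage_algebra2 space_PiM)
  have "(\<lambda>z. restrict (\<lambda>i. input_value i z) K) \<in> measurable N (\<Pi>\<^sub>M _\<in>K. borel)"
    using assms(1) by (intro measurable_restrict) auto
  from measurable_sets[OF this B(1)] show "A \<in> sets N"
    using B(2) assms(2) by simp
qed

lemma local_algebra_mono: "K \<subseteq> K' \<Longrightarrow> sets (local_algebra K) \<subseteq> sets (local_algebra K')"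
  by (rule sets_local_algebra_subset) (auto intro: input_value_local)

lemma noise_at_mono: "S \<subseteq> S' \<Longrightarrow> noise_at S \<subseteq> noise_at S'"
  by (auto simp: noise_at_def)

lemma waiting_time_local:
  assumes "x \<in> S" "noise_at S \<subseteq> K"
  shows "(\<lambda>z. fst (snd z) (x, i)) \<in> borel_measurable (local_algebra K)"
  using input_value_local[of "Inr (Inl (x, i))" K] assms by (auto simp: noise_at_def input_value_fun)

lemma tie_variable_local:
  assumes "x \<in> S" "noise_at S \<subseteq> K"
  shows "(\<lambda>z. snd (snd z) (x, i)) \<in> measurable (local_algebra K) (count_space UNIV)"
proof -
  have "(\<lambda>z. real_of_int (snd (snd z) (x, i))) \<in> borel_measurable (local_algebra K)"
    using input_value_local[of "Inr (Inr (x, i))" K] assms by (auto simp: noise_at_def input_value_fun)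
  then have "(\<lambda>z. \<lfloor>real_of_int (snd (snd z) (x, i))\<rfloor>) \<in> measurable (local_algebra K) (count_space UNIV)"
    by measurable
  then show ?thesis by simp
qed

lemma initial_spin_local:
  assumes "Inl i \<in> K"
  shows "{z. fst z i \<noteq> 1} \<in> sets (local_algebra K)"
proof -
  have "(\<lambda>z. real_of_int (fst z i)) \<in> borel_measurable (local_algebra K)"
    using input_value_local[OF assms] by (simp add: input_value_fun)
  then have "{z \<in> space (local_algebra K). real_of_int (fst z i) \<noteq> 1} \<in> sets (local_algebra K)"
    by measurable
  then show ?thesis by simp
qed

context
  fixes \<epsilon> q :: real
begin

abbreviation "law \<equiv> random_init_law \<epsilon> q :: 'd::finite sample measure"

lemma prob_space_block_law: "prob_space (block_law \<epsilon>)"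
  unfolding block_law_def by (rule prob_space_PiM) (rule prob_space_measure_pmf)

lemma prob_space_law: "prob_space (law :: 'd::finite sample measure)"
proof -
  interpret B: prob_space "block_law \<epsilon> :: 'd::finite config measure" by (rule prob_space_block_law)
  interpret N: prob_space "noise_law q :: 'd noise measure" by (rule prob_space_noise_law)
  interpret pair_prob_space "block_law \<epsilon> :: 'd config measure" "noise_law q :: 'd noise measure" by unfold_locales
  show ?thesis unfolding random_init_law_def by unfold_locales
qed

lemma space_law [simp]: "space law = UNIV"
  by (simp add: random_init_law_def block_law_def space_pair_measure space_PiM PiE_UNIV_domain)

lemma distr_law_snd: "distr law (noise_law q) snd = (noise_law q :: 'd::finite noise measure)"
proof (rule measure_eqI)
  interpret B: prob_space "block_law \<epsilon> :: 'd config measure" by (rule prob_space_block_law)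
  interpret N: prob_space "noise_law q :: 'd noise measure" by (rule prob_space_noise_law)
  fix A assume "A \<in> sets (distr law (noise_law q :: 'd noise measure) snd)"
  then have A: "A \<in> sets (noise_law q)" by simp
  have "snd -` A \<inter> space law = space (block_law \<epsilon> :: 'd config measure) \<times> A"
    by (auto simp: block_law_def space_PiM)
  then show "emeasure (distr law (noise_law q) snd) A = emeasure (noise_law q) A"
    using A by (simp add: emeasure_distr random_init_law_def N.emeasure_pair_measure_Times B.emeasure_space_1)
qed simp

lemma snd_law_measurable [measurable]: "snd \<in> measurable law (noise_law q :: 'd::finite noise measure)"
  unfolding random_init_law_def by measurable

lemma fst_law_measurable: "(\<lambda>z. fst z i) \<in> measurable law (count_space UNIV)"
proof -
  have "(\<lambda>z. fst z i) \<in> measurable law (measure_pmf (spin_pmf (1 - \<epsilon>)))"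
    unfolding random_init_law_def block_law_def by measurable
  then show ?thesis by simp
qed

lemma measure_law_noise:
  assumes "A \<in> sets (noise_law q :: 'd::finite noise measure)"
  shows "measure law {z. snd z \<in> A} = measure (noise_law q) A"
proof -
  have "measure (distr law (noise_law q) snd) A = measure law (snd -` A \<inter> space law)"
    by (rule measure_distr[OF snd_law_measurable assms])
  then show ?thesis by (simp add: distr_law_snd vimage_def)
qed

lemma AE_law_noise:
  assumes "AE \<omega> in (noise_law q :: 'd::finite noise measure). P \<omega>"
  shows "AE z in (law :: 'd sample measure). P (snd z)"
  by (rule AE_distrD[OF snd_law_measurable, where P = P], unfold distr_law_snd, rule assms)

lemma input_value_measurable: "input_value i \<in> borel_measurable (law :: 'd::finite sample measure)"
proof (cases i)
  case (Inl a)
  have "(\<lambda>z. real_of_int (fst z a)) \<in> borel_measurable (law :: 'd sample measure)"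
    by (rule measurable_compose[OF fst_law_measurable]) simp
  then show ?thesis by (simp add: Inl input_value_fun)
next
  case (Inr b)
  show ?thesis
  proof (cases b)
    case (Inl a)
    then show ?thesis
      using measurable_compose[OF snd_law_measurable waiting_time_measurable[of a]] Inr by (simp add: input_value_fun)
  next
    case (Inr c)
    have "(\<lambda>z. real_of_int (snd (snd z) c)) \<in> borel_measurable (law :: 'd sample measure)"
      by (rule measurable_compose[OF measurable_compose[OF snd_law_measurable tie_variable_measurable]]) simp
    then show ?thesis using \<open>i = Inr b\<close> Inr by (simp add: input_value_fun)
  qed
qed

lemma local_algebra_sets_law: "A \<in> sets (local_algebra K) \<Longrightarrow> A \<in> sets (law :: 'd::finite sample measure)"
  using sets_local_algebra_subset[of K "law :: 'd sample measure"] input_value_measurable by auto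

text \<open>Cylinders in the nested product of the three families factorize.\<close>

lemma indep_inputs: "prob_space.indep_vars (law :: 'd::finite sample measure) (\<lambda>_. borel) input_value UNIV"
proof -
  let ?B = "block_law \<epsilon> :: 'd config measure" and ?N = "noise_law q :: 'd noise measure"
  let ?C = "clocks_law :: ('d site \<times> nat \<Rightarrow> real) measure" and ?X = "spins_law q :: ('d site \<times> nat \<Rightarrow> int) measure"
  let ?L = "law :: 'd sample measure"
  interpret L: prob_space ?L by (rule prob_space_law)
  interpret B: prob_space ?B by (rule prob_space_block_law)
  interpret N: prob_space ?N by (rule prob_space_noise_law)
  interpret X: prob_space ?X by (rule prob_space_spins_law)
  define m :: "'d input \<Rightarrow> real set \<Rightarrow> ennreal" where "m i A = (case i of
      Inl a \<Rightarrow> emeasure (measure_pmf (spin_pmf (1 - \<epsilon>))) (real_of_int -` A)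
    | Inr (Inl p) \<Rightarrow> emeasure exp_law A
    | Inr (Inr p) \<Rightarrow> emeasure (measure_pmf (spin_pmf q)) (real_of_int -` A))" for i A
  have cyl: "emeasure ?L {z. \<forall>i\<in>J. input_value i z \<in> A i} = (\<Prod>i\<in>J. m i (A i))"
    if J: "finite J" and A: "\<And>i. i \<in> J \<Longrightarrow> A i \<in> sets borel" for J A
  proof -
    define J1 where "J1 = {a. Inl a \<in> J}"
    define J2 where "J2 = {p. Inr (Inl p) \<in> J}"
    define J3 where "J3 = {p. Inr (Inr p) \<in> J}"
    have JP: "J = J1 <+> (J2 <+> J3)"
      unfolding J1_def J2_def J3_def
    proof (intro set_eqI)
      fix i show "i \<in> J \<longleftrightarrow> i \<in> {a. Inl a \<in> J} <+> ({p. Inr (Inl p) \<in> J} <+> {p. Inr (Inr p) \<in> J})"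
        by (cases i; cases "projr i") (auto simp: Plus_def)
    qed
    have fin: "finite J1" "finite J2" "finite J3"
      using J unfolding JP by (simp_all add: finite_Plus_iff)
    define E1 where "E1 = prod_emb UNIV (\<lambda>_. measure_pmf (spin_pmf (1 - \<epsilon>))) J1 (Pi\<^sub>E J1 (\<lambda>a. real_of_int -` A (Inl a)))"
    define E2 where "E2 = prod_emb UNIV (\<lambda>_. exp_law) J2 (Pi\<^sub>E J2 (\<lambda>p. A (Inr (Inl p))))"
    define E3 where "E3 = prod_emb UNIV (\<lambda>_. measure_pmf (spin_pmf q)) J3 (Pi\<^sub>E J3 (\<lambda>p. real_of_int -` A (Inr (Inr p))))"
    have A2: "A (Inr (Inl p)) \<in> sets exp_law" if "p \<in> J2" for p
      using A[of "Inr (Inl p)"] that by (simp add: J2_def)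
    have s1: "E1 \<in> sets ?B" unfolding E1_def block_law_def using fin by (intro measurable_prod_emb sets_PiM_I_finite) auto
    have s2: "E2 \<in> sets ?C" unfolding E2_def using fin A2 by (intro measurable_prod_emb sets_PiM_I_finite) auto
    have s3: "E3 \<in> sets ?X" unfolding E3_def using fin by (intro measurable_prod_emb sets_PiM_I_finite) auto
    have eq: "{z. \<forall>i\<in>J. input_value i z \<in> A i} = E1 \<times> (E2 \<times> E3)"
      unfolding JP by (auto simp: E1_def E2_def E3_def prod_emb_def space_PiM PiE_def Pi_def extensional_def restrict_def Plus_def
          ball_Un)
    have "emeasure ?L (E1 \<times> (E2 \<times> E3)) = emeasure ?B E1 * (emeasure ?C E2 * emeasure ?X E3)"
    proof -
      have s23: "E2 \<times> E3 \<in> sets ?N" using s2 s3 by (simp add: noise_law_eq)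
      have "emeasure ?L (E1 \<times> (E2 \<times> E3)) = emeasure ?B E1 * emeasure ?N (E2 \<times> E3)"
        unfolding random_init_law_def by (rule N.emeasure_pair_measure_Times[OF s1 s23])
      also have "emeasure ?N (E2 \<times> E3) = emeasure ?C E2 * emeasure ?X E3"
        unfolding noise_law_eq by (rule X.emeasure_pair_measure_Times[OF s2 s3])
      finally show ?thesis .
    qed
    also have "emeasure ?B E1 = (\<Prod>a\<in>J1. m (Inl a) (A (Inl a)))"
      unfolding E1_def block_law_def m_def using fin by (simp add: emeasure_PiM_emb prob_space_measure_pmf)
    also have "emeasure ?C E2 = (\<Prod>p\<in>J2. m (Inr (Inl p)) (A (Inr (Inl p))))"
      unfolding E2_def m_def using fin A2 by (subst emeasure_PiM_emb) (auto simp: exp_law.prob_space_axioms)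
    also have "emeasure ?X E3 = (\<Prod>p\<in>J3. m (Inr (Inr p)) (A (Inr (Inr p))))"
      unfolding E3_def m_def using fin by (simp add: emeasure_PiM_emb prob_space_measure_pmf)
    also have "(\<Prod>a\<in>J1. m (Inl a) (A (Inl a))) * ((\<Prod>p\<in>J2. m (Inr (Inl p)) (A (Inr (Inl p)))) * (\<Prod>p\<in>J3. m (Inr (Inr p)) (A (Inr (Inr p)))))
        = (\<Prod>i\<in>J. m i (A i))"
      unfolding JP using fin by (simp add: prod.Plus)
    finally show ?thesis by (simp add: eq)
  qed
  have marg: "emeasure (distr ?L borel (input_value i)) A = m i A" if "A \<in> sets borel" for i A
  proof -
    have "emeasure (distr ?L borel (input_value i)) A = emeasure ?L {z. input_value i z \<in> A}"
      using that by (subst emeasure_distr[OF input_value_measurable]) (auto simp: vimage_def)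
    then show ?thesis using cyl[of "{i}" "\<lambda>_. A"] that by simp
  qed
  have "distr ?L (\<Pi>\<^sub>M i\<in>UNIV. borel) (\<lambda>z. \<lambda>i\<in>UNIV. input_value i z) = (\<Pi>\<^sub>M i\<in>UNIV. distr ?L borel (input_value i))"
  proof (rule measure_eqI_PiM_infinite)
    have im: "(\<lambda>z. \<lambda>i\<in>UNIV. input_value i z) \<in> measurable ?L (\<Pi>\<^sub>M i\<in>UNIV. borel)"
      by (intro measurable_restrict input_value_measurable)
    show "finite_measure (distr ?L (\<Pi>\<^sub>M i\<in>UNIV. borel) (\<lambda>z. \<lambda>i\<in>UNIV. input_value i z))"
      by (rule L.finite_measure_distr[OF im])
    fix A :: "'d input \<Rightarrow> real set" and J :: "'d input set"
    assume J: "finite J" "J \<subseteq> UNIV" and A: "\<And>i. i \<in> J \<Longrightarrow> A i \<in> sets (distr ?L borel (input_value i))"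
    let ?E = "prod_emb UNIV (\<lambda>i. distr ?L borel (input_value i)) J (Pi\<^sub>E J A)"
    have E: "?E = prod_emb UNIV (\<lambda>_. borel) J (Pi\<^sub>E J A)"
      by (simp add: prod_emb_def)
    have A': "A i \<in> sets borel" if "i \<in> J" for i using A[OF that] by simp
    have "emeasure (distr ?L (\<Pi>\<^sub>M i\<in>UNIV. borel) (\<lambda>z. \<lambda>i\<in>UNIV. input_value i z)) ?E
        = emeasure ?L {z. \<forall>i\<in>J. input_value i z \<in> A i}"
    proof -
      have "prod_emb UNIV (\<lambda>_. borel) J (Pi\<^sub>E J A) \<in> sets (\<Pi>\<^sub>M i\<in>UNIV. borel)"
        using J A' by (intro measurable_prod_emb sets_PiM_I_finite) auto
      moreover have "(\<lambda>z. \<lambda>i\<in>UNIV. input_value i z) -` prod_emb UNIV (\<lambda>_. borel) J (Pi\<^sub>E J A) \<inter> space ?L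
          = {z. \<forall>i\<in>J. input_value i z \<in> A i}"
        by (auto simp: prod_emb_def PiE_def Pi_def extensional_def)
      ultimately show ?thesis
        unfolding E by (simp add: emeasure_distr[OF im])
    qed
    also have "\<dots> = (\<Prod>i\<in>J. m i (A i))" by (rule cyl[OF J(1) A'])
    also have "\<dots> = (\<Prod>i\<in>J. emeasure (distr ?L borel (input_value i)) (A i))"
      using A' by (intro prod.cong refl marg[symmetric])
    also have "\<dots> = emeasure (\<Pi>\<^sub>M i\<in>UNIV. distr ?L borel (input_value i)) ?E"
      using J A by (intro emeasure_PiM_emb[symmetric] L.prob_space_distr input_value_measurable) auto
    finally show "emeasure (distr ?L (\<Pi>\<^sub>M i\<in>UNIV. borel) (\<lambda>z. \<lambda>i\<in>UNIV. input_value i z)) ?E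
      = emeasure (\<Pi>\<^sub>M i\<in>UNIV. distr ?L borel (input_value i)) ?E" .
  qed (auto intro!: sets_PiM_cong)
  then show ?thesis
    by (subst L.indep_vars_iff_distr_eq_PiM') (auto intro: input_value_measurable)
qed

lemma local_events_independent:
  assumes J: "finite J" and disj: "disjoint_family_on K J" and A: "\<And>j. j \<in> J \<Longrightarrow> A j \<in> sets (local_algebra (K j))"
  shows "measure (law :: 'd::finite sample measure) {z. \<forall>j\<in>J. z \<in> A j} = (\<Prod>j\<in>J. measure law (A j))"
proof (cases "J = {}")
  case True
  interpret L: prob_space "law :: 'd sample measure" by (rule prob_space_law)
  show ?thesis using True L.prob_space by simp
next
  case False
  interpret L: prob_space "law :: 'd sample measure" by (rule prob_space_law)
  have ind: "L.indep_vars (\<lambda>j. \<Pi>\<^sub>M _\<in>K j. borel) (\<lambda>j z. restrict (\<lambda>i. input_value i z) (K j)) J"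
    by (rule L.indep_vars_restrict[OF indep_inputs _ disj]) simp
  have "\<exists>B. B \<in> sets (\<Pi>\<^sub>M _\<in>K j. borel :: real measure) \<and> A j = (\<lambda>z. restrict (\<lambda>i. input_value i z) (K j)) -` B"
    if "j \<in> J" for j
    using A[OF that] by (auto simp: local_algebra_def sets_vimage_algebra2 space_PiM)
  then obtain B where B: "\<And>j. j \<in> J \<Longrightarrow> B j \<in> sets (\<Pi>\<^sub>M _\<in>K j. borel :: real measure)"
    "\<And>j. j \<in> J \<Longrightarrow> A j = (\<lambda>z. restrict (\<lambda>i. input_value i z) (K j)) -` B j"
    by metis
  have "L.prob (\<Inter>j\<in>J. (\<lambda>z. restrict (\<lambda>i. input_value i z) (K j)) -` B j \<inter> space law) =
    (\<Prod>j\<in>J. L.prob ((\<lambda>z. restrict (\<lambda>i. input_value i z) (K j)) -` B j \<inter> space law))"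
    by (rule L.indep_varsD[OF ind False J]) (use B in auto)
  also have "(\<Inter>j\<in>J. (\<lambda>z. restrict (\<lambda>i. input_value i z) (K j)) -` B j \<inter> space law) = {z. \<forall>j\<in>J. z \<in> A j}"
    using B(2) False by (auto simp del: space_law) (simp_all)
  also have "(\<Prod>j\<in>J. L.prob ((\<lambda>z. restrict (\<lambda>i. input_value i z) (K j)) -` B j \<inter> space law)) = (\<Prod>j\<in>J. L.prob (A j))"
    using B(2) by (intro prod.cong) auto
  finally show ?thesis .
qed

end

text \<open>
  Events that concern the noise at the sites of \<open>S\<close> are measurable as soon as the inputs there are.
  The random noise \<open>f\<close> is left open so that this applies to local algebras and to restarted noise.
\<close>

context
  fixes F :: "'z measure" and f :: "'z \<Rightarrow> 'd::finite noise" and S :: "'d site set"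
  assumes waiting: "\<And>x i. x \<in> S \<Longrightarrow> (\<lambda>z. fst (f z) (x, i)) \<in> borel_measurable F"
    and ties: "\<And>x i. x \<in> S \<Longrightarrow> (\<lambda>z. snd (f z) (x, i)) \<in> measurable F (count_space UNIV)"
begin

lemma ring_time_measurable_at: "x \<in> S \<Longrightarrow> (\<lambda>z. ring_time (f z) x i) \<in> borel_measurable F"
  unfolding ring_time_def using waiting by measurable

lemma rings_upto_measurable_at: "x \<in> S \<Longrightarrow> (\<lambda>z. rings_upto (f z) x c) \<in> measurable F (count_space UNIV)"
  unfolding rings_upto_def using ring_time_measurable_at by measurable

lemma rings_before_measurable_at:
  "x \<in> S \<Longrightarrow> y \<in> S \<Longrightarrow> (\<lambda>z. rings_before (f z) y (ring_time (f z) x i)) \<in> measurable F (count_space UNIV)"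
  unfolding rings_before_def using ring_time_measurable_at by measurable

lemma approximation_measurable_at:
  assumes "\<Lambda> \<subseteq> S"
  shows "(\<lambda>z. approximation \<Lambda> \<sigma>\<^sub>0 n (f z) x m) \<in> measurable F (count_space UNIV)"
proof (induction n arbitrary: x m)
  case (Suc n)
  show ?case
  proof (cases "m = 0 \<or> x \<notin> \<Lambda>")
    case False
    then obtain i where m: "m = Suc i" and x: "x \<in> \<Lambda>" by (cases m) auto
    define g where "g y z = approximation \<Lambda> \<sigma>\<^sub>0 n (f z) y (rings_before (f z) y (ring_time (f z) x i))" for y z
    have "g y \<in> measurable F (count_space UNIV)" for y
    proof (cases "y \<in> \<Lambda>")
      case True
      show ?thesis
        unfolding g_def using True x assms
        by (intro measurable_compose_countable[OF Suc.IH rings_before_measurable_at]) auto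
    next
      case False
      have "g y = (\<lambda>_. \<sigma>\<^sub>0 y)" using False by (auto simp: g_def)
      then show ?thesis by simp
    qed
    then have g: "(\<lambda>z. real_of_int (g y z)) \<in> borel_measurable F" for y
      by (rule measurable_compose) simp
    have [measurable]: "(\<lambda>z. \<Sum>y\<in>neighbors x. real_of_int (g y z)) \<in> borel_measurable F"
      by (intro borel_measurable_sum g)
    have [measurable]: "(\<lambda>z. snd (f z) (x, i)) \<in> measurable F (count_space UNIV)"
      using ties x assms by auto
    have "(\<lambda>z. approximation \<Lambda> \<sigma>\<^sub>0 (Suc n) (f z) x m) = (\<lambda>z. if 0 < (\<Sum>y\<in>neighbors x. real_of_int (g y z)) then 1
        else if (\<Sum>y\<in>neighbors x. real_of_int (g y z)) < 0 then - 1 else snd (f z) (x, i))"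
      using x by (auto simp: m majority_def Let_def g_def fun_eq_iff simp flip: of_int_sum)
    then show ?thesis by simp
  qed auto
qed simp

lemma erodes_measurable_at:
  assumes "cube L \<subseteq> S"
  shows "Measurable.pred F (\<lambda>z. erodes L c (f z))"
proof -
  have "(\<lambda>z. approximation (cube L) (cube_init L) n (f z) x (rings_upto (f z) x c)) \<in> measurable F (count_space UNIV)"
    if "x \<in> cube L" for n x
    using that assms by (intro measurable_compose_countable[OF approximation_measurable_at rings_upto_measurable_at]) auto
  then have [measurable]: "Measurable.pred F (\<lambda>z. \<forall>x\<in>cube L. approximation (cube L) (cube_init L) n (f z) x (rings_upto (f z) x c) = 1)" for n
    by (intro pred_intros_finite) auto
  show ?thesis
    unfolding erodes_def eventually_sequentially by measurable
qed

lemma chronological_measurable_at: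
  assumes "set xs \<subseteq> S" "g \<in> borel_measurable F"
  shows "Measurable.pred F (\<lambda>z. chronological (f z) a (g z) xs)"
  using assms
proof (induction xs arbitrary: g)
  case (Cons x xs)
  have [measurable]: "(\<lambda>z. ring_time (f z) x i) \<in> borel_measurable F" for i
    using Cons.prems ring_time_measurable_at by simp
  have [measurable]: "Measurable.pred F (\<lambda>z. chronological (f z) a (ring_time (f z) x i) xs)" for i
    using Cons.prems by (intro Cons.IH) auto
  have [measurable]: "g \<in> borel_measurable F" by fact
  show ?case
    unfolding chronological.simps by measurable
qed simp

lemma fast_path_measurable_at:
  assumes "D \<subseteq> S"
  shows "Measurable.pred F (\<lambda>z. fast_path (f z) D a s n x)"
proof -
  have [measurable]: "Measurable.pred F (\<lambda>z. chronological (f z) a s xs)" if "set xs \<subseteq> D" for xs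
    using that assms by (intro chronological_measurable_at) auto
  have "Measurable.pred F (\<lambda>z. length xs = n \<and> xs \<noteq> [] \<and> hd xs = x \<and> distinct xs \<and> set xs \<subseteq> D \<and> chronological (f z) a s xs)" for xs
    by (cases "set xs \<subseteq> D") auto
  then show ?thesis
    unfolding fast_path_def by measurable
qed

lemma restart_measurable_at:
  assumes "x + v \<in> S"
  shows "(\<lambda>z. fst (restart v t (f z)) (x, i)) \<in> borel_measurable F"
    and "(\<lambda>z. snd (restart v t (f z)) (x, i)) \<in> measurable F (count_space UNIV)"
proof -
  have "(\<lambda>z. if i = 0 then ring_time (f z) (x + v) k - t else fst (f z) (x + v, k + i)) \<in> borel_measurable F" for k
    using ring_time_measurable_at[OF assms] waiting[OF assms] by measurable
  from measurable_compose_countable[OF this rings_upto_measurable_at[OF assms]]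
  show "(\<lambda>z. fst (restart v t (f z)) (x, i)) \<in> borel_measurable F"
    by (simp add: restart_def cong: if_cong)
  have "(\<lambda>z. snd (f z) (x + v, k + i)) \<in> measurable F (count_space UNIV)" for k
    using ties[OF assms] by measurable
  from measurable_compose_countable[OF this rings_upto_measurable_at[OF assms]]
  show "(\<lambda>z. snd (restart v t (f z)) (x, i)) \<in> measurable F (count_space UNIV)"
    by (simp add: restart_def)
qed

end

lemma local_erodes_restart:
  assumes "\<And>x. x \<in> cube L \<Longrightarrow> x + v \<in> S" "noise_at S \<subseteq> K"
  shows "{z. \<not> erodes L c (restart v t (snd z))} \<in> sets (local_algebra K)"
proof -
  have "Measurable.pred (local_algebra K) (\<lambda>z. erodes L c (restart v t (snd z)))"
    by (rule erodes_measurable_at[where S = "cube L"];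
      (rule restart_measurable_at[where S = S and F = "local_algebra K" and f = snd])?)
      (use assms waiting_time_local tie_variable_local in blast)+
  then have "{z \<in> space (local_algebra K). \<not> erodes L c (restart v t (snd z))} \<in> sets (local_algebra K)"
    by measurable
  then show ?thesis by simp
qed

lemma local_fast_path:
  assumes "D \<subseteq> S" "noise_at S \<subseteq> K"
  shows "{z. fast_path (snd z) D a s n x} \<in> sets (local_algebra K)"
proof -
  have "Measurable.pred (local_algebra K) (\<lambda>z. fast_path (snd z) D a s n x)"
    by (rule fast_path_measurable_at[where S = S]) (use assms waiting_time_local tie_variable_local in blast)+
  then show ?thesis by (simp add: pred_def)
qed

section \<open>Influence travels at finite speed\<close>

fun walks :: "nat \<Rightarrow> 'd::finite site \<Rightarrow> 'd site list set" where
  "walks 0 x = {[x]}"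
| "walks (Suc n) x = (\<Union>y\<in>neighbors x. (#) x ` walks n y)"

lemma finite_walks [simp]: "finite (walks n x)"
  by (induction n arbitrary: x) auto

lemma card_walks_le: "card (walks n (x :: 'd::finite site)) \<le> (3 ^ CARD('d)) ^ n"
proof (induction n arbitrary: x)
  case (Suc n)
  have "card (walks (Suc n) x) \<le> (\<Sum>y\<in>neighbors x. card ((#) x ` walks n y))"
    by (simp add: card_UN_le)
  also have "\<dots> \<le> (\<Sum>y\<in>neighbors x. (3 ^ CARD('d)) ^ n)"
    by (intro sum_mono order_trans[OF card_image_le Suc.IH]) auto
  also have "\<dots> \<le> 3 ^ CARD('d) * (3 ^ CARD('d)) ^ n"
    using card_neighbors_le[of x] by simp
  finally show ?case by simp
qed simp

lemma chronological_in_walks: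
  "chronological \<omega> a s xs \<Longrightarrow> length xs = Suc n \<Longrightarrow> xs \<in> walks n (hd xs)"
proof (induction n arbitrary: s xs)
  case 0
  then show ?case by (cases xs) auto
next
  case (Suc n)
  then obtain x xs' where xs: "xs = x # xs'" "length xs' = Suc n" by (cases xs) auto
  then obtain i where "xs' = [] \<or> hd xs' \<in> neighbors x" "chronological \<omega> a (ring_time \<omega> x i) xs'"
    using Suc.prems by auto
  then show ?case
    using Suc.IH[of "ring_time \<omega> x i" xs'] xs by (cases xs') auto
qed

fun decreasing_labels :: "nat \<Rightarrow> nat \<Rightarrow> nat list set" where
  "decreasing_labels 0 N = {[]}"
| "decreasing_labels (Suc n) N = (\<Union>l<N. (#) l ` decreasing_labels n (Suc l))"

lemma finite_decreasing_labels [simp]: "finite (decreasing_labels n N)"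
  by (induction n arbitrary: N) auto

lemma card_decreasing_labels_le: "card (decreasing_labels n N) \<le> 2 ^ (n + N)"
proof (induction n arbitrary: N)
  case (Suc n)
  have "card (decreasing_labels (Suc n) N) \<le> (\<Sum>l<N. card ((#) l ` decreasing_labels n (Suc l)))"
    by (simp add: card_UN_le)
  also have "\<dots> \<le> (\<Sum>l<N. 2 ^ (n + Suc l))"
    by (intro sum_mono order_trans[OF card_image_le Suc.IH]) auto
  also have "\<dots> = 2 ^ Suc n * (\<Sum>l<N. 2 ^ l)"
    by (simp add: sum_distrib_left power_add mult_ac)
  also have "(\<Sum>l<N. 2 ^ l) \<le> (2 :: nat) ^ N"
    by (induction N) auto
  finally show ?case by (simp add: power_add)
qed simp

text \<open>
  Cutting time into steps of length \<open>h\<close>, the rings along a chronological path are assigned to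
  steps in a monotone way.
\<close>

lemma chronological_labels:
  assumes "chronological \<omega> a s xs" "h > 0" "s \<le> a + real N * h"
  shows "\<exists>ls\<in>decreasing_labels (length xs) N. length ls = length xs \<and> (\<forall>i<length xs. \<exists>k.
    a + real (ls ! i) * h < ring_time \<omega> (xs ! i) k \<and> ring_time \<omega> (xs ! i) k \<le> a + real (ls ! i) * h + h)"
  using assms
proof (induction xs arbitrary: s N)
  case (Cons x xs)
  obtain k where k: "a < ring_time \<omega> x k" "ring_time \<omega> x k < s" "chronological \<omega> a (ring_time \<omega> x k) xs"
    using Cons.prems by auto
  define r where "r = (ring_time \<omega> x k - a) / h"
  have r: "0 < r" "r < real N"
    using k Cons.prems by (auto simp: r_def field_simps)
  define l where "l = nat (\<lceil>r\<rceil> - 1)"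
  have l: "real l < r" "r \<le> real l + 1"
    using r ceiling_correct[of r] unfolding l_def by (auto simp: of_nat_nat)
  have lN: "l < N" using l r by simp
  have u: "a + real l * h < ring_time \<omega> x k" "ring_time \<omega> x k \<le> a + real l * h + h"
    using l Cons.prems(2) by (auto simp: r_def field_simps)
  then have "ring_time \<omega> x k \<le> a + real (Suc l) * h" by (simp add: algebra_simps)
  from Cons.IH[OF k(3) Cons.prems(2) this] obtain ls where ls: "ls \<in> decreasing_labels (length xs) (Suc l)"
    "length ls = length xs" "\<forall>i<length xs. \<exists>k. a + real (ls ! i) * h < ring_time \<omega> (xs ! i) k
      \<and> ring_time \<omega> (xs ! i) k \<le> a + real (ls ! i) * h + h" by blast
  have "l # ls \<in> decreasing_labels (length (x # xs)) N"
    using ls(1) lN by auto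
  moreover have "\<exists>k. a + real ((l # ls) ! i) * h < ring_time \<omega> ((x # xs) ! i) k \<and>
      ring_time \<omega> ((x # xs) ! i) k \<le> a + real ((l # ls) ! i) * h + h" if "i < length (x # xs)" for i
    using that u ls(3) by (cases i) auto
  ultimately show ?case
    using ls(2) by (intro bexI[of _ "l # ls"]) auto
qed simp

lemma local_ring_in_interval:
  "{z. \<exists>k. b < ring_time (snd z) x k \<and> ring_time (snd z) x k \<le> c} \<in> sets (local_algebra (noise_at {x}))"
proof -
  have [measurable]: "(\<lambda>z. ring_time (snd z) x k) \<in> borel_measurable (local_algebra (noise_at {x}))" for k
    by (rule ring_time_measurable_at[where S = "{x}"])
      (use waiting_time_local[of _ "{x}"] tie_variable_local[of _ "{x}"] in auto)
  have "{z \<in> space (local_algebra (noise_at {x})). \<exists>k. b < ring_time (snd z) x k \<and> ring_time (snd z) x k \<le> c}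
      \<in> sets (local_algebra (noise_at {x}))"
    by measurable
  then show ?thesis by simp
qed

text \<open>
  A union bound over the paths and the assignments of their rings to time steps. The sites of a path
  are distinct, so its rings are independent.
\<close>

lemma prob_fast_path_le:
  fixes x :: "'d::finite site"
  assumes a: "0 \<le> a" "a \<le> s" and n: "0 < n" "8 * 3 ^ CARD('d) * (s - a) \<le> real n"
  shows "measure (law \<epsilon> q) {z. fast_path (snd z) D a s n x} \<le> (1 / 2) ^ n"
proof -
  let ?L = "law \<epsilon> q :: 'd sample measure"
  interpret L: prob_space ?L by (rule prob_space_law)
  define \<Delta> :: real where "\<Delta> = 3 ^ CARD('d)"
  have \<Delta>: "\<Delta> > 0" by (simp add: \<Delta>_def)
  \<comment> \<open>There are at most \<open>\<Delta>\<^sup>n\<close> paths and \<open>4\<^sup>n\<close> labelings, each of probability at most \<open>h\<^sup>n\<close>.\<close>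
  define h where "h = 1 / (8 * \<Delta>)"
  have h: "h > 0" using \<Delta> by (simp add: h_def)
  define N where "N = nat \<lceil>(s - a) / h\<rceil>"
  have "(s - a) / h \<le> real n"
    using n(2) \<Delta> by (simp add: h_def \<Delta>_def mult.commute)
  then have Nn: "N \<le> n" by (simp add: N_def ceiling_le_iff)
  have "(s - a) / h \<le> real N"
    unfolding N_def using a h by (simp add: of_nat_nat)
  then have sN: "s \<le> a + real N * h"
    using h by (simp add: divide_le_eq)
  define R where "R y l = {z :: 'd sample. \<exists>k. a + real l * h < ring_time (snd z) y k \<and> ring_time (snd z) y k \<le> a + real l * h + h}" for y l
  have R_loc: "R y l \<in> sets (local_algebra (noise_at {y}))" for y l
    unfolding R_def by (rule local_ring_in_interval)
  have R_sets: "R y l \<in> sets ?L" for y l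
    by (rule local_algebra_sets_law[OF R_loc])
  have R_prob: "L.prob (R y l) \<le> h" for y l
  proof -
    let ?A = "{\<omega>. \<exists>k. a + real l * h < ring_time \<omega> y k \<and> ring_time \<omega> y k \<le> a + real l * h + h}"
    have "?A \<in> sets (noise_law q)"
      using ring_in_interval_measurable[of "a + real l * h" y h q] by (simp add: pred_def)
    from measure_law_noise[OF this, of \<epsilon>] show ?thesis
      using prob_ring_in_interval[of "a + real l * h" h q y] a h by (simp add: R_def)
  qed
  define E where "E xs ls = {z. \<forall>i\<in>{..<n}. z \<in> R (xs ! i) (ls ! i)}" for xs ls
  have E_prob: "L.prob (E xs ls) \<le> h ^ n" if "distinct xs" "length xs = n" for xs ls
  proof -
    have "disjoint_family_on (\<lambda>i. noise_at {xs ! i}) {..<n}"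
      using that by (auto simp: disjoint_family_on_def noise_at_def nth_eq_iff_index_eq)
    from local_events_independent[OF finite_lessThan this R_loc]
    have "L.prob (E xs ls) = (\<Prod>i<n. L.prob (R (xs ! i) (ls ! i)))"
      by (simp add: E_def)
    also have "\<dots> \<le> (\<Prod>i<n. h)"
      by (intro prod_mono) (simp add: R_prob)
    finally show ?thesis by simp
  qed
  have E_sets: "E xs ls \<in> sets ?L" for xs ls
  proof -
    have "{z \<in> space ?L. \<forall>i\<in>{..<n}. z \<in> R (xs ! i) (ls ! i)} \<in> sets ?L"
      using R_sets by (intro sets.sets_Collect_finite_All) auto
    then show ?thesis by (simp add: E_def)
  qed
  let ?W = "{xs \<in> walks (n - 1) x. distinct xs \<and> length xs = n}" and ?D = "decreasing_labels n N"
  have finW: "finite ?W" by simp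
  have "{z. fast_path (snd z) D a s n x} \<subseteq> (\<Union>p\<in>?W \<times> ?D. E (fst p) (snd p))"
  proof
    fix z :: "'d sample" assume "z \<in> {z. fast_path (snd z) D a s n x}"
    then obtain xs where xs: "length xs = n" "xs \<noteq> []" "hd xs = x" "distinct xs" "chronological (snd z) a s xs"
      by (auto simp: fast_path_def)
    then have "xs \<in> walks (n - 1) x"
      using chronological_in_walks[OF xs(5), of "n - 1"] n by auto
    moreover obtain ls where "ls \<in> ?D" "z \<in> E xs ls"
      using chronological_labels[OF xs(5) h sN] xs(1) by (auto simp: E_def R_def)
    ultimately show "z \<in> (\<Union>p\<in>?W \<times> ?D. E (fst p) (snd p))"
      using xs by force
  qed
  then have "L.prob {z. fast_path (snd z) D a s n x} \<le> L.prob (\<Union>p\<in>?W \<times> ?D. E (fst p) (snd p))"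
    using E_sets by (intro L.finite_measure_mono sets.finite_UN) auto
  also have "\<dots> \<le> (\<Sum>p\<in>?W \<times> ?D. L.prob (E (fst p) (snd p)))"
    using E_sets finW by (intro L.finite_measure_subadditive_finite) auto
  also have "\<dots> \<le> (\<Sum>p\<in>?W \<times> ?D. h ^ n)"
    by (intro sum_mono E_prob) auto
  also have "\<dots> = real (card ?W) * real (card ?D) * h ^ n"
    by (simp add: card_cartesian_product)
  also have "\<dots> \<le> \<Delta> ^ n * 2 ^ (n + n) * h ^ n"
  proof (intro mult_right_mono mult_mono)
    have "card ?W \<le> card (walks (n - 1) x)" by (intro card_mono) auto
    also have "\<dots> \<le> (3 ^ CARD('d)) ^ (n - 1)" by (rule card_walks_le)
    also have "\<dots> \<le> (3 ^ CARD('d)) ^ n" by (intro power_increasing) auto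
    finally have "real (card ?W) \<le> real ((3 ^ CARD('d)) ^ n)" by (rule of_nat_mono)
    then show "real (card ?W) \<le> \<Delta> ^ n" by (simp add: \<Delta>_def)
    have "card ?D \<le> 2 ^ (n + N)" by (rule card_decreasing_labels_le)
    also have "\<dots> \<le> 2 ^ (n + n)" using Nn by (intro power_increasing) auto
    finally have "real (card ?D) \<le> real (2 ^ (n + n))" by (rule of_nat_mono)
    then show "real (card ?D) \<le> 2 ^ (n + n)" by simp
  qed (use h \<Delta> in auto)
  also have "\<dots> = (\<Delta> * 4 * h) ^ n"
    by (simp add: power_mult_distrib power_add flip: power_mult_distrib[of 2 2])
  also have "\<Delta> * 4 * h = 1 / 2" using \<Delta> by (simp add: h_def)
  finally show ?thesis .
qed

lemma fast_path_sets_law: "{z. fast_path (snd z) D a s n x} \<in> sets (law \<epsilon> q)"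
  by (rule local_algebra_sets_law, rule local_fast_path[OF order_refl order_refl])

lemma AE_finite_influence: "AE z in (law \<epsilon> q :: 'd::finite sample measure). finite_influence (snd z)"
proof -
  let ?L = "law \<epsilon> q :: 'd sample measure"
  interpret L: prob_space ?L by (rule prob_space_law)
  have "AE z in ?L. \<exists>n>0. \<not> fast_path (snd z) UNIV 0 (real H) n x" for x H
  proof -
    define A where "A n = {z :: 'd sample. fast_path (snd z) UNIV 0 (real H) n x}" for n
    have A: "A n \<in> sets ?L" for n unfolding A_def by (rule fast_path_sets_law)
    obtain m :: nat where m: "8 * 3 ^ CARD('d) * real H \<le> real m"
      using real_arch_simple by blast
    have le: "L.prob (\<Inter>n\<in>{0<..}. A n) \<le> (1 / 2) ^ (m + Suc k)" for k
    proof -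
      have "L.prob (\<Inter>n\<in>{0<..}. A n) \<le> L.prob (A (m + Suc k))"
        using A by (intro L.finite_measure_mono) auto
      also have "\<dots> \<le> (1 / 2) ^ (m + Suc k)"
        unfolding A_def by (rule prob_fast_path_le) (use m in auto)
      finally show ?thesis .
    qed
    have "(\<lambda>k. (1 / 2 :: real) ^ (k + Suc m)) \<longlonglongrightarrow> 0"
      by (intro LIMSEQ_ignore_initial_segment LIMSEQ_realpow_zero) auto
    then have "L.prob (\<Inter>n\<in>{0<..}. A n) \<le> 0"
      by (rule LIMSEQ_le_const) (use le in \<open>auto simp: add_ac\<close>)
    then have "L.prob (\<Inter>n\<in>{0<..}. A n) = 0"
      by (simp add: measure_le_0_iff)
    moreover have "(\<Inter>n\<in>{0<..}. A n) \<in> sets ?L"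
      using A by (intro sets.countable_INT) auto
    ultimately have "(\<Inter>n\<in>{0<..}. A n) \<in> null_sets ?L"
      by (simp add: null_sets_def L.emeasure_eq_measure)
    then have "AE z in ?L. z \<notin> (\<Inter>n\<in>{0<..}. A n)" by (rule AE_not_in)
    then show ?thesis by eventually_elim (auto simp: A_def)
  qed
  then show ?thesis
    unfolding finite_influence_def by (simp add: AE_all_countable)
qed

lemma AE_finite_influence_noise: "AE \<omega> in (noise_law q :: 'd::finite noise measure). finite_influence \<omega>"
proof -
  let ?L = "law 0 q :: 'd sample measure"
  have m: "Measurable.pred (noise_law q) (\<lambda>\<omega> :: 'd noise. fast_path \<omega> UNIV 0 (real H) n x)" for H n x
    by (rule fast_path_measurable_at[where S = UNIV]) auto
  have "Measurable.pred (noise_law q) (finite_influence :: 'd noise \<Rightarrow> bool)"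
    unfolding finite_influence_def using m by measurable
  then have s: "{\<omega> \<in> space (noise_law q). finite_influence (\<omega> :: 'd noise)} \<in> sets (noise_law q)"
    by measurable
  have "AE \<omega> in distr ?L (noise_law q) snd. finite_influence \<omega>"
    by (subst AE_distr_iff[OF snd_law_measurable s]) (rule AE_finite_influence)
  then show ?thesis unfolding distr_law_snd .
qed

section \<open>The probability that a cube survives\<close>

lemma not_erodes_sets_noise: "{\<omega>. \<not> erodes L c (\<omega> :: 'd::finite noise)} \<in> sets (noise_law q)"
proof -
  have "Measurable.pred (noise_law q) (\<lambda>\<omega> :: 'd noise. erodes L c \<omega>)"
    by (rule erodes_measurable_at[where S = UNIV]) auto
  then have "{\<omega> \<in> space (noise_law q). \<not> erodes L c (\<omega> :: 'd noise)} \<in> sets (noise_law q)"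
    by measurable
  then show ?thesis by simp
qed

text \<open>
  The event about \<^const>\<open>erosion_time\<close> differs from a measurable one by a null set. Hence it is
  measurable in the completion, and its probability there is that of the measurable event.
\<close>

lemma prob_not_erodes:
  assumes d: "CARD('d::finite) \<ge> 2" and c: "0 \<le> c" "c \<le> c'"
    and erosion: "\<P>(\<omega> in completion (noise_law q :: 'd noise measure). erosion_time L \<omega> > ereal c) \<le> p"
  shows "measure (noise_law q :: 'd noise measure) {\<omega>. \<not> erodes L c' \<omega>} \<le> p"
proof -
  let ?N = "noise_law q :: 'd noise measure"
  interpret N: prob_space ?N by (rule prob_space_noise_law)
  let ?A = "{\<omega>. \<not> erodes L c \<omega>}" and ?E = "{\<omega>. erosion_time L \<omega> > ereal c}"
  have A: "?A \<in> sets ?N" by (rule not_erodes_sets_noise)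
  have ae: "AE \<omega> in ?N. \<omega> \<in> ?E \<longleftrightarrow> \<omega> \<in> ?A"
    using AE_regular AE_finite_influence_noise
  proof eventually_elim
    fix \<omega> :: "'d noise" assume "regular \<omega>" "finite_influence \<omega>"
    then show "\<omega> \<in> ?E \<longleftrightarrow> \<omega> \<in> ?A"
      using erosion_time_le_iff[OF _ d _ c(1), of \<omega> L] by (auto simp: not_le[symmetric])
  qed
  then obtain Z where Z: "{\<omega> \<in> space ?N. \<not> (\<omega> \<in> ?E \<longleftrightarrow> \<omega> \<in> ?A)} \<subseteq> Z" "emeasure ?N Z = 0" "Z \<in> sets ?N"
    by (rule AE_E)
  have "?E = (?A - Z) \<union> (?E \<inter> Z)" using Z(1) by auto
  then have E: "?E \<in> sets (completion ?N)"
    by (rule sets_completionI[where N' = Z]) (use Z A in auto)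
  have "measure ?N {\<omega>. \<not> erodes L c' \<omega>} \<le> measure ?N ?A"
  proof (rule N.finite_measure_mono_AE[OF _ A])
    show "AE \<omega> in ?N. \<omega> \<in> {\<omega>. \<not> erodes L c' \<omega>} \<longrightarrow> \<omega> \<in> ?A"
      using AE_regular
    proof eventually_elim
      fix \<omega> :: "'d noise" assume "regular \<omega>"
      then show "\<omega> \<in> {\<omega>. \<not> erodes L c' \<omega>} \<longrightarrow> \<omega> \<in> ?A"
        using erodes_mono[of \<omega> L c c'] c by auto
    qed
  qed
  also have "\<dots> = measure (completion ?N) ?A"
    using A by simp
  also have "\<dots> = measure (completion ?N) ?E"
    by (rule measure_eq_AE) (use AE_completion[OF ae] A E in \<open>auto elim: eventually_mono\<close>)
  also have "\<dots> \<le> p" using erosion by simp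
  finally show ?thesis .
qed

lemma prob_not_erodes_restart:
  fixes v :: "'d::finite site"
  assumes t: "0 \<le> t"
  shows "measure (law \<epsilon> q) {z. \<not> erodes L c (restart v t (snd z))}
    = measure (noise_law q :: 'd noise measure) {\<omega>. \<not> erodes L c \<omega>}"
proof -
  let ?N = "noise_law q :: 'd noise measure"
  let ?A = "{\<omega> :: 'd noise. \<not> erodes L c \<omega>}"
  have A: "?A \<in> sets ?N" by (rule not_erodes_sets_noise)
  have pre: "restart v t -` ?A \<inter> space ?N \<in> sets ?N"
    by (rule measurable_sets[OF distr_restart(1)[OF t] A])
  have "measure ?N ?A = measure (distr ?N ?N (restart v t)) ?A"
    by (simp add: distr_restart(2)[OF t])
  also have "\<dots> = measure ?N (restart v t -` ?A \<inter> space ?N)"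
    by (rule measure_distr[OF distr_restart(1)[OF t] A])
  also have "\<dots> = measure (law \<epsilon> q) {z. snd z \<in> restart v t -` ?A \<inter> space ?N}"
    by (rule measure_law_noise[OF pre, symmetric])
  finally show ?thesis by simp
qed

section \<open>Covering sparse sets by separated boxes\<close>

definition lower :: "'d::finite site set \<Rightarrow> 'd \<Rightarrow> int" where
  "lower p k = Min ((\<lambda>b. b $ k) ` p)"

definition upper :: "'d::finite site set \<Rightarrow> 'd \<Rightarrow> int" where
  "upper p k = Max ((\<lambda>b. b $ k) ` p)"

text \<open>
  Start with single points and merge sets whose hulls are close to each other. The width of a hull
  grows by merging at most as its number of points does, and two sets of at most \<open>n\<close> points each
  merge into a set that fits into a window of side \<open>4 n\<close>, so that it has at most \<open>n\<close> points again.
\<close>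

lemma separated_hulls:
  fixes B :: "'d::finite site set"
  assumes B: "finite B" and n: "n \<ge> 1"
    and window: "\<And>a. (\<And>k. \<exists>b\<in>B. a $ k = b $ k) \<Longrightarrow>
      card {b\<in>B. \<forall>k. a $ k \<le> b $ k \<and> b $ k < a $ k + 4 * int n} \<le> n"
  obtains P where "\<Union>P = B" "{} \<notin> P"
    "\<And>p k. p \<in> P \<Longrightarrow> upper p k - lower p k \<le> 2 * int n - 2"
    "\<And>p p'. p \<in> P \<Longrightarrow> p' \<in> P \<Longrightarrow> p \<noteq> p' \<Longrightarrow>
      \<exists>k. upper p k + 3 \<le> lower p' k \<or> upper p' k + 3 \<le> lower p k"
proof -
  \<comment> \<open>instead of merging, take an admissible partition with the least number of parts\<close>
  define valid where "valid P \<longleftrightarrow> \<Union>P = B \<and> {} \<notin> P \<and> disjoint P \<and>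
    (\<forall>p\<in>P. card p \<le> n \<and> (\<forall>k. upper p k - lower p k \<le> 2 * int (card p) - 2))" for P
  have "valid ((\<lambda>b. {b}) ` B)"
    using n by (auto simp: valid_def disjoint_def upper_def lower_def)
  then obtain P where P: "valid P" and minimal: "\<And>P'. valid P' \<Longrightarrow> card P \<le> card P'"
    using ex_has_least_nat[of valid _ card] by metis
  have finp: "finite p" "p \<noteq> {}" if "p \<in> P" for p
    using P B that finite_subset[of p B] by (auto simp: valid_def)
  have finP: "finite P"
    using P B by (auto simp: valid_def intro: finite_UnionD)
  have sep: "\<exists>k. upper p k + 3 \<le> lower p' k \<or> upper p' k + 3 \<le> lower p k"
    if p: "p \<in> P" "p' \<in> P" "p \<noteq> p'" for p p'
  proof (rule ccontr)
    assume "\<not> ?thesis"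
    then have "\<not> upper p k + 3 \<le> lower p' k" "\<not> upper p' k + 3 \<le> lower p k" for k
      by blast+
    then have near: "lower p' k \<le> upper p k + 2" "lower p k \<le> upper p' k + 2" for k
      by (smt (verit))+
    let ?q = "p \<union> p'"
    note fin = finp[OF p(1)] finp[OF p(2)]
    have disj: "p \<inter> p' = {}"
      using P p by (auto simp: valid_def disjoint_def)
    have card_q: "card ?q = card p + card p'"
      using fin disj by (simp add: card_Un_disjoint)
    have hull: "upper ?q k = max (upper p k) (upper p' k)" "lower ?q k = min (lower p k) (lower p' k)" for k
      using fin by (auto simp: upper_def lower_def image_Un Max_Un Min_Un)
    have w: "upper p k - lower p k \<le> 2 * int (card p) - 2" "upper p' k - lower p' k \<le> 2 * int (card p') - 2"
      "card p \<le> n" "card p' \<le> n" for k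
      using P p by (auto simp: valid_def)
    have width: "upper ?q k - lower ?q k \<le> 2 * int (card ?q) - 2" for k
      unfolding hull card_q using w(1,2)[of k] near[of k] by (auto simp: max_def min_def)
    have mem: "lower ?q k \<le> b $ k" "b $ k \<le> upper ?q k" if "b \<in> ?q" for b k
      using that fin unfolding lower_def upper_def by (auto intro: Min_le Max_ge)
    let ?a = "\<chi> k. lower ?q k"
    have "\<exists>b\<in>B. ?a $ k = b $ k" for k
    proof -
      have "lower ?q k \<in> (\<lambda>b. b $ k) ` ?q"
        unfolding lower_def using fin by (intro Min_in) auto
      then show ?thesis using P p by (auto simp: valid_def)
    qed
    from window[OF this] have le: "card {b\<in>B. \<forall>k. ?a $ k \<le> b $ k \<and> b $ k < ?a $ k + 4 * int n} \<le> n" .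
    have "?q \<subseteq> {b\<in>B. \<forall>k. ?a $ k \<le> b $ k \<and> b $ k < ?a $ k + 4 * int n}"
    proof
      fix b assume b: "b \<in> ?q"
      then have "b \<in> B" using P p by (auto simp: valid_def)
      moreover have "?a $ k \<le> b $ k \<and> b $ k < ?a $ k + 4 * int n" for k
        using mem[OF b, of k] width[of k] w(3,4) by (simp add: card_q)
      ultimately show "b \<in> {b\<in>B. \<forall>k. ?a $ k \<le> b $ k \<and> b $ k < ?a $ k + 4 * int n}" by blast
    qed
    from card_mono[OF _ this] have card_n: "card ?q \<le> n" using B le by simp
    have "valid (insert ?q (P - {p, p'}))"
      unfolding valid_def
    proof (intro conjI ballI)
      show "\<Union>(insert ?q (P - {p, p'})) = B" using P p by (auto simp: valid_def)
      show "{} \<notin> insert ?q (P - {p, p'})" using P fin by (auto simp: valid_def)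
      have "r \<inter> ?q = {}" if "r \<in> P - {p, p'}" for r
        using P p that unfolding valid_def disjoint_def by blast
      then show "disjoint (insert ?q (P - {p, p'}))"
        using P unfolding valid_def disjoint_def by (auto simp: Int_commute)
      fix r assume "r \<in> insert ?q (P - {p, p'})"
      then show "card r \<le> n" "\<forall>k. upper r k - lower r k \<le> 2 * int (card r) - 2"
        using P card_n width by (auto simp: valid_def)
    qed
    from minimal[OF this] have "card P \<le> card (insert ?q (P - {p, p'}))" .
    also have "\<dots> \<le> Suc (card (P - {p, p'}))"
      by (rule card_insert_le_m1[THEN order_trans]) (use finP in auto)
    also have "card (P - {p, p'}) = card P - 2"
      using p finP by (subst card_Diff_subset) auto
    finally have "card P \<le> Suc (card P - 2)" .
    moreover have "card {p, p'} \<le> card P"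
      using p finP by (intro card_mono) auto
    ultimately show False using p by simp
  qed
  show ?thesis
  proof (rule that[of P])
    show "upper p k - lower p k \<le> 2 * int n - 2" if "p \<in> P" for p k
      using P that unfolding valid_def by (smt (verit) of_nat_mono)
  qed (use P sep in \<open>auto simp: valid_def\<close>)
qed

section \<open>Renormalization\<close>

definition block_index :: "nat \<Rightarrow> 'd::finite site \<Rightarrow> 'd site" where
  "block_index L x = (\<chi> k. x $ k div int L)"

definition enlarged_block :: "nat \<Rightarrow> 'd::finite site \<Rightarrow> nat \<Rightarrow> 'd site set" where
  "enlarged_block L z m = {x. \<forall>k. int L * (z $ k - int m) \<le> x $ k \<and> x $ k < int L * (z $ k + int m + 1)}"

abbreviation "block L z \<equiv> enlarged_block L z 0"

definition inputs_at :: "nat \<Rightarrow> 'd::finite site set \<Rightarrow> 'd input set" where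
  "inputs_at L\<^sub>0 S = Inl ` block_index L\<^sub>0 ` S \<union> noise_at S"

text \<open>
  On scale \<open>L\<close>, the dynamics started from blocks of side \<open>L\<^sub>0\<close> is controlled at time \<open>t\<close> if a block of
  side \<open>L\<close> is entirely $+1$ during $[t, 2t]$ outside an event of probability \<open>p\<close> that depends only on
  the inputs near the block.
\<close>

definition controlled :: "real \<Rightarrow> real \<Rightarrow> nat \<Rightarrow> 'd::finite itself \<Rightarrow> nat \<Rightarrow> real \<Rightarrow> real \<Rightarrow> bool" where
  "controlled \<epsilon> q L\<^sub>0 _ L t p \<longleftrightarrow> (\<exists>B :: 'd site \<Rightarrow> 'd sample set.
     (\<forall>z. B z \<in> sets (local_algebra (inputs_at L\<^sub>0 (enlarged_block L z 2)))) \<and>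
     (\<forall>z. measure (law \<epsilon> q) (B z) \<le> p) \<and>
     (\<forall>z \<eta> \<omega> V x s. regular \<omega> \<longrightarrow> (\<forall>i. \<eta> i \<in> {1, - 1}) \<longrightarrow> skeleton \<omega> (block_init L\<^sub>0 \<eta>) V \<longrightarrow>
        (\<eta>, \<omega>) \<notin> B z \<longrightarrow> x \<in> block L z \<longrightarrow> t \<le> s \<longrightarrow> s \<le> 2 * t \<longrightarrow> V x (rings_upto \<omega> x s) = 1))"

lemma block_index_bounds:
  assumes "L \<ge> 1"
  shows "int L * block_index L x $ k \<le> x $ k" "x $ k < int L * block_index L x $ k + int L"
proof -
  have "x $ k = int L * (x $ k div int L) + x $ k mod int L" by simp
  moreover have "0 \<le> x $ k mod int L" "x $ k mod int L < int L" using assms by auto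
  ultimately show "int L * block_index L x $ k \<le> x $ k" "x $ k < int L * block_index L x $ k + int L"
    unfolding block_index_def vec_lambda_beta by linarith+
qed

lemma in_block_index: "L \<ge> 1 \<Longrightarrow> x \<in> block L (block_index L x)"
  using block_index_bounds[of L x] by (auto simp: enlarged_block_def algebra_simps)

lemma finite_enlarged_block [simp]: "finite (enlarged_block L z m)"
proof -
  have "enlarged_block L z m \<subseteq> {x. \<forall>k. int L * (z $ k - int m) \<le> x $ k \<and> x $ k \<le> int L * (z $ k + int m + 1)}"
    by (auto simp: enlarged_block_def less_imp_le)
  then show ?thesis by (rule finite_subset) (rule finite_box)
qed

lemma card_box_le:
  assumes "\<And>k. u k - l k \<le> int m"
  shows "card {x :: 'd::finite site. \<forall>k. l k \<le> x $ k \<and> x $ k < u k} \<le> m ^ CARD('d)"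
proof -
  have "{x :: 'd site. \<forall>k. l k \<le> x $ k \<and> x $ k < u k} \<subseteq> vec_lambda ` (\<Pi>\<^sub>E k\<in>UNIV. {l k..<u k})"
  proof
    fix y assume "y \<in> {x :: 'd site. \<forall>k. l k \<le> x $ k \<and> x $ k < u k}"
    then have "vec_nth y \<in> (\<Pi>\<^sub>E k\<in>UNIV. {l k..<u k})" by auto
    then show "y \<in> vec_lambda ` (\<Pi>\<^sub>E k\<in>UNIV. {l k..<u k})"
      using image_eqI[of y vec_lambda "vec_nth y"] by (simp add: vec_nth_inverse)
  qed
  then have "card {x :: 'd site. \<forall>k. l k \<le> x $ k \<and> x $ k < u k} \<le> card (vec_lambda ` (\<Pi>\<^sub>E k\<in>(UNIV::'d set). {l k..<u k}))"
    by (intro card_mono finite_imageI finite_PiE) auto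
  also have "\<dots> \<le> card (\<Pi>\<^sub>E k\<in>(UNIV::'d set). {l k..<u k})"
    by (intro card_image_le finite_PiE) auto
  also have "\<dots> = (\<Prod>k\<in>(UNIV::'d set). nat (u k - l k))"
    by (simp add: card_PiE)
  also have "\<dots> \<le> (\<Prod>k\<in>(UNIV::'d set). m)"
    using assms by (intro prod_mono) (auto simp: nat_le_iff)
  finally show ?thesis by simp
qed

lemma card_enlarged_block_le: "card (enlarged_block L (z :: 'd::finite site) m) \<le> ((2 * m + 1) * L) ^ CARD('d)"
  unfolding enlarged_block_def by (rule card_box_le) (simp add: algebra_simps)

text \<open>
  Among \<open>n\<close> blocks there are at least \<open>n / 6\<^sup>d\<close> whose positions agree modulo 6, and their events are
  independent.
\<close>

lemma prob_bad_blocks_le: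
  fixes B :: "'d::finite site \<Rightarrow> 'd sample set"
  assumes loc: "\<And>z. B z \<in> sets (local_algebra (inputs_at L\<^sub>0 (enlarged_block L z 2)))"
    and p: "\<And>z. measure (law \<epsilon> q) (B z) \<le> p" "0 < p" "p \<le> 1"
    and L: "1 \<le> L\<^sub>0" "L\<^sub>0 \<le> L" and J: "finite J"
  shows "measure (law \<epsilon> q) {z. \<forall>j\<in>J. z \<in> B j} \<le> p powr (real (card J) / 6 ^ CARD('d))"
proof -
  interpret Pr: prob_space "law \<epsilon> q :: 'd sample measure" by (rule prob_space_law)
  define residue :: "'d site \<Rightarrow> 'd site" where "residue z = (\<chi> k. z $ k mod 6)" for z
  have Bs: "B z \<in> sets (law \<epsilon> q)" for z by (rule local_algebra_sets_law[OF loc])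
  let ?R = "{x :: 'd site. \<forall>k. 0 \<le> x $ k \<and> x $ k < 6}"
  have finR: "finite ?R"
    by (rule finite_subset[OF _ finite_box[of "\<lambda>_. 0" "\<lambda>_. 6"]]) (auto simp: less_imp_le)
  have cardR: "card ?R \<le> 6 ^ CARD('d)"
    by (rule card_box_le) simp
  have "\<exists>r. card J \<le> 6 ^ CARD('d) * card {j\<in>J. residue j = r}"
  proof (rule ccontr)
    assume "\<not> ?thesis"
    then have lt: "6 ^ CARD('d) * card {j\<in>J. residue j = r} < card J" for r by (simp add: not_le)
    have J0: "card J > 0" using lt[of 0] by linarith
    have "card J = card (\<Union>r\<in>?R. {j\<in>J. residue j = r})"
      by (rule arg_cong[where f = card]) (auto simp: residue_def)
    also have "\<dots> \<le> (\<Sum>r\<in>?R. card {j\<in>J. residue j = r})"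
      using finR by (rule card_UN_le)
    finally have "6 ^ CARD('d) * card J \<le> (\<Sum>r\<in>?R. 6 ^ CARD('d) * card {j\<in>J. residue j = r})"
      by (simp add: sum_distrib_left[symmetric])
    also have "\<dots> \<le> (\<Sum>r\<in>?R. card J - 1)"
    proof (rule sum_mono)
      fix r show "6 ^ CARD('d) * card {j\<in>J. residue j = r} \<le> card J - 1"
        using lt[of r] by linarith
    qed
    also have "\<dots> \<le> 6 ^ CARD('d) * (card J - 1)"
      using cardR by simp
    finally show False using J0 by simp
  qed
  then obtain r where r: "card J \<le> 6 ^ CARD('d) * card {j\<in>J. residue j = r}" by blast
  let ?J = "{j\<in>J. residue j = r}"
  have disj: "disjoint_family_on (\<lambda>j. inputs_at L\<^sub>0 (enlarged_block L j 2)) ?J"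
    unfolding disjoint_family_on_def
  proof (intro ballI impI)
    fix i j assume ij: "i \<in> ?J" "j \<in> ?J" "i \<noteq> j"
    have far: "\<exists>k. \<bar>x $ k - y $ k\<bar> > int L" if xy: "x \<in> enlarged_block L i 2" "y \<in> enlarged_block L j 2" for x y
    proof -
      obtain k where k: "i $ k \<noteq> j $ k" using ij(3) by (auto simp: vec_eq_iff)
      have "residue i = residue j" using ij by simp
      then have "i $ k mod 6 = j $ k mod 6" by (simp add: residue_def vec_eq_iff)
      then have "6 dvd i $ k - j $ k" by (simp add: mod_eq_dvd_iff)
      then obtain c where c: "i $ k - j $ k = 6 * c" by (rule dvdE)
      then have "c \<ge> 1 \<or> c \<le> - 1" using k by auto
      then have "i $ k + 6 \<le> j $ k \<or> j $ k + 6 \<le> i $ k" using c by linarith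
      then have "int L * (i $ k + 6) \<le> int L * j $ k \<or> int L * (j $ k + 6) \<le> int L * i $ k"
        by (metis mult_left_mono of_nat_0_le_iff)
      moreover have "int L * (i $ k - 2) \<le> x $ k" "x $ k < int L * (i $ k + 3)"
        "int L * (j $ k - 2) \<le> y $ k" "y $ k < int L * (j $ k + 3)"
        using xy by (auto simp: enlarged_block_def add.commute)
      ultimately show ?thesis
        by (intro exI[of _ k]) (auto simp: algebra_simps)
    qed
    have "block_index L\<^sub>0 x \<noteq> block_index L\<^sub>0 y" if xy: "x \<in> enlarged_block L i 2" "y \<in> enlarged_block L j 2" for x y
    proof
      assume "block_index L\<^sub>0 x = block_index L\<^sub>0 y"
      then have near: "\<bar>x $ k - y $ k\<bar> < int L\<^sub>0" for k
        using block_index_bounds[OF L(1), of x k] block_index_bounds[OF L(1), of y k] by auto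
      obtain k where "\<bar>x $ k - y $ k\<bar> > int L" using far[OF xy] by blast
      then show False using near[of k] L(2) by linarith
    qed
    moreover have "enlarged_block L i 2 \<inter> enlarged_block L j 2 = {}"
      using far by fastforce
    ultimately show "inputs_at L\<^sub>0 (enlarged_block L i 2) \<inter> inputs_at L\<^sub>0 (enlarged_block L j 2) = {}"
      unfolding inputs_at_def noise_at_def by blast
  qed
  have "Pr.prob {z. \<forall>j\<in>J. z \<in> B j} \<le> Pr.prob {z. \<forall>j\<in>?J. z \<in> B j}"
  proof (rule Pr.finite_measure_mono)
    have "{z \<in> space (law \<epsilon> q). \<forall>j\<in>?J. z \<in> B j} \<in> sets (law \<epsilon> q)"
      using Bs J by (intro sets.sets_Collect_finite_All) auto
    then show "{z. \<forall>j\<in>?J. z \<in> B j} \<in> sets (law \<epsilon> q)" by simp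
  qed auto
  also have "\<dots> = (\<Prod>j\<in>?J. Pr.prob (B j))"
    using J disj loc by (intro local_events_independent) auto
  also have "\<dots> \<le> (\<Prod>j\<in>?J. p)"
    using p by (intro prod_mono) auto
  also have "\<dots> = p powr real (card ?J)"
    using p by (simp add: powr_realpow)
  also have "\<dots> \<le> p powr (real (card J) / 6 ^ CARD('d))"
  proof (rule powr_mono')
    have "real (card J) \<le> real (6 ^ CARD('d) * card ?J)" using r by (rule of_nat_mono)
    then show "real (card J) / 6 ^ CARD('d) \<le> real (card ?J)" by (simp add: divide_le_eq mult.commute)
  qed (use p in auto)
  finally show ?thesis .
qed

lemma controlled_initially:
  fixes \<epsilon> q :: real
  assumes \<epsilon>: "0 \<le> \<epsilon>" "\<epsilon> \<le> 1" and L\<^sub>0: "L\<^sub>0 \<ge> 1"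
  shows "controlled \<epsilon> q L\<^sub>0 TYPE('d::finite) L\<^sub>0 0 \<epsilon>"
proof -
  define B where "B z = {s :: 'd sample. fst s z \<noteq> 1}" for z
  have idx: "block_index L\<^sub>0 x = z" if "x \<in> block L\<^sub>0 z" for x z :: "'d site"
  proof -
    have "x $ k div int L\<^sub>0 = z $ k" for k
    proof -
      have "int L\<^sub>0 * z $ k \<le> x $ k" "x $ k < int L\<^sub>0 * z $ k + int L\<^sub>0"
        using that by (auto simp: enlarged_block_def algebra_simps)
      then have "(int L\<^sub>0 * z $ k + (x $ k - int L\<^sub>0 * z $ k)) div int L\<^sub>0 = z $ k"
        using L\<^sub>0 by (subst div_mult_self4) (auto simp: div_pos_pos_trivial)
      then show ?thesis by simp
    qed
    then show ?thesis by (simp add: block_index_def vec_eq_iff)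
  qed
  have self: "Inl z \<in> inputs_at L\<^sub>0 (enlarged_block L\<^sub>0 z 2)" for z :: "'d site"
  proof -
    let ?x = "\<chi> k. int L\<^sub>0 * z $ k"
    have "?x \<in> block L\<^sub>0 z" using L\<^sub>0 by (auto simp: enlarged_block_def algebra_simps)
    moreover have "?x \<in> enlarged_block L\<^sub>0 z 2" using L\<^sub>0 by (auto simp: enlarged_block_def algebra_simps)
    ultimately have "z = block_index L\<^sub>0 ?x" "?x \<in> enlarged_block L\<^sub>0 z 2" using idx by auto
    then show ?thesis unfolding inputs_at_def by blast
  qed
  have loc: "B z \<in> sets (local_algebra (inputs_at L\<^sub>0 (enlarged_block L\<^sub>0 z 2)))" for z
    unfolding B_def by (rule initial_spin_local[OF self])
  have prob: "measure (law \<epsilon> q) (B z) \<le> \<epsilon>" for z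
  proof -
    interpret N: prob_space "noise_law q :: 'd noise measure" by (rule prob_space_noise_law)
    interpret P: product_prob_space "\<lambda>_. measure_pmf (spin_pmf (1 - \<epsilon>))" "UNIV :: 'd site set"
      by unfold_locales
    let ?A = "{\<eta> :: 'd config. \<eta> z \<noteq> 1}"
    have A: "?A \<in> sets (block_law \<epsilon>)"
    proof -
      have "{\<eta> \<in> space (block_law \<epsilon>). \<eta> z \<noteq> (1 :: int)} \<in> sets (block_law \<epsilon> :: 'd config measure)"
        unfolding block_law_def by measurable
      then show ?thesis by (simp add: block_law_def space_PiM PiE_UNIV_domain)
    qed
    have BA: "B z = ?A \<times> space (noise_law q)" by (auto simp: B_def)
    have "emeasure (law \<epsilon> q) (B z) = emeasure (block_law \<epsilon>) ?A"
      unfolding BA random_init_law_def using A by (simp add: N.emeasure_pair_measure_Times N.emeasure_space_1 del: space_noise_law)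
    also have "\<dots> = emeasure (distr (block_law \<epsilon>) (measure_pmf (spin_pmf (1 - \<epsilon>))) (\<lambda>\<eta>. \<eta> z)) {s. s \<noteq> 1}"
      by (subst emeasure_distr) (auto simp: block_law_def space_PiM PiE_UNIV_domain intro!: arg_cong[where f = "emeasure _"])
    also have "\<dots> = emeasure (measure_pmf (spin_pmf (1 - \<epsilon>))) {s. s \<noteq> 1}"
      unfolding block_law_def by (simp add: P.PiM_component)
    also have "\<dots> = emeasure (measure_pmf (bernoulli_pmf (1 - \<epsilon>))) {False}"
      unfolding spin_pmf_def by (subst emeasure_map_pmf) (auto intro!: arg_cong[where f = "emeasure _"] split: if_splits)
    also have "\<dots> = ennreal \<epsilon>"
      using \<epsilon> by (simp add: emeasure_pmf_single)
    finally show ?thesis using \<epsilon> by (simp add: measure_def)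
  qed
  have "V x (rings_upto \<omega> x s) = 1"
    if "regular \<omega>" "\<forall>i. \<eta> i \<in> {1, - 1}" "skeleton \<omega> (block_init L\<^sub>0 \<eta>) V" "(\<eta>, \<omega>) \<notin> B z" "x \<in> block L\<^sub>0 z"
      "0 \<le> s" "s \<le> 2 * 0" for z \<eta> \<omega> V s and x :: "'d site"
  proof -
    have "s = 0" using that by simp
    then have "V x (rings_upto \<omega> x s) = block_init L\<^sub>0 \<eta> x"
      using that by (simp add: rings_upto_0 skeleton_def)
    also have "\<dots> = \<eta> (block_index L\<^sub>0 x)" by (simp add: block_init_def block_index_def)
    also have "\<dots> = 1" using that idx by (simp add: B_def)
    finally show ?thesis .
  qed
  then show ?thesis
    unfolding controlled_def using loc prob by (intro exI[of _ B]) blast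
qed

text \<open>
  The induction step. Around a block of the larger scale, the bad blocks of the smaller scale are
  covered by separated boxes unless some window contains many of them; the boxes erode in time \<open>T\<close>
  unless some cube survives for an exceptional time; and the outside has no influence on the block
  until $2 (t' + T)$ unless there is a fast path.
\<close>

lemma controlled_step:
  fixes \<epsilon> q :: real and L\<^sub>0 L L' n :: nat
  defines "\<Delta> \<equiv> 3 ^ CARD('d::finite)" and "R \<equiv> 2 * n * L'"
  assumes d: "CARD('d) \<ge> 2"
    and ctrl: "controlled \<epsilon> q L\<^sub>0 TYPE('d) L' t' p'" and p': "0 < p'" "p' \<le> 1" and t': "0 \<le> t'"
    and L\<^sub>0: "1 \<le> L\<^sub>0" "L\<^sub>0 \<le> L'" and n: "n \<ge> 1" and L: "3 * L' \<le> L" "R \<le> L"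
    and T: "0 \<le> T" and speed: "8 * \<Delta> * (t' + 2 * T + 1) \<le> real L"
    and survive: "measure (noise_law q :: 'd noise measure) {\<omega>. \<not> erodes R T \<omega>} \<le> p\<^sub>e"
  shows "controlled \<epsilon> q L\<^sub>0 TYPE('d) L (t' + T)
    ((3 * real L) ^ CARD('d) * ((4 * real n) ^ (CARD('d) * n) * p' powr (real n / 6 ^ CARD('d)))
     + (3 * real L) ^ CARD('d) * p\<^sub>e + real L ^ CARD('d) * (1 / 2) ^ L)"
proof -
  interpret Pr: prob_space "law \<epsilon> q :: 'd sample measure" by (rule prob_space_law)
  have L1: "1 \<le> L'" "1 \<le> L" using L\<^sub>0 L by auto
  obtain B :: "'d site \<Rightarrow> 'd sample set" where
    B_loc: "\<And>z. B z \<in> sets (local_algebra (inputs_at L\<^sub>0 (enlarged_block L' z 2)))"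
    and B_prob: "\<And>z. measure (law \<epsilon> q) (B z) \<le> p'"
    and B_good: "\<And>z \<eta> \<omega> V x s. regular \<omega> \<Longrightarrow> (\<forall>i. \<eta> i \<in> {1, - 1}) \<Longrightarrow> skeleton \<omega> (block_init L\<^sub>0 \<eta>) V \<Longrightarrow>
        (\<eta>, \<omega>) \<notin> B z \<Longrightarrow> x \<in> block L' z \<Longrightarrow> t' \<le> s \<Longrightarrow> s \<le> 2 * t' \<Longrightarrow> V x (rings_upto \<omega> x s) = 1"
    using ctrl unfolding controlled_def by blast
  let ?D = "\<lambda>z :: 'd site. enlarged_block L z 1" and ?N = "\<lambda>z :: 'd site. enlarged_block L z 2"
  define I where "I z = block_index L' ` ?D z" for z
  \<comment> \<open>The summand 1 lets the closed window $[t' + T, 2 (t' + T)]$ end before \<open>s'\<close>.\<close>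
  define s' where "s' = 2 * t' + 2 * T + 1"
  define corner where "corner a = (\<chi> k. int L' * a $ k)" for a :: "'d site"
  define window where "window a = {b :: 'd site. \<forall>k. a $ k \<le> b $ k \<and> b $ k < a $ k + 4 * int n}" for a
  \<comment> \<open>the three exceptional events: too many bad blocks, slow erosion, fast influence\<close>
  define crowded where "crowded z = (\<Union>a\<in>I z. \<Union>J\<in>{J. J \<subseteq> window a \<inter> I z \<and> card J = n}. {s. \<forall>j\<in>J. s \<in> B j})" for z
  define surviving where "surviving z = (\<Union>a\<in>I z. {s :: 'd sample. \<not> erodes R T (restart (corner a) t' (snd s))})" for z
  define fast where "fast z = (\<Union>x\<in>block L z. {s :: 'd sample. fast_path (snd s) (?D z) t' s' L x})" for z
  have finI: "finite (I z)" for z by (simp add: I_def)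
  have cardI: "card (I z) \<le> (3 * L) ^ CARD('d)" for z
    unfolding I_def using card_image_le[of "?D z" "block_index L'"] card_enlarged_block_le[of L z 1]
    by (simp add: numeral_3_eq_3)
  have fin_window: "finite (window a)" for a
    unfolding window_def
    by (rule finite_subset[OF _ finite_box[of "\<lambda>k. a $ k" "\<lambda>k. a $ k + 4 * int n"]]) (auto simp: less_imp_le)
  have card_window: "card (window a) \<le> (4 * n) ^ CARD('d)" for a
    unfolding window_def by (rule card_box_le) simp
  have I_bounds: "int L * (z $ k - 1) - int L' < int L' * a $ k" "int L' * a $ k < int L * (z $ k + 2)"
    if a: "a \<in> I z" for a z k
  proof -
    obtain x where x: "x \<in> ?D z" "a = block_index L' x" using a by (auto simp: I_def)
    then have "int L * (z $ k - 1) \<le> x $ k" "x $ k < int L * (z $ k + 2)"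
      by (auto simp: enlarged_block_def add.commute)
    then show "int L * (z $ k - 1) - int L' < int L' * a $ k" "int L' * a $ k < int L * (z $ k + 2)"
      using block_index_bounds[OF L1(1), of x k] x(2) by auto
  qed
  have I_coordinates: "a \<in> I z" if coord: "\<And>k. \<exists>b\<in>I z. a $ k = b $ k" for a z
  proof -
    have "\<exists>y. int L * (z $ k - 1) \<le> y \<and> y < int L * (z $ k + 2) \<and> a $ k = y div int L'" for k
    proof -
      obtain b where "b \<in> I z" "a $ k = b $ k" using coord[of k] by blast
      then obtain y where "y \<in> ?D z" "a $ k = block_index L' y $ k" by (auto simp: I_def)
      then show ?thesis by (intro exI[of _ "y $ k"]) (auto simp: enlarged_block_def block_index_def add.commute)
    qed
    then obtain y where "\<And>k. int L * (z $ k - 1) \<le> y k \<and> y k < int L * (z $ k + 2) \<and> a $ k = y k div int L'"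
      by metis
    then have "(\<chi> k. y k) \<in> ?D z" "a = block_index L' (\<chi> k. y k)"
      by (auto simp: enlarged_block_def block_index_def vec_eq_iff add.commute)
    then show ?thesis unfolding I_def by blast
  qed
  have sub_N: "x \<in> ?N z"
    if "\<And>k. int L * (z $ k - 1) - 3 * int L' \<le> x $ k"
      "\<And>k. x $ k < int L * (z $ k + 2) + int L" for x z
  proof -
    have "int L * (z $ k - 2) \<le> x $ k \<and> x $ k < int L * (z $ k + 3)" for k
      using that[of k] L by (simp add: algebra_simps)
    then show ?thesis by (simp add: enlarged_block_def add.commute)
  qed
  have sub_block: "enlarged_block L' a 2 \<subseteq> ?N z" if a: "a \<in> I z" for a z
  proof
    fix x assume x: "x \<in> enlarged_block L' a 2"
    obtain y where y: "y \<in> ?D z" "a = block_index L' y" using a by (auto simp: I_def)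
    have b: "int L * (z $ k - 1) \<le> y $ k" "y $ k < int L * (z $ k + 2)" for k
      using y by (auto simp: enlarged_block_def add.commute)
    show "x \<in> ?N z"
    proof (rule sub_N)
      fix k
      have "int L' * a $ k - 2 * int L' \<le> x $ k" "x $ k < int L' * a $ k + 3 * int L'"
        using x by (auto simp: enlarged_block_def algebra_simps)
      moreover have "int L' * a $ k \<le> y $ k" "y $ k < int L' * a $ k + int L'"
        using block_index_bounds[OF L1(1), of y k] y(2) by auto
      moreover have "3 * int L' \<le> int L" using L by simp
      ultimately show "int L * (z $ k - 1) - 3 * int L' \<le> x $ k" "x $ k < int L * (z $ k + 2) + int L"
        using b[of k] by linarith+
    qed
  qed
  have inputs_mono: "S \<subseteq> S' \<Longrightarrow> inputs_at L\<^sub>0 S \<subseteq> inputs_at L\<^sub>0 S'" for S S' :: "'d site set"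
    using noise_at_mono[of S S'] unfolding inputs_at_def by blast
  let ?A = "\<lambda>z. local_algebra (inputs_at L\<^sub>0 (?N z))"
  have B_loc': "B a \<in> sets (?A z)" if "a \<in> I z" for a z
    using local_algebra_mono[OF inputs_mono[OF sub_block[OF that]]] B_loc by blast
  have E_loc: "{s. \<forall>j\<in>J. s \<in> B j} \<in> sets (?A z)" if J: "J \<subseteq> I z" for J z
  proof -
    have "{s \<in> space (?A z). \<forall>j\<in>J. s \<in> B j} \<in> sets (?A z)"
      using J B_loc' finite_subset[OF J finI] by (intro sets.sets_Collect_finite_All) auto
    then show ?thesis by simp
  qed
  have fin_subsets: "finite {J. J \<subseteq> window a \<inter> I z \<and> card J = n}" for a z
    by (rule finite_subset[of _ "Pow (window a)"]) (auto simp: fin_window)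
  have crowded_loc: "crowded z \<in> sets (?A z)" for z
    unfolding crowded_def using finI fin_subsets E_loc by (intro sets.finite_UN) auto
  have surviving_loc: "{s :: 'd sample. \<not> erodes R T (restart (corner a) t' (snd s))} \<in> sets (?A z)"
    if a: "a \<in> I z" for a z
  proof (rule local_erodes_restart[where S = "?N z"])
    fix x :: "'d site" assume x: "x \<in> cube R"
    show "x + corner a \<in> ?N z"
    proof (rule sub_N)
      fix k
      have xk: "0 \<le> x $ k" "x $ k < int R" using x by (auto simp: cube_def)
      show "int L * (z $ k - 1) - 3 * int L' \<le> (x + corner a) $ k"
        using I_bounds[OF a, of k] xk by (simp add: corner_def)
      have "int R \<le> int L" using L by simp
      then show "(x + corner a) $ k < int L * (z $ k + 2) + int L"
        using I_bounds[OF a, of k] xk by (simp add: corner_def)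
    qed
  qed (simp add: inputs_at_def)
  have D_sub_N: "?D z \<subseteq> ?N z" for z
  proof
    fix x assume "x \<in> ?D z"
    then have "int L * (z $ k - 1) \<le> x $ k" "x $ k < int L * (z $ k + 2)" for k
      by (auto simp: enlarged_block_def add.commute)
    moreover have "0 \<le> int L" "0 \<le> int L'" by simp_all
    ultimately have "int L * (z $ k - 1) - 3 * int L' \<le> x $ k" "x $ k < int L * (z $ k + 2) + int L" for k
      using L1 by (smt (verit))+
    then show "x \<in> ?N z" by (rule sub_N)
  qed
  have fast_loc: "{s :: 'd sample. fast_path (snd s) (?D z) t' s' L x} \<in> sets (?A z)" for z x
    using D_sub_N by (rule local_fast_path) (simp add: inputs_at_def)
  have event_loc: "crowded z \<union> surviving z \<union> fast z \<in> sets (?A z)" for z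
    using crowded_loc surviving_loc fast_loc finI
    by (intro sets.Un) (auto simp: surviving_def fast_def)
  have crowded_prob: "Pr.prob (crowded z) \<le> (3 * real L) ^ CARD('d) * ((4 * real n) ^ (CARD('d) * n) * p' powr (real n / 6 ^ CARD('d)))" for z
  proof -
    let ?J = "\<lambda>a. {J. J \<subseteq> window a \<inter> I z \<and> card J = n}"
    let ?b = "p' powr (real n / 6 ^ CARD('d))"
    have inner: "Pr.prob (\<Union>J\<in>?J a. {s. \<forall>j\<in>J. s \<in> B j}) \<le> (4 * real n) ^ (CARD('d) * n) * ?b" for a
    proof -
      have "Pr.prob (\<Union>J\<in>?J a. {s. \<forall>j\<in>J. s \<in> B j}) \<le> (\<Sum>J\<in>?J a. Pr.prob {s. \<forall>j\<in>J. s \<in> B j})"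
        using fin_subsets by (intro Pr.finite_measure_subadditive_finite) (auto intro!: local_algebra_sets_law E_loc)
      also have "\<dots> \<le> (\<Sum>J\<in>?J a. ?b)"
      proof (rule sum_mono)
        fix J assume J: "J \<in> ?J a"
        then have fJ: "finite J" using finite_subset[OF _ fin_window] by blast
        show "Pr.prob {s. \<forall>j\<in>J. s \<in> B j} \<le> ?b"
          using prob_bad_blocks_le[OF B_loc B_prob p' L\<^sub>0 fJ] J by auto
      qed
      also have "\<dots> = real (card (?J a)) * ?b" by simp
      also have "\<dots> \<le> (4 * real n) ^ (CARD('d) * n) * ?b"
      proof (rule mult_right_mono)
        have "card (?J a) \<le> card {J. J \<subseteq> window a \<and> card J = n}"
        proof (rule card_mono)
          show "finite {J. J \<subseteq> window a \<and> card J = n}"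
            by (rule finite_subset[of _ "Pow (window a)"]) (auto simp: fin_window)
        qed blast
        also have "\<dots> = card (window a) choose n"
          by (rule n_subsets[OF fin_window])
        also have "\<dots> \<le> card (window a) ^ n"
          by (cases "n \<le> card (window a)") (auto intro: binomial_le_pow simp: binomial_eq_0)
        also have "\<dots> \<le> ((4 * n) ^ CARD('d)) ^ n"
          using card_window by (rule power_mono) simp
        finally have "real (card (?J a)) \<le> real (((4 * n) ^ CARD('d)) ^ n)" by (rule of_nat_mono)
        then show "real (card (?J a)) \<le> (4 * real n) ^ (CARD('d) * n)" by (simp add: power_mult)
      qed simp
      finally show ?thesis .
    qed
    have "Pr.prob (crowded z) \<le> (\<Sum>a\<in>I z. Pr.prob (\<Union>J\<in>?J a. {s. \<forall>j\<in>J. s \<in> B j}))"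
      unfolding crowded_def using finI fin_subsets
      by (intro Pr.finite_measure_subadditive_finite) (auto intro!: sets.finite_UN local_algebra_sets_law E_loc)
    also have "\<dots> \<le> real (card (I z)) * ((4 * real n) ^ (CARD('d) * n) * ?b)"
      using sum_bounded_above[of "I z", OF inner] by simp
    also have "\<dots> \<le> (3 * real L) ^ CARD('d) * ((4 * real n) ^ (CARD('d) * n) * ?b)"
    proof (rule mult_right_mono)
      have "real (card (I z)) \<le> real ((3 * L) ^ CARD('d))" by (rule of_nat_mono[OF cardI])
      then show "real (card (I z)) \<le> (3 * real L) ^ CARD('d)" by simp
    qed simp
    finally show ?thesis .
  qed
  have pe: "0 \<le> p\<^sub>e" using survive measure_nonneg order_trans by blast
  have surviving_prob: "Pr.prob (surviving z) \<le> (3 * real L) ^ CARD('d) * p\<^sub>e" for z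
  proof -
    have "Pr.prob (surviving z) \<le> (\<Sum>a\<in>I z. Pr.prob {s :: 'd sample. \<not> erodes R T (restart (corner a) t' (snd s))})"
      unfolding surviving_def using finI
      by (intro Pr.finite_measure_subadditive_finite) (auto intro!: local_algebra_sets_law surviving_loc)
    also have "\<dots> \<le> (\<Sum>a\<in>I z. p\<^sub>e)"
    proof (rule sum_mono)
      fix a assume "a \<in> I z"
      show "Pr.prob {s :: 'd sample. \<not> erodes R T (restart (corner a) t' (snd s))} \<le> p\<^sub>e"
        unfolding prob_not_erodes_restart[OF t'] by (rule survive)
    qed
    also have "\<dots> = real (card (I z)) * p\<^sub>e" by simp
    also have "\<dots> \<le> (3 * real L) ^ CARD('d) * p\<^sub>e"
    proof (rule mult_right_mono)
      have "real (card (I z)) \<le> real ((3 * L) ^ CARD('d))" by (rule of_nat_mono[OF cardI])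
      then show "real (card (I z)) \<le> (3 * real L) ^ CARD('d)" by simp
    qed (rule pe)
    finally show ?thesis .
  qed
  have fast_prob: "Pr.prob (fast z) \<le> real L ^ CARD('d) * (1 / 2) ^ L" for z
  proof -
    have "Pr.prob (fast z) \<le> (\<Sum>x\<in>block L z. Pr.prob {s :: 'd sample. fast_path (snd s) (?D z) t' s' L x})"
      unfolding fast_def
      by (intro Pr.finite_measure_subadditive_finite image_subsetI finite_enlarged_block local_algebra_sets_law[OF fast_loc])
    also have "\<dots> \<le> (\<Sum>x\<in>block L z. (1 / 2) ^ L)"
      by (intro sum_mono prob_fast_path_le) (use t' T L1 speed in \<open>auto simp: s'_def \<Delta>_def add.assoc\<close>)
    also have "\<dots> = real (card (block L z)) * (1 / 2) ^ L" by simp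
    also have "\<dots> \<le> real L ^ CARD('d) * (1 / 2) ^ L"
    proof (rule mult_right_mono)
      have "real (card (block L z)) \<le> real (((2 * 0 + 1) * L) ^ CARD('d))"
        by (rule of_nat_mono[OF card_enlarged_block_le])
      then show "real (card (block L z)) \<le> real L ^ CARD('d)" by simp
    qed simp
    finally show ?thesis .
  qed
  have prob: "Pr.prob (crowded z \<union> surviving z \<union> fast z) \<le>
    (3 * real L) ^ CARD('d) * ((4 * real n) ^ (CARD('d) * n) * p' powr (real n / 6 ^ CARD('d)))
     + (3 * real L) ^ CARD('d) * p\<^sub>e + real L ^ CARD('d) * (1 / 2) ^ L" for z
  proof -
    have s: "crowded z \<in> Pr.events" "surviving z \<in> Pr.events" "fast z \<in> Pr.events"
      unfolding surviving_def fast_def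
      by (rule local_algebra_sets_law[OF crowded_loc],
          rule sets.finite_UN[OF finI local_algebra_sets_law[OF surviving_loc]], assumption,
          rule sets.finite_UN[OF finite_enlarged_block local_algebra_sets_law[OF fast_loc]])
    then have "Pr.prob (crowded z \<union> surviving z \<union> fast z) \<le> Pr.prob (crowded z \<union> surviving z) + Pr.prob (fast z)"
      by (intro measure_Un_le sets.Un)
    also have "\<dots> \<le> Pr.prob (crowded z) + Pr.prob (surviving z) + Pr.prob (fast z)"
      using measure_Un_le[OF s(1,2)] by simp
    finally show ?thesis
      using crowded_prob[of z] surviving_prob[of z] fast_prob[of z] by linarith
  qed
  have good: "V x (rings_upto \<omega> x s) = 1"
    if reg: "regular \<omega>" and \<eta>: "\<forall>i. \<eta> i \<in> {1, - 1}" and V: "skeleton \<omega> (block_init L\<^sub>0 \<eta>) V"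
      and notin: "(\<eta>, \<omega>) \<notin> crowded z \<union> surviving z \<union> fast z" and x: "x \<in> block L z"
      and s: "t' + T \<le> s" "s \<le> 2 * (t' + T)" for z \<eta> \<omega> V s and x :: "'d site"
  proof -
    define Bad where "Bad = {a \<in> I z. (\<eta>, \<omega>) \<in> B a}"
    have finBad: "finite Bad" using finI by (simp add: Bad_def)
    have win: "card {b\<in>Bad. \<forall>k. a $ k \<le> b $ k \<and> b $ k < a $ k + 4 * int n} \<le> n"
      if a: "\<And>k. \<exists>b\<in>Bad. a $ k = b $ k" for a
    proof (rule ccontr)
      let ?S = "{b\<in>Bad. \<forall>k. a $ k \<le> b $ k \<and> b $ k < a $ k + 4 * int n}"
      assume "\<not> card ?S \<le> n"
      then have "n \<le> card ?S" by linarith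
      then obtain J where J: "J \<subseteq> ?S" "card J = n"
        by (rule obtain_subset_with_card_n)
      have "a \<in> I z"
        by (rule I_coordinates) (use a in \<open>auto simp: Bad_def\<close>)
      moreover have "J \<subseteq> window a \<inter> I z" "\<forall>j\<in>J. (\<eta>, \<omega>) \<in> B j"
        using J by (auto simp: window_def Bad_def)
      ultimately have "(\<eta>, \<omega>) \<in> crowded z" using J(2) unfolding crowded_def by blast
      then show False using notin by simp
    qed
    obtain P where P: "\<Union>P = Bad" "{} \<notin> P"
      and width: "\<And>p k. p \<in> P \<Longrightarrow> upper p k - lower p k \<le> 2 * int n - 2"
      and sep: "\<And>p p'. p \<in> P \<Longrightarrow> p' \<in> P \<Longrightarrow> p \<noteq> p' \<Longrightarrow>
        \<exists>k. upper p k + 3 \<le> lower p' k \<or> upper p' k + 3 \<le> lower p k"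
      using separated_hulls[OF finBad n win] by blast
    have finp: "finite p" "p \<noteq> {}" if "p \<in> P" for p
      using P that finBad finite_subset[of p Bad] by auto
    have hull: "lower p k \<le> b $ k" "b $ k \<le> upper p k" if "p \<in> P" "b \<in> p" for p b k
      using finp[OF that(1)] that(2) unfolding lower_def upper_def by (auto intro: Min_le Max_ge)
    define lo where "lo p k = int L' * lower p k" for p :: "'d site set" and k
    define hi where "hi p k = int L' * upper p k + int L' - 1" for p :: "'d site set" and k
    let ?Q = "\<lambda>p. {y :: 'd site. \<forall>k. lo p k \<le> y $ k \<and> y $ k \<le> hi p k}"
    have L'pos: "int L' \<ge> 1" using L1 by simp
    show ?thesis
    proof (rule separated_boxes_erode[where I = P and l = lo and u = hi and D = "?D z" and L = R and t = t' and T = T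
          and n = L and s = s' and v = "\<lambda>p. corner (\<chi> k. lower p k)"])
      show "CARD('d) \<ge> 2" "regular \<omega>" "finite (?D z)" "0 < L" "0 \<le> T" "t' + T \<le> s" "s < s'"
        using d reg L1 T s by (simp_all add: s'_def)
    next
      fix p p' y y' assume p: "p \<in> P" "p' \<in> P" and y: "y \<in> ?Q p" "y' \<in> ?Q p'"
        and near: "\<And>k. \<bar>y $ k - y' $ k\<bar> \<le> 2"
      show "p = p'"
      proof (rule ccontr)
        assume "p \<noteq> p'"
        then obtain k where k: "upper p k + 3 \<le> lower p' k \<or> upper p' k + 3 \<le> lower p k"
          using sep[OF p] by blast
        then have "int L' * (upper p k + 3) \<le> int L' * lower p' k \<or> int L' * (upper p' k + 3) \<le> int L' * lower p k"
          by (metis mult_left_mono of_nat_0_le_iff)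
        then have "lo p' k \<ge> hi p k + 2 * int L' + 1 \<or> lo p k \<ge> hi p' k + 2 * int L' + 1"
          by (auto simp: lo_def hi_def algebra_simps)
        moreover have "lo p k \<le> y $ k" "y $ k \<le> hi p k" "lo p' k \<le> y' $ k" "y' $ k \<le> hi p' k"
          using y by auto
        ultimately show False using near[of k] L'pos by linarith
      qed
    next
      fix p y assume p: "p \<in> P" and y: "y \<in> ?Q p"
      have "0 \<le> y $ k - int L' * lower p k \<and> y $ k - int L' * lower p k < int R" for k
      proof -
        have "int L' * (upper p k - lower p k) \<le> int L' * (2 * int n - 2)"
          by (rule mult_left_mono[OF width[OF p]]) simp
        moreover have "lo p k \<le> y $ k" "y $ k \<le> hi p k" using y by auto
        ultimately show ?thesis
          using L'pos by (simp add: lo_def hi_def R_def algebra_simps)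
      qed
      then show "y - corner (\<chi> k. lower p k) \<in> cube R"
        by (simp add: cube_def corner_def)
    next
      fix p assume p: "p \<in> P"
      have "(\<chi> k. lower p k) \<in> I z"
      proof (rule I_coordinates)
        fix k
        have "lower p k \<in> (\<lambda>b. b $ k) ` p"
          unfolding lower_def using finp[OF p] by (intro Min_in) auto
        then show "\<exists>b\<in>I z. (\<chi> k. lower p k) $ k = b $ k" using P p by (auto simp: Bad_def)
      qed
      then show "erodes R T (restart (corner (\<chi> k. lower p k)) t' \<omega>)"
        using notin by (auto simp: surviving_def)
    next
      show "V y m \<in> {1, - 1}" for y m
        by (rule skeleton_in_spins[OF reg V]) (use \<eta> in \<open>simp add: block_init_def\<close>)
      show "skeleton_at \<omega> V y i \<le> V y (Suc i)" for y i
        using V by (simp add: skeleton_def)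
    next
      fix y assume y: "y \<in> ?D z" and out: "\<And>p. p \<in> P \<Longrightarrow> y \<notin> ?Q p"
      have "(\<eta>, \<omega>) \<notin> B (block_index L' y)"
      proof
        assume "(\<eta>, \<omega>) \<in> B (block_index L' y)"
        then have "block_index L' y \<in> Bad" using y by (auto simp: Bad_def I_def)
        then obtain p where p: "p \<in> P" "block_index L' y \<in> p" using P by blast
        have "lo p k \<le> y $ k \<and> y $ k \<le> hi p k" for k
        proof -
          have "int L' * lower p k \<le> int L' * block_index L' y $ k" "int L' * block_index L' y $ k \<le> int L' * upper p k"
            using hull[OF p] by (auto intro: mult_left_mono)
          moreover have "int L' * block_index L' y $ k \<le> y $ k" "y $ k < int L' * block_index L' y $ k + int L'"
            using block_index_bounds[OF L1(1), of y k] by auto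
          ultimately show ?thesis
            unfolding lo_def hi_def by (intro conjI) linarith+
        qed
        then show False using out[OF p(1)] by simp
      qed
      then show "V y (rings_upto \<omega> y t') = 1"
        using B_good[OF reg \<eta> V _ in_block_index[OF L1(1)]] t' by simp
    next
      fix y assume near: "\<forall>k. \<bar>y $ k - x $ k\<bar> \<le> int L"
      have "int L * (z $ k - 1) \<le> y $ k \<and> y $ k < int L * (z $ k + 2)" for k
      proof -
        have "int L * z $ k \<le> x $ k" "x $ k < int L * z $ k + int L"
          using x by (auto simp: enlarged_block_def algebra_simps)
        then show ?thesis using near[rule_format, of k] by (simp add: algebra_simps abs_le_iff)
      qed
      then show "y \<in> ?D z" by (simp add: enlarged_block_def add.commute)
    next
      show "\<not> fast_path \<omega> (?D z) t' s' L x"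
        using notin x by (auto simp: fast_def)
    qed
  qed
  show ?thesis
    unfolding controlled_def
    using event_loc prob good by (intro exI[of _ "\<lambda>z. crowded z \<union> surviving z \<union> fast z"]) blast
qed

section \<open>Growth of the scales\<close>

lemma controlled_mono: "controlled \<epsilon> q L\<^sub>0 D L t p \<Longrightarrow> p \<le> p' \<Longrightarrow> controlled \<epsilon> q L\<^sub>0 D L t p'"
  unfolding controlled_def by (meson order_trans)

lemma half_le_floor:
  assumes "1 \<le> (y :: real)"
  shows "y / 2 \<le> real (nat \<lfloor>y\<rfloor>)"
proof -
  have "1 \<le> \<lfloor>y\<rfloor>" using assms by simp
  then have "1 \<le> real_of_int \<lfloor>y\<rfloor>" "real (nat \<lfloor>y\<rfloor>) = real_of_int \<lfloor>y\<rfloor>" by simp_all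
  then show ?thesis using real_of_int_floor_add_one_gt[of y] by linarith
qed

text \<open>
  Every large scale is reached by the growth step from a scale that is roughly its \<open>M\<close>-th root, so
  that the bound with the exponent \<open>\<beta>\<close> reproduces itself.
\<close>

lemma controlled_all_scales:
  fixes M :: nat and \<epsilon> q \<beta> P \<nu> t :: real and \<Lambda> L\<^sub>0 L\<^sub>1 :: nat
  assumes M: "M \<ge> 2" and P: "\<And>x. real \<Lambda> \<le> x \<Longrightarrow> P * ln x \<le> x powr \<beta>"
    and grow: "\<And>L' t' \<nu> L. controlled \<epsilon> q L\<^sub>0 TYPE('d::finite) L' t' (exp (- \<nu>)) \<Longrightarrow> L\<^sub>0 \<le> L' \<Longrightarrow>
      0 \<le> t' \<Longrightarrow> t' \<le> real L' \<Longrightarrow> \<Lambda> \<le> L' \<Longrightarrow> P * ln (real L') \<le> \<nu> \<Longrightarrow> L' ^ M \<le> L \<Longrightarrow> L \<le> L' ^ (M ^ 2) \<Longrightarrow>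
      \<exists>t\<ge>0. t \<le> real L \<and> controlled \<epsilon> q L\<^sub>0 TYPE('d) L t (exp (- (real L powr \<beta>)))"
    and start: "controlled \<epsilon> q L\<^sub>0 TYPE('d) L\<^sub>1 t (exp (- \<nu>))" "L\<^sub>0 \<le> L\<^sub>1" "0 \<le> t" "t \<le> real L\<^sub>1" "\<Lambda> \<le> L\<^sub>1"
      "P * ln (real L\<^sub>1) \<le> \<nu>" and two: "2 \<le> L\<^sub>1"
  shows "L\<^sub>1 ^ M \<le> L \<Longrightarrow> \<exists>t\<ge>0. t \<le> real L \<and> controlled \<epsilon> q L\<^sub>0 TYPE('d) L t (exp (- (real L powr \<beta>)))"
proof (induction L rule: less_induct)
  case (less L)
  show ?case
  proof (cases "L \<le> L\<^sub>1 ^ (M ^ 2)")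
    case True
    then show ?thesis using grow[OF start] less.prems by blast
  next
    case False
    have LM: "L\<^sub>1 \<le> L\<^sub>1 ^ M" using two M power_increasing[of 1 M L\<^sub>1] by simp
    have "\<exists>L'. L' ^ M \<le> L \<and> (\<forall>k. k ^ M \<le> L \<longrightarrow> k \<le> L')"
    proof -
      have b: "k \<le> L" if "k ^ M \<le> L" for k
        using that M by (cases "k = 0") (auto intro: order_trans[OF self_le_power[of k M]])
      let ?S = "{k. k ^ M \<le> L}"
      have fS: "finite ?S" by (rule finite_subset[of _ "{..L}"]) (use b in auto)
      have "0 \<in> ?S" using M by (cases M) auto
      then have "Max ?S \<in> ?S" using fS by (intro Max_in) auto
      then show ?thesis using fS by (intro exI[of _ "Max ?S"]) auto
    qed
    then obtain L' where L': "L' ^ M \<le> L" "\<And>k. k ^ M \<le> L \<Longrightarrow> k \<le> L'" by blast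
    have "(L\<^sub>1 ^ M) ^ M \<le> L" using False by (simp add: power2_eq_square flip: power_mult)
    then have big: "L\<^sub>1 ^ M \<le> L'" by (rule L'(2))
    then have L'2: "2 \<le> L'" using LM two by linarith
    have "L' < L' ^ M"
      using L'2 M power_strict_increasing[of 1 M L'] by simp
    then have "L' < L" using L' by simp
    from less.IH[OF this big] obtain t where t: "0 \<le> t" "t \<le> real L'"
      "controlled \<epsilon> q L\<^sub>0 TYPE('d) L' t (exp (- (real L' powr \<beta>)))" by blast
    have "L < (L' + 1) ^ M" using L'(2)[of "L' + 1"] by (metis add_leE leI not_one_le_zero Suc_n_not_le_n Suc_eq_plus1)
    also have "\<dots> \<le> (L' ^ 2) ^ M"
    proof (rule power_mono)
      have "L' + 1 \<le> L' * 2" using L'2 by simp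
      also have "\<dots> \<le> L' * L'" using L'2 by (intro mult_left_mono) auto
      finally show "L' + 1 \<le> L' ^ 2" by (simp add: power2_eq_square)
    qed simp
    also have "\<dots> = L' ^ (2 * M)" by (simp add: power_mult)
    also have "\<dots> \<le> L' ^ (M ^ 2)"
      using L'2 M by (intro power_increasing) (auto simp: power2_eq_square)
    finally have up: "L \<le> L' ^ (M ^ 2)" by simp
    have "\<Lambda> \<le> L'" "L\<^sub>0 \<le> L'" using big LM start by linarith+
    then show ?thesis
      using grow[OF t(3) _ t(1,2) _ P L'(1) up] by simp
  qed
qed

text \<open>
  The erosion hypothesis, in the form in which the induction uses it, and the constants:
  \<open>\<Delta>\<close> bounds the number of neighbors, \<open>\<kappa>\<close> is half of the fraction of blocks that are independent,
  and \<open>c\<^sub>1\<close> is the smallest of the three rates of decay.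
\<close>

context
  fixes q \<alpha> C \<gamma> :: real and d :: nat and \<kappa> \<Delta> c\<^sub>1 :: real
  assumes d_def: "d = CARD('d::finite)" and d2: "CARD('d) \<ge> 2"
    and \<alpha>: "\<alpha> \<ge> 1" and C: "C \<ge> 1" and \<gamma>: "\<gamma> > 0"
    and survive: "\<And>m T. m \<ge> 1 \<Longrightarrow> C * real m powr \<alpha> \<le> T \<Longrightarrow>
      measure (noise_law q :: 'd noise measure) {\<omega>. \<not> erodes m T \<omega>} \<le> exp (- \<gamma> * real m)"
    and \<kappa>_def: "\<kappa> = 1 / (2 * 6 ^ CARD('d))" and \<Delta>_def: "\<Delta> = 3 ^ CARD('d)"
    and c\<^sub>1_def: "c\<^sub>1 = min \<kappa> (min \<gamma> (1 / 2))"
begin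

lemma constants: "0 < \<kappa>" "1 \<le> \<Delta>" "0 < c\<^sub>1" "c\<^sub>1 \<le> \<kappa>" "c\<^sub>1 \<le> \<gamma>" "c\<^sub>1 \<le> 1 / 2"
  using \<gamma> by (auto simp: \<kappa>_def \<Delta>_def c\<^sub>1_def)

lemma le_erosion_bound:
  assumes "1 \<le> (x :: real)"
  shows "x \<le> C * x powr \<alpha>"
proof -
  have "x powr 1 \<le> x powr \<alpha>" using \<alpha> assms by (intro powr_mono) auto
  also have "\<dots> \<le> C * x powr \<alpha>" using C by (simp add: mult_le_cancel_right1)
  finally show ?thesis using assms by simp
qed

text \<open>
  In terms of exponents: \<open>\<kappa> n \<nu>\<close> from \<open>n\<close> bad blocks in a window, $2 \gamma n L'$ from the erosion of
  cubes and \<open>L / 2\<close> from the speed of influence. The choice of the bad blocks in their window costs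
  \<open>d n ln (4 n)\<close>, by \<open>crowd\<close> at most half of what their probability gives, and adding up the three
  terms over all positions costs \<open>d ln (3 L) + 2\<close>.
\<close>

lemma controlled_step_exp:
  assumes ctrl: "controlled \<epsilon> q L\<^sub>0 TYPE('d) L' t' (exp (- \<nu>))" and \<nu>: "0 \<le> \<nu>"
    and t': "0 \<le> t'" "t' \<le> real L'" and L\<^sub>0: "1 \<le> L\<^sub>0" "L\<^sub>0 \<le> L'" and n: "n \<ge> 1"
    and T: "C * (2 * real n * real L') powr \<alpha> \<le> T" and L: "32 * \<Delta> * T \<le> real L"
    and crowd: "real d * ln (4 * real n) \<le> \<kappa> * \<nu>"
    and \<mu>: "\<mu> \<le> \<kappa> * real n * \<nu>" "\<mu> \<le> \<gamma> * (2 * real n * real L')" "\<mu> \<le> real L / 2"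
  shows "controlled \<epsilon> q L\<^sub>0 TYPE('d) L (t' + T) (exp (- (\<mu> - real d * ln (3 * real L) - 2)))"
proof -
  let ?R = "2 * n * L'"
  have R: "1 \<le> ?R" "real ?R = 2 * real n * real L'" using n L\<^sub>0 by auto
  have "1 \<le> n * L'" using n L\<^sub>0 by auto
  then have nL: "real L' \<le> real n * real L'" "real n * real L' \<ge> 1"
    using n L\<^sub>0 mult_right_mono[of 1 "real n" "real L'"] mult_mono[of 1 "real n" 1 "real L'"] by simp_all
  have RT: "real ?R \<le> T"
    using le_erosion_bound[of "real ?R"] R T by (metis of_nat_1 of_nat_mono order_trans)
  then have T1: "1 \<le> T" "t' \<le> T" "real L' \<le> T" using R nL t' by (simp_all only: R(2))
  have "1 * T \<le> \<Delta> * T" using constants T1 by (intro mult_right_mono) auto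
  then have LT: "32 * T \<le> real L" using L by simp
  have ctrl': "controlled \<epsilon> q L\<^sub>0 TYPE('d) L (t' + T)
    ((3 * real L) ^ CARD('d) * ((4 * real n) ^ (CARD('d) * n) * exp (- \<nu>) powr (real n / 6 ^ CARD('d)))
     + (3 * real L) ^ CARD('d) * exp (- \<gamma> * real ?R) + real L ^ CARD('d) * (1 / 2) ^ L)"
  proof (rule controlled_step[OF d2 ctrl _ _ t'(1) L\<^sub>0 n])
    show "3 * L' \<le> L" using LT T1 by linarith
    show "2 * n * L' \<le> L" using LT T1 RT by linarith
    have "8 * \<Delta> * (t' + 2 * T + 1) \<le> 8 * \<Delta> * (4 * T)"
      using T1 constants by (intro mult_left_mono) auto
    also have "\<dots> = 32 * \<Delta> * T" by simp
    also note L
    finally show "8 * 3 ^ CARD('d) * (t' + 2 * T + 1) \<le> real L" unfolding \<Delta>_def .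
    show "measure (noise_law q :: 'd noise measure) {\<omega>. \<not> erodes (2 * n * L') T \<omega>} \<le> exp (- \<gamma> * real ?R)"
      using T R by (intro survive) auto
  qed (use \<nu> T1 in auto)
  have L1: "real L \<ge> 1" using LT T1 by simp
  have e1: "(4 * real n) ^ (CARD('d) * n) * exp (- \<nu>) powr (real n / 6 ^ CARD('d)) \<le> exp (- \<mu>)"
  proof -
    have "(4 * real n) ^ (CARD('d) * n) = exp (ln (4 * real n)) ^ (CARD('d) * n)"
      using n by (subst exp_ln) auto
    also have "\<dots> = exp (real (CARD('d) * n) * ln (4 * real n))"
      by (rule exp_of_nat_mult[symmetric])
    also have "\<dots> = exp (real n * (real d * ln (4 * real n)))"
      by (simp only: d_def of_nat_mult mult_ac)
    also have "\<dots> \<le> exp (real n * (\<kappa> * \<nu>))"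
      using crowd by (simp add: mult_left_mono)
    finally have "(4 * real n) ^ (CARD('d) * n) * exp (- \<nu>) powr (real n / 6 ^ CARD('d))
        \<le> exp (real n * (\<kappa> * \<nu>)) * exp (- \<nu>) powr (real n / 6 ^ CARD('d))"
      by (rule mult_right_mono) simp
    also have "\<dots> = exp (real n * (\<kappa> * \<nu>)) * exp (- (2 * \<kappa> * real n * \<nu>))"
      by (simp add: exp_powr_real \<kappa>_def)
    also have "\<dots> = exp (- (\<kappa> * real n * \<nu>))"
      by (simp add: algebra_simps flip: exp_add)
    also have "\<dots> \<le> exp (- \<mu>)" using \<mu>(1) by simp
    finally show ?thesis .
  qed
  have e2: "exp (- \<gamma> * real ?R) \<le> exp (- \<mu>)" using \<mu>(2) R by simp
  have e3: "(1 / 2 :: real) ^ L \<le> exp (- \<mu>)"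
  proof -
    have "(1 / 2) ^ L \<le> exp (- 1 / 2 :: real) ^ L"
      using exp_ge_add_one_self[of "- 1 / 2"] by (intro power_mono) auto
    also have "\<dots> = exp (- (real L / 2))" by (simp flip: exp_of_nat_mult)
    also have "\<dots> \<le> exp (- \<mu>)" using \<mu>(3) by simp
    finally show ?thesis .
  qed
  show ?thesis
  proof (rule controlled_mono[OF ctrl'])
    let ?X = "(3 * real L) ^ CARD('d)"
    have "real L ^ CARD('d) \<le> ?X" by (intro power_mono) auto
    then have "?X * ((4 * real n) ^ (CARD('d) * n) * exp (- \<nu>) powr (real n / 6 ^ CARD('d)))
       + ?X * exp (- \<gamma> * real ?R) + real L ^ CARD('d) * (1 / 2) ^ L
       \<le> ?X * exp (- \<mu>) + ?X * exp (- \<mu>) + ?X * exp (- \<mu>)"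
      by (intro add_mono mult_mono e1 e2 e3 order_refl) auto
    also have "\<dots> = 3 * (?X * exp (- \<mu>))" by simp
    also have "\<dots> \<le> exp 2 * (?X * exp (- \<mu>))"
      using exp_ge_add_one_self[of 2] by (intro mult_right_mono) auto
    also have "exp 2 * (?X * exp (- \<mu>)) = exp (- (\<mu> - real d * ln (3 * real L) - 2))"
    proof -
      have "?X = exp (ln (3 * real L)) ^ CARD('d)" using L1 by (subst exp_ln) auto
      also have "\<dots> = exp (real d * ln (3 * real L))"
        unfolding d_def by (rule exp_of_nat_mult[symmetric])
      finally show ?thesis by (simp add: algebra_simps flip: exp_add)
    qed
    finally show "?X * ((4 * real n) ^ (CARD('d) * n) * exp (- \<nu>) powr (real n / 6 ^ CARD('d)))
       + ?X * exp (- \<gamma> * real ?R) + real L ^ CARD('d) * (1 / 2) ^ L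
       \<le> exp (- (\<mu> - real d * ln (3 * real L) - 2))" .
  qed
qed

text \<open>
  From scale \<open>L'\<close> to scale \<open>L\<close> there is room for $n \approx L^{1/\alpha} / L'$, and the exponent becomes
  of order \<open>n\<close>. If $L' \le L^{1/M}$, this beats $L^\beta$. Conversely \<open>L\<close> must stay below a power of
  \<open>L'\<close>, since a probability on scale \<open>L'\<close> that is a high power of $1 / L'$ only pays for positions in
  windows of polynomial size.
\<close>

lemma controlled_growth:
  fixes M :: nat and \<beta> :: real
  assumes \<beta>: "0 < \<beta>" "\<beta> < 1 / \<alpha> - 1 / real M" and M: "M \<ge> 2"
  obtains P :: real and \<Lambda> :: nat where "P > 0" "\<Lambda> \<ge> 2" "\<And>x. real \<Lambda> \<le> x \<Longrightarrow> P * ln x \<le> x powr \<beta>"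
    "\<And>\<epsilon> L\<^sub>0 L' t' \<nu> L. controlled \<epsilon> q L\<^sub>0 TYPE('d) L' t' (exp (- \<nu>)) \<Longrightarrow> 1 \<le> L\<^sub>0 \<Longrightarrow> L\<^sub>0 \<le> L' \<Longrightarrow>
      0 \<le> t' \<Longrightarrow> t' \<le> real L' \<Longrightarrow> \<Lambda> \<le> L' \<Longrightarrow> P * ln (real L') \<le> \<nu> \<Longrightarrow> L' ^ M \<le> L \<Longrightarrow> L \<le> L' ^ (M ^ 2) \<Longrightarrow>
      \<exists>t\<ge>0. t \<le> real L \<and> controlled \<epsilon> q L\<^sub>0 TYPE('d) L t (exp (- (real L powr \<beta>)))"
proof -
  define a where "a = 1 / \<alpha> - 1 / real M"
  define c\<^sub>0 where "c\<^sub>0 = (32 * \<Delta> * C) powr (- 1 / \<alpha>) / 2"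
  define P where "P = real d * (2 + real M ^ 2) / \<kappa> + 2"
  have c0: "c\<^sub>0 > 0" using constants C by (simp add: c\<^sub>0_def)
  have a: "\<beta> < a" "0 < a" using \<beta> by (auto simp: a_def)
  have P: "P \<ge> 2" using constants by (simp add: P_def)
  have "0 < c\<^sub>1 * c\<^sub>0 / 2" using c0 constants by simp
  then have "\<forall>\<^sub>F x in at_top. x powr \<beta> + real d * ln (3 * x) + 2 \<le> c\<^sub>1 * c\<^sub>0 / 2 * x powr a"
    using a \<beta>(1) by real_asymp
  moreover have "\<forall>\<^sub>F x in at_top. 1 \<le> c\<^sub>0 * x powr a"
    using a c0 by real_asymp
  moreover have "\<forall>\<^sub>F x in at_top. P * ln x \<le> x powr \<beta>"
    using \<beta>(1) by real_asymp
  moreover have "\<forall>\<^sub>F x in at_top. (2 :: real) \<le> x"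
    by (rule eventually_ge_at_top)
  ultimately have "\<forall>\<^sub>F x in at_top. x powr \<beta> + real d * ln (3 * x) + 2 \<le> c\<^sub>1 * c\<^sub>0 / 2 * x powr a \<and>
      1 \<le> c\<^sub>0 * x powr a \<and> P * ln x \<le> x powr \<beta> \<and> 2 \<le> x"
    by eventually_elim blast
  then obtain X where X: "\<And>x. X \<le> x \<Longrightarrow> x powr \<beta> + real d * ln (3 * x) + 2 \<le> c\<^sub>1 * c\<^sub>0 / 2 * x powr a"
      "\<And>x. X \<le> x \<Longrightarrow> 1 \<le> c\<^sub>0 * x powr a" "\<And>x. X \<le> x \<Longrightarrow> P * ln x \<le> x powr \<beta>"
    unfolding eventually_at_top_linorder by blast
  define \<Lambda> where "\<Lambda> = max 2 (nat \<lceil>X\<rceil>)"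
  have \<Lambda>: "\<Lambda> \<ge> 2" "X \<le> real \<Lambda>" by (auto simp: \<Lambda>_def) linarith
  show ?thesis
  proof (rule that[of P \<Lambda>])
    show "P > 0" "\<Lambda> \<ge> 2" using P \<Lambda> by auto
    show "P * ln x \<le> x powr \<beta>" if "real \<Lambda> \<le> x" for x using X(3) \<Lambda> that by simp
  next
    fix \<epsilon> \<nu> t' :: real and L\<^sub>0 L' L :: nat
    assume ctrl: "controlled \<epsilon> q L\<^sub>0 TYPE('d) L' t' (exp (- \<nu>))" and L\<^sub>0: "1 \<le> L\<^sub>0" "L\<^sub>0 \<le> L'"
      and t': "0 \<le> t'" "t' \<le> real L'" and L': "\<Lambda> \<le> L'" and \<nu>: "P * ln (real L') \<le> \<nu>"
      and LM: "L' ^ M \<le> L" "L \<le> L' ^ (M ^ 2)"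
    have L'2: "2 \<le> L'" using L' \<Lambda> by simp
    have "L' ^ 1 \<le> L' ^ M" using L'2 M by (intro power_increasing) auto
    then have L'L: "L' \<le> L" using LM by simp
    have XL: "X \<le> real L" using \<Lambda> L' L'L by (meson of_nat_mono order_trans)
    have Lpos: "0 < real L" using L'L L'2 by simp
    have ln2: "1 / 2 \<le> ln (2 :: real)" using ln2_ge_two_thirds by simp
    have lnL': "1 / 2 \<le> ln (real L')"
    proof -
      have "ln 2 \<le> ln (real L')" using L'2 by (intro ln_mono) auto
      then show ?thesis using ln2 by linarith
    qed
    have \<nu>1: "1 \<le> \<nu>"
    proof -
      have "2 * (1 / 2) \<le> P * ln (real L')" using P lnL' by (intro mult_mono) auto
      then show ?thesis using \<nu> by simp
    qed
    define y where "y = (real L / (32 * \<Delta> * C)) powr (1 / \<alpha>) / (2 * real L')"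
    define n where "n = nat \<lfloor>y\<rfloor>"
    define T where "T = real L / (32 * \<Delta>)"
    have "real L' powr real M \<le> real L"
      using LM(1) L'2 by (simp add: powr_realpow flip: of_nat_power)
    then have "(real L' powr real M) powr (1 / real M) \<le> real L powr (1 / real M)"
      by (intro powr_mono2) auto
    then have L'root: "real L' \<le> real L powr (1 / real M)"
      using M L'2 by (simp add: powr_powr)
    have y: "c\<^sub>0 * real L powr a \<le> y"
    proof -
      have "c\<^sub>0 * real L powr a = (real L / (32 * \<Delta> * C)) powr (1 / \<alpha>) / (2 * real L powr (1 / real M))"
      proof -
        have K: "0 < 32 * \<Delta> * C" using constants C by simp
        have "(32 * \<Delta> * C) powr (- 1 / \<alpha>) = 1 / (32 * \<Delta> * C) powr (1 / \<alpha>)"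
          using powr_minus_divide[of "32 * \<Delta> * C" "1 / \<alpha>"] by simp
        moreover have "real L powr a = real L powr (1 / \<alpha>) / real L powr (1 / real M)"
          unfolding a_def by (rule powr_diff)
        moreover have "(real L / (32 * \<Delta> * C)) powr (1 / \<alpha>) = real L powr (1 / \<alpha>) / (32 * \<Delta> * C) powr (1 / \<alpha>)"
          by (rule powr_divide)
        ultimately show ?thesis unfolding c\<^sub>0_def by simp
      qed
      also have "\<dots> \<le> y"
        unfolding y_def using L'root L'2 Lpos by (intro divide_left_mono) auto
      finally show ?thesis .
    qed
    have y1: "1 \<le> y" using X(2)[OF XL] y by simp
    have ny: "y / 2 \<le> real n" "real n \<le> y" "1 \<le> n"
      using half_le_floor[OF y1] y1 unfolding n_def by (auto simp: of_nat_nat le_nat_iff)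
    have T_ge: "C * (2 * real n * real L') powr \<alpha> \<le> T"
    proof -
      have "2 * real n * real L' \<le> 2 * y * real L'" using ny by (intro mult_right_mono) auto
      also have "\<dots> = (real L / (32 * \<Delta> * C)) powr (1 / \<alpha>)" using L'2 by (simp add: y_def)
      finally have "(2 * real n * real L') powr \<alpha> \<le> ((real L / (32 * \<Delta> * C)) powr (1 / \<alpha>)) powr \<alpha>"
        using \<alpha> by (intro powr_mono2) auto
      also have "\<dots> = real L / (32 * \<Delta> * C)"
        using \<alpha> Lpos constants C by (simp add: powr_powr)
      finally have "C * (2 * real n * real L') powr \<alpha> \<le> C * (real L / (32 * \<Delta> * C))"
        using C by (intro mult_left_mono) auto
      also have "\<dots> = T" using C by (simp add: T_def)
      finally show ?thesis .
    qed
    have "1 * 1 \<le> real n * real L'" using ny L'2 by (intro mult_mono) auto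
    then have RT: "2 * real n * real L' \<le> T"
      using le_erosion_bound[of "2 * real n * real L'"] T_ge by simp
    have TL: "T \<le> real L / 32"
      unfolding T_def using constants Lpos by (intro divide_left_mono) auto
    have "real n * 2 \<le> real n * real L'" using L'2 by (intro mult_left_mono) auto
    moreover have "1 * real L' \<le> real n * real L'" using ny(3) by (intro mult_right_mono) auto
    moreover have "0 < real n" using ny(3) by simp
    moreover have "2 * real n * real L' = 2 * (real n * real L')" by simp
    ultimately have nL: "real n \<le> real L / 2" "real L' \<le> T"
      using RT TL Lpos by linarith+
    have lnL: "ln (real L) \<le> real M ^ 2 * ln (real L')"
    proof -
      have "real L \<le> real L' ^ (M ^ 2)" using LM(2) by (metis of_nat_mono of_nat_power)
      then have "ln (real L) \<le> ln (real L' ^ (M ^ 2))" using Lpos by (intro ln_mono) auto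
      then show ?thesis using L'2 by (simp add: ln_realpow)
    qed
    have crowd: "real d * ln (4 * real n) \<le> \<kappa> * \<nu>"
    proof -
      have "ln (4 * real n) \<le> ln (4 * real L)" using nL ny Lpos by (intro ln_mono) auto
      also have "\<dots> = 2 * ln 2 + ln (real L)"
        using Lpos ln_realpow[of 2 2] by (simp add: ln_mult)
      also have "\<dots> \<le> 2 * ln (real L') + real M ^ 2 * ln (real L')"
      proof -
        have "ln 2 \<le> ln (real L')" using L'2 by (intro ln_mono) auto
        then show ?thesis using lnL by linarith
      qed
      finally have "real d * ln (4 * real n) \<le> real d * ((2 + real M ^ 2) * ln (real L'))"
        by (intro mult_left_mono) (simp_all add: algebra_simps)
      also have "\<dots> = \<kappa> * ((P - 2) * ln (real L'))" using constants by (simp add: P_def)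
      also have "\<dots> \<le> \<kappa> * (P * ln (real L'))"
        using constants lnL' by (intro mult_left_mono mult_right_mono) auto
      also have "\<dots> \<le> \<kappa> * \<nu>" using \<nu> constants by (intro mult_left_mono) auto
      finally show ?thesis .
    qed
    have \<mu>: "c\<^sub>1 * real n \<le> \<kappa> * real n * \<nu>" "c\<^sub>1 * real n \<le> \<gamma> * (2 * real n * real L')" "c\<^sub>1 * real n \<le> real L / 2"
    proof -
      have "c\<^sub>1 * (real n * 1) \<le> \<kappa> * (real n * \<nu>)"
        using constants \<nu>1 by (intro mult_mono) auto
      then show "c\<^sub>1 * real n \<le> \<kappa> * real n * \<nu>" by (simp add: mult.assoc)
      have "real n \<le> 2 * real n * real L'" using L'2 ny by (simp add: mult_le_cancel_left1)
      then show "c\<^sub>1 * real n \<le> \<gamma> * (2 * real n * real L')"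
        using constants by (intro mult_mono) auto
      have "c\<^sub>1 * real n \<le> 1 * real n" using constants by (intro mult_right_mono) auto
      then show "c\<^sub>1 * real n \<le> real L / 2" using nL by simp
    qed
    have "controlled \<epsilon> q L\<^sub>0 TYPE('d) L (t' + T) (exp (- (c\<^sub>1 * real n - real d * ln (3 * real L) - 2)))"
      by (rule controlled_step_exp[OF ctrl _ t' L\<^sub>0 ny(3) T_ge _ crowd \<mu>])
        (use \<nu>1 constants in \<open>auto simp: T_def\<close>)
    moreover have "exp (- (c\<^sub>1 * real n - real d * ln (3 * real L) - 2)) \<le> exp (- (real L powr \<beta>))"
    proof -
      have "c\<^sub>1 * c\<^sub>0 / 2 * real L powr a \<le> c\<^sub>1 * (y / 2)"
        using y constants by (simp add: mult.assoc mult_left_mono)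
      also have "\<dots> \<le> c\<^sub>1 * real n" using ny constants by (intro mult_left_mono) auto
      finally show ?thesis using X(1)[OF XL] by simp
    qed
    ultimately have "controlled \<epsilon> q L\<^sub>0 TYPE('d) L (t' + T) (exp (- (real L powr \<beta>)))"
      by (rule controlled_mono)
    moreover have "t' + T \<le> real L" "0 \<le> t' + T" using t' nL TL Lpos by linarith+
    ultimately show "\<exists>t\<ge>0. t \<le> real L \<and> controlled \<epsilon> q L\<^sub>0 TYPE('d) L t (exp (- (real L powr \<beta>)))"
      by blast
  qed
qed

text \<open>
  With $\nu = \ln (1 / \epsilon_0)$ and $n \approx \nu^2$, the exponent after the first step is of order $\nu^2$,
  whereas \<open>ln L\<close> is at most of order \<open>\<nu>\<close> if \<open>L\<^sub>0\<close> is at most a power of \<open>1 / \<epsilon>\<^sub>0\<close>. So the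
  probability becomes smaller than any given power of \<open>1 / L\<close>.
\<close>

lemma controlled_start:
  fixes \<theta> P :: real and \<Lambda> :: nat
  assumes "P > 0"
  shows "\<exists>\<epsilon>>0. \<forall>\<epsilon>\<^sub>0. 0 < \<epsilon>\<^sub>0 \<longrightarrow> \<epsilon>\<^sub>0 < \<epsilon> \<longrightarrow> (\<forall>L\<^sub>0\<ge>1. real L\<^sub>0 \<le> \<epsilon>\<^sub>0 powr (- \<theta>) \<longrightarrow>
    (\<exists>L t \<nu>. controlled \<epsilon>\<^sub>0 q L\<^sub>0 TYPE('d) L t (exp (- \<nu>)) \<and> L\<^sub>0 \<le> L \<and> 0 \<le> t \<and> t \<le> real L \<and> \<Lambda> \<le> L \<and>
      P * ln (real L) \<le> \<nu>))"
proof -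
  define U where "U x = ln (64 * \<Delta> * C) + \<alpha> * (ln 4 + 2 * ln x + \<theta> * x)" for x
  have "\<forall>\<^sub>F x in at_top. real d * ln (8 * x ^ 2) \<le> \<kappa> * x"
    using constants by real_asymp
  moreover have "\<forall>\<^sub>F x in at_top. P * U x + real d * (ln 3 + U x) + 2 \<le> c\<^sub>1 * x ^ 2"
    unfolding U_def using constants by real_asymp
  moreover have "\<forall>\<^sub>F x in at_top. real \<Lambda> \<le> x ^ 2"
    by real_asymp
  moreover have "\<forall>\<^sub>F x in at_top. (1 :: real) \<le> x"
    by (rule eventually_ge_at_top)
  ultimately have "\<forall>\<^sub>F x in at_top. real d * ln (8 * x ^ 2) \<le> \<kappa> * x \<and>
      P * U x + real d * (ln 3 + U x) + 2 \<le> c\<^sub>1 * x ^ 2 \<and> real \<Lambda> \<le> x ^ 2 \<and> 1 \<le> x"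
    by eventually_elim blast
  then obtain X where X: "\<And>x. X \<le> x \<Longrightarrow> real d * ln (8 * x ^ 2) \<le> \<kappa> * x \<and>
      P * U x + real d * (ln 3 + U x) + 2 \<le> c\<^sub>1 * x ^ 2 \<and> real \<Lambda> \<le> x ^ 2 \<and> 1 \<le> x"
    unfolding eventually_at_top_linorder by blast
  show ?thesis
  proof (intro exI[of _ "exp (- X)"] conjI allI impI)
    fix \<epsilon>\<^sub>0 :: real and L\<^sub>0 :: nat
    assume \<epsilon>\<^sub>0: "0 < \<epsilon>\<^sub>0" "\<epsilon>\<^sub>0 < exp (- X)" and L\<^sub>0: "1 \<le> L\<^sub>0" "real L\<^sub>0 \<le> \<epsilon>\<^sub>0 powr (- \<theta>)"
    define \<nu> where "\<nu> = - ln \<epsilon>\<^sub>0"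
    have "ln \<epsilon>\<^sub>0 < ln (exp (- X))" using \<epsilon>\<^sub>0 by (subst ln_less_cancel_iff) auto
    then have "X \<le> \<nu>" by (simp add: \<nu>_def)
    note x = X[OF this]
    have \<nu>1: "1 \<le> \<nu>" using x by blast
    have e: "exp (- \<nu>) = \<epsilon>\<^sub>0" using \<epsilon>\<^sub>0 by (simp add: \<nu>_def)
    have \<epsilon>1: "\<epsilon>\<^sub>0 \<le> 1" using \<nu>1 by (simp flip: e)
    have ctrl: "controlled \<epsilon>\<^sub>0 q L\<^sub>0 TYPE('d) L\<^sub>0 0 (exp (- \<nu>))"
      unfolding e using \<epsilon>\<^sub>0 \<epsilon>1 L\<^sub>0 by (intro controlled_initially) auto
    define n where "n = nat \<lceil>\<nu> ^ 2\<rceil>"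
    have \<nu>2: "1 \<le> \<nu> ^ 2" using \<nu>1 by (simp add: one_le_power)
    have n: "\<nu> ^ 2 \<le> real n" "real n \<le> 2 * \<nu> ^ 2"
      using \<nu>2 by (auto simp: n_def of_nat_nat) linarith+
    then have n1: "1 \<le> n" using \<nu>2 by (simp flip: of_nat_le_iff) 
    define T where "T = C * (2 * real n * real L\<^sub>0) powr \<alpha>"
    define L where "L = nat \<lceil>32 * \<Delta> * T\<rceil>"
    have nL: "1 \<le> real n * real L\<^sub>0" "real n \<le> real n * real L\<^sub>0" "real L\<^sub>0 \<le> real n * real L\<^sub>0"
      using n1 L\<^sub>0 by (auto simp: mult_le_cancel_left1 mult_le_cancel_right1 simp flip: of_nat_mult)
    have RT: "2 * real n * real L\<^sub>0 \<le> T"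
      unfolding T_def using nL by (intro le_erosion_bound) auto
    have "1 * T \<le> \<Delta> * T" using constants RT nL by (intro mult_right_mono) auto
    then have DT: "T \<le> \<Delta> * T" by simp
    have L: "32 * \<Delta> * T \<le> real L" "real L \<le> 64 * \<Delta> * T"
    proof -
      have "0 \<le> 32 * \<Delta> * T" using DT RT nL by linarith
      then have "0 \<le> \<lceil>32 * \<Delta> * T\<rceil>" using le_of_int_ceiling[of "32 * \<Delta> * T"] by linarith
      then have "real L = real_of_int \<lceil>32 * \<Delta> * T\<rceil>" by (simp add: L_def)
      then show "32 * \<Delta> * T \<le> real L" "real L \<le> 64 * \<Delta> * T"
        using ceiling_correct[of "32 * \<Delta> * T"] DT RT nL by linarith+
    qed
    have lnL: "ln (real L) \<le> U \<nu>"
    proof -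
      have "real L \<le> 64 * \<Delta> * C * (2 * real n * real L\<^sub>0) powr \<alpha>"
        using L(2) by (simp add: T_def mult_ac)
      then have "ln (real L) \<le> ln (64 * \<Delta> * C * (2 * real n * real L\<^sub>0) powr \<alpha>)"
        using L(1) DT RT nL by (intro ln_mono) linarith+
      also have "\<dots> = ln (64 * \<Delta> * C) + \<alpha> * ln (2 * real n * real L\<^sub>0)"
        using constants C n1 L\<^sub>0 by (simp add: ln_mult ln_powr)
      also have "ln (2 * real n * real L\<^sub>0) \<le> ln (4 * \<nu> ^ 2 * \<epsilon>\<^sub>0 powr (- \<theta>))"
        using n L\<^sub>0 n1 \<nu>2 \<epsilon>\<^sub>0 by (intro ln_mono mult_mono[of "2 * real n" "4 * \<nu> ^ 2"]) auto
      also have "\<dots> = ln 4 + 2 * ln \<nu> + \<theta> * \<nu>"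
      proof -
        have "ln (\<epsilon>\<^sub>0 powr (- \<theta>)) = \<theta> * \<nu>" by (simp add: ln_powr \<nu>_def)
        then show ?thesis using \<nu>1 \<epsilon>\<^sub>0 by (simp add: ln_mult ln_realpow)
      qed
      finally show ?thesis using \<alpha> by (simp add: U_def)
    qed
    define \<nu>\<^sub>1 where "\<nu>\<^sub>1 = c\<^sub>1 * \<nu> ^ 2 - real d * ln (3 * real L) - 2"
    have Lpos: "real L \<ge> \<nu> ^ 2" "real L \<ge> 2 * real n" "real L \<ge> real L\<^sub>0" "real L \<ge> T"
      using L(1) DT RT nL n \<nu>2 by linarith+
    have "controlled \<epsilon>\<^sub>0 q L\<^sub>0 TYPE('d) L (0 + T) (exp (- \<nu>\<^sub>1))"
      unfolding \<nu>\<^sub>1_def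
    proof (rule controlled_step_exp[OF ctrl, where n = n])
      show "C * (2 * real n * real L\<^sub>0) powr \<alpha> \<le> T" by (simp add: T_def)
      have "real d * ln (4 * real n) \<le> real d * ln (8 * \<nu> ^ 2)"
        using n n1 by (intro mult_left_mono ln_mono) auto
      then show "real d * ln (4 * real n) \<le> \<kappa> * \<nu>" using x by linarith
      have "c\<^sub>1 * (\<nu> ^ 2 * 1) \<le> \<kappa> * (real n * \<nu>)"
        using constants n \<nu>1 \<nu>2 by (intro mult_mono) auto
      then show "c\<^sub>1 * \<nu> ^ 2 \<le> \<kappa> * real n * \<nu>" by (simp add: mult.assoc)
      show "c\<^sub>1 * \<nu> ^ 2 \<le> \<gamma> * (2 * real n * real L\<^sub>0)"
        using constants n nL by (intro mult_mono) auto
      have "c\<^sub>1 * \<nu> ^ 2 \<le> 1 / 2 * real L"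
        using constants Lpos by (intro mult_mono) auto
      then show "c\<^sub>1 * \<nu> ^ 2 \<le> real L / 2" by simp
    qed (use \<nu>1 L\<^sub>0 n1 L in auto)
    moreover have "P * ln (real L) \<le> \<nu>\<^sub>1"
    proof -
      have "ln (3 * real L) = ln 3 + ln (real L)" using Lpos \<nu>2 by (simp add: ln_mult)
      then have "real d * ln (3 * real L) \<le> real d * (ln 3 + U \<nu>)" using lnL by (intro mult_left_mono) auto
      moreover have "P * ln (real L) \<le> P * U \<nu>" using lnL assms by simp
      ultimately show ?thesis using x unfolding \<nu>\<^sub>1_def by linarith
    qed
    moreover have "\<Lambda> \<le> L" using x Lpos by linarith
    ultimately show "\<exists>L t \<nu>. controlled \<epsilon>\<^sub>0 q L\<^sub>0 TYPE('d) L t (exp (- \<nu>)) \<and> L\<^sub>0 \<le> L \<and> 0 \<le> t \<and> t \<le> real L \<and> \<Lambda> \<le> L \<and>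
      P * ln (real L) \<le> \<nu>"
      using Lpos RT nL by (intro exI[of _ L] exI[of _ "0 + T"] exI[of _ \<nu>\<^sub>1]) auto
  qed simp
qed

text \<open>
  The last step uses the scale $(\ln t)^{\alpha+1}$. Its exponent $(\ln t)^{(\alpha+1)\beta}$ exceeds the
  order $\ln t$ that windows in a region of size \<open>t\<close> may cost, and the loss of a factor $L'^{1-\beta}$ is at
  most of order $(\ln t)^\alpha$.
\<close>

lemma controlled_at_time:
  fixes \<beta> \<epsilon> :: real and L\<^sub>0 \<Lambda> :: nat
  assumes \<beta>: "1 < (\<alpha> + 1) * \<beta>" "0 < \<beta>" "\<beta> \<le> 1" and L\<^sub>0: "1 \<le> L\<^sub>0" "L\<^sub>0 \<le> \<Lambda>"
    and scales: "\<And>L. \<Lambda> \<le> L \<Longrightarrow> \<exists>t\<ge>0. t \<le> real L \<and> controlled \<epsilon> q L\<^sub>0 TYPE('d) L t (exp (- (real L powr \<beta>)))"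
  shows "\<exists>c>0. \<forall>\<^sub>F t in at_top. \<exists>L\<ge>1.
    controlled \<epsilon> q L\<^sub>0 TYPE('d) L t (exp (- (c * (t powr (1 / \<alpha>) / (ln t) powr \<alpha>))))"
proof -
  define K where "K = (2 * C) powr (1 / \<alpha>)"
  have K: "1 \<le> K" unfolding K_def using C \<alpha> by (intro ge_one_powr_ge_zero) auto
  define c where "c = c\<^sub>1 / (8 * K)"
  have c: "0 < c" "c \<le> 1" "c = c\<^sub>1 / 4 * (1 / K) * (1 / 2)"
    using constants K by (auto simp: c_def divide_le_eq)
  have ev1: "\<forall>\<^sub>F t in at_top. 4 * (ln t) powr (\<alpha> + 1) \<le> t"
    using \<alpha> by real_asymp
  have ev2: "\<forall>\<^sub>F t in at_top. 1 \<le> (1 / K) * t powr (1 / \<alpha>) / (4 * (ln t) powr (\<alpha> + 1))"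
    using \<alpha> K by real_asymp
  have ev3: "\<forall>\<^sub>F t in at_top. real d * ln (4 * t) \<le> \<kappa> * (ln t) powr ((\<alpha> + 1) * \<beta>)"
    using \<beta>(1) constants by real_asymp
  have ev4: "\<forall>\<^sub>F t in at_top. real \<Lambda> \<le> (ln t) powr (\<alpha> + 1)"
    using \<alpha> by real_asymp
  have ev5: "\<forall>\<^sub>F t in at_top. real d * ln (192 * \<Delta> * t) + 2 \<le> c / 2 * (t powr (1 / \<alpha>) / (ln t) powr \<alpha>)"
    using \<alpha> c constants by real_asymp
  have ev6: "\<forall>\<^sub>F t in at_top. 1 \<le> ln t \<and> (1 :: real) \<le> t"
    by (intro eventually_conj) real_asymp+
  show ?thesis
  proof (intro exI[of _ "c / 2"] conjI)
    show "0 < c / 2" using c by simp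
    show "\<forall>\<^sub>F t in at_top. \<exists>L\<ge>1. controlled \<epsilon> q L\<^sub>0 TYPE('d) L t
        (exp (- (c / 2 * (t powr (1 / \<alpha>) / (ln t) powr \<alpha>))))"
      using ev1 ev2 ev3 ev4 ev5 ev6
    proof eventually_elim
      fix t :: real
      assume e1: "4 * (ln t) powr (\<alpha> + 1) \<le> t"
        and e2: "1 \<le> (1 / K) * t powr (1 / \<alpha>) / (4 * (ln t) powr (\<alpha> + 1))"
        and e3: "real d * ln (4 * t) \<le> \<kappa> * (ln t) powr ((\<alpha> + 1) * \<beta>)"
        and e4: "real \<Lambda> \<le> (ln t) powr (\<alpha> + 1)"
        and e5: "real d * ln (192 * \<Delta> * t) + 2 \<le> c / 2 * (t powr (1 / \<alpha>) / (ln t) powr \<alpha>)"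
        and e6: "1 \<le> ln t \<and> 1 \<le> t"
      define u where "u = (ln t) powr (\<alpha> + 1)"
      have u: "1 \<le> u" unfolding u_def using e6 \<alpha> by (intro ge_one_powr_ge_zero) auto
      define L' where "L' = nat \<lceil>u\<rceil>"
      have "real L' = real_of_int \<lceil>u\<rceil>" using u by (simp add: L'_def)
      then have L': "u \<le> real L'" "real L' \<le> 2 * u" using u ceiling_correct[of u] by linarith+
      have L'1: "1 \<le> real L'" using L' u by linarith
      have \<Lambda>L': "\<Lambda> \<le> L'" using e4 L' unfolding u_def by linarith
      obtain t' where t': "0 \<le> t'" "t' \<le> real L'"
        "controlled \<epsilon> q L\<^sub>0 TYPE('d) L' t' (exp (- (real L' powr \<beta>)))"
        using scales[OF \<Lambda>L'] by blast
      define r where "r = (1 / K) * t powr (1 / \<alpha>)"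
      have r0: "0 \<le> r" using K by (simp add: r_def)
      have r_eq: "r = (t / (2 * C)) powr (1 / \<alpha>)" by (simp add: r_def K_def powr_divide)
      define y where "y = r / (2 * real L')"
      have "r / (4 * u) \<le> y"
        unfolding y_def using L' L'1 r0 by (intro divide_left_mono) auto
      then have y1: "1 \<le> y" using e2 by (simp add: r_def u_def)
      define n where "n = nat \<lfloor>y\<rfloor>"
      have n: "y / 2 \<le> real n" "real n \<le> y" "1 \<le> n"
        using half_le_floor[OF y1] y1 unfolding n_def by (auto simp: of_nat_nat le_nat_iff)
      have "2 * real n * real L' \<le> 2 * y * real L'" using n by (intro mult_right_mono) auto
      also have "\<dots> = r" using L'1 by (simp add: y_def)
      finally have R: "2 * real n * real L' \<le> r" .
      have T: "C * (2 * real n * real L') powr \<alpha> \<le> t / 2"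
      proof -
        have "(2 * real n * real L') powr \<alpha> \<le> r powr \<alpha>" using R \<alpha> by (intro powr_mono2) auto
        also have "\<dots> = t / (2 * C)" using \<alpha> e6 C by (simp add: r_eq powr_powr)
        finally have "C * (2 * real n * real L') powr \<alpha> \<le> C * (t / (2 * C))" using C by (intro mult_left_mono) auto
        then show ?thesis using C by simp
      qed
      have nL1: "1 \<le> real n" "real n \<le> real n * real L'" "1 \<le> real n * real L'"
        using n(3) L'1 mult_mono[of 1 "real n" 1 "real L'"] by (simp_all add: mult_le_cancel_left1)
      have Rt: "2 * real n * real L' \<le> t / 2"
        using le_erosion_bound[of "2 * real n * real L'"] nL1 T by linarith
      have t't: "t' \<le> t / 2" using t' L' e1 unfolding u_def by linarith
      define L where "L = nat \<lceil>32 * \<Delta> * t\<rceil>"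
      have Dt: "t \<le> \<Delta> * t" using constants e6 by (simp add: mult_le_cancel_right1)
      have "0 \<le> 32 * \<Delta> * t" using Dt e6 by linarith
      then have "real L = real_of_int \<lceil>32 * \<Delta> * t\<rceil>"
        using le_of_int_ceiling[of "32 * \<Delta> * t"] by (simp add: L_def)
      then have L: "32 * \<Delta> * t \<le> real L" "real L \<le> 64 * \<Delta> * t"
        using ceiling_correct[of "32 * \<Delta> * t"] Dt e6 by linarith+
      have Lt: "t \<le> real L / 2" using L(1) Dt e6 by linarith
      define g where "g = t powr (1 / \<alpha>) / (ln t) powr \<alpha>"
      have g: "g = t powr (1 / \<alpha>) * (ln t) powr (- \<alpha>)"
        by (simp add: g_def powr_minus_divide)
      have g_le: "g \<le> t powr (1 / \<alpha>)"
      proof -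
        have "1 \<le> (ln t) powr \<alpha>" using e6 \<alpha> by (intro ge_one_powr_ge_zero) auto
        then have "t powr (1 / \<alpha>) / (ln t) powr \<alpha> \<le> t powr (1 / \<alpha>) / 1" by (intro divide_left_mono) auto
        then show ?thesis by (simp add: g_def)
      qed
      have g0: "0 \<le> g" by (simp add: g_def)
      have \<mu>1: "c * g \<le> \<kappa> * real n * (real L' powr \<beta>)"
      proof -
        \<comment> \<open>the loss \<open>L' powr (1 - \<beta>)\<close> against \<open>n L' \<approx> r / 2\<close> is at most of order \<open>ln t powr \<alpha>\<close>\<close>
        have "(ln t) powr (- \<alpha>) \<le> (ln t) powr ((\<alpha> + 1) * (\<beta> - 1))"
          using e6 \<beta>(1) by (intro powr_mono) (auto simp: algebra_simps)
        also have "\<dots> = u powr (\<beta> - 1)" by (simp add: u_def powr_powr)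
        finally have "1 / 2 * (ln t) powr (- \<alpha>) \<le> 2 powr (\<beta> - 1) * u powr (\<beta> - 1)"
          using \<beta>(2) powr_mono[of "- 1" "\<beta> - 1" "2 :: real"]
          by (intro mult_mono) (auto simp: powr_minus_divide)
        also have "\<dots> = (2 * u) powr (\<beta> - 1)" using u by (simp add: powr_mult)
        also have "\<dots> \<le> real L' powr (\<beta> - 1)"
          using \<beta>(3) L' L'1 by (intro powr_mono2') auto
        also have "\<dots> = real L' powr \<beta> / real L'" using L'1 by (simp add: powr_diff)
        finally have w: "1 / 2 * (ln t) powr (- \<alpha>) \<le> real L' powr \<beta> / real L'" .
        have "c * g = c\<^sub>1 / 4 * r * (1 / 2 * (ln t) powr (- \<alpha>))"
          by (simp add: c(3) g r_def)
        also have "\<dots> \<le> c\<^sub>1 / 4 * r * (real L' powr \<beta> / real L')"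
          using w constants r0 by (intro mult_left_mono) auto
        also have "\<dots> = c\<^sub>1 * (y / 2) * real L' powr \<beta>" by (simp add: y_def)
        also have "\<dots> \<le> \<kappa> * real n * real L' powr \<beta>"
          using constants n y1 by (intro mult_right_mono mult_mono) auto
        finally show ?thesis .
      qed
      have \<mu>2: "c * g \<le> \<gamma> * (2 * real n * real L')"
      proof -
        have "c * g \<le> c * t powr (1 / \<alpha>)" using g_le c by (intro mult_left_mono) auto
        also have "\<dots> = c\<^sub>1 * (r / 8)" by (simp add: c_def r_def)
        also have "\<dots> = c\<^sub>1 * (y * real L' / 4)" using L'1 by (simp add: y_def)
        also have "\<dots> \<le> \<gamma> * (2 * real n * real L')"
        proof (rule mult_mono)
          have "y * real L' \<le> 2 * real n * real L'" using n by (intro mult_right_mono) auto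
          then show "y * real L' / 4 \<le> 2 * real n * real L'" using nL1 by linarith
        qed (use constants y1 in auto)
        finally show ?thesis .
      qed
      have \<mu>3: "c * g \<le> real L / 2"
      proof -
        have "c * g \<le> 1 * t powr (1 / \<alpha>)" using c g_le g0 by (intro mult_mono) auto
        also have "\<dots> \<le> 1 * t powr 1"
          using e6 \<alpha> by (intro mult_left_mono powr_mono) auto
        finally show ?thesis using Lt e6 by simp
      qed
      have ctrl: "controlled \<epsilon> q L\<^sub>0 TYPE('d) L (t' + (t - t')) (exp (- (c * g - real d * ln (3 * real L) - 2)))"
      proof (rule controlled_step_exp[OF t'(3) _ t'(1,2) L\<^sub>0(1) _ n(3)])
        show "L\<^sub>0 \<le> L'" using L\<^sub>0 \<Lambda>L' by simp
        show "C * (2 * real n * real L') powr \<alpha> \<le> t - t'" using T t't by linarith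
        have "32 * \<Delta> * (t - t') \<le> 32 * \<Delta> * t" using t' constants by (intro mult_left_mono) auto
        then show "32 * \<Delta> * (t - t') \<le> real L" using L by linarith
        have "real n \<le> t" using Rt nL1 e6 by linarith
        then have "real d * ln (4 * real n) \<le> real d * ln (4 * t)"
          using nL1 by (intro mult_left_mono ln_mono) auto
        also have "\<dots> \<le> \<kappa> * u powr \<beta>" using e3 by (simp add: u_def powr_powr)
        also have "\<dots> \<le> \<kappa> * real L' powr \<beta>"
          using constants L' u \<beta> by (intro mult_left_mono powr_mono2) auto
        finally show "real d * ln (4 * real n) \<le> \<kappa> * real L' powr \<beta>" .
      qed (use \<mu>1 \<mu>2 \<mu>3 in auto)
      have exponent: "c / 2 * g \<le> c * g - real d * ln (3 * real L) - 2"
      proof -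
        have "real d * ln (3 * real L) \<le> real d * ln (192 * \<Delta> * t)"
          using L Lt e6 by (intro mult_left_mono ln_mono) auto
        moreover have "real d * ln (192 * \<Delta> * t) + 2 \<le> c / 2 * g" using e5 unfolding g_def .
        moreover have "c * g = c / 2 * g + c / 2 * g" by simp
        ultimately show ?thesis by linarith
      qed
      have "exp (- (c * g - real d * ln (3 * real L) - 2)) \<le> exp (- (c / 2 * g))"
        using exponent by (simp only: exp_le_cancel_iff neg_le_iff_le)
      from controlled_mono[OF ctrl this] have "controlled \<epsilon> q L\<^sub>0 TYPE('d) L t (exp (- (c / 2 * g)))"
        by simp
      moreover have "1 \<le> L" using Lt e6 by linarith
      ultimately show "\<exists>L\<ge>1. controlled \<epsilon> q L\<^sub>0 TYPE('d) L t (exp (- (c / 2 * (t powr (1 / \<alpha>) / (ln t) powr \<alpha>))))"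
        unfolding g_def by blast
    qed
  qed
qed

end

section \<open>All later times\<close>

lemma controlled_origin:
  assumes "controlled \<epsilon> q L\<^sub>0 TYPE('d::finite) L t p" and L: "1 \<le> L" and t: "0 \<le> t"
  obtains A where "A \<in> sets (law \<epsilon> q :: 'd sample measure)" "measure (law \<epsilon> q) A \<le> p"
    "\<And>\<eta> \<omega> s. regular \<omega> \<Longrightarrow> finite_influence \<omega> \<Longrightarrow> \<forall>i. \<eta> i \<in> {1, - 1} \<Longrightarrow> (\<eta>, \<omega>) \<notin> A \<Longrightarrow> t \<le> s \<Longrightarrow> s \<le> 2 * t \<Longrightarrow>
      glauber \<omega> (block_init L\<^sub>0 \<eta>) s 0 = 1"
proof -
  obtain B :: "'d site \<Rightarrow> 'd sample set" where
    B: "\<And>z. B z \<in> sets (local_algebra (inputs_at L\<^sub>0 (enlarged_block L z 2)))"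
      "\<And>z. measure (law \<epsilon> q) (B z) \<le> p"
    and good: "\<And>z \<eta> \<omega> V x s. regular \<omega> \<Longrightarrow> \<forall>i. \<eta> i \<in> {1, - 1} \<Longrightarrow> skeleton \<omega> (block_init L\<^sub>0 \<eta>) V \<Longrightarrow>
        (\<eta>, \<omega>) \<notin> B z \<Longrightarrow> x \<in> block L z \<Longrightarrow> t \<le> s \<Longrightarrow> s \<le> 2 * t \<Longrightarrow> V x (rings_upto \<omega> x s) = 1"
    using assms(1) unfolding controlled_def by blast
  show ?thesis
  proof (rule that[of "B 0"])
    show "B 0 \<in> sets (law \<epsilon> q :: 'd sample measure)" by (rule local_algebra_sets_law[OF B(1)])
    show "measure (law \<epsilon> q) (B 0) \<le> p" by (rule B(2))
    fix \<eta> \<omega> s assume *: "regular \<omega>" "finite_influence \<omega>" "\<forall>i. \<eta> i \<in> {1, - 1}" "(\<eta>, \<omega>) \<notin> B 0" "t \<le> s" "s \<le> 2 * t"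
    have init: "block_init L\<^sub>0 \<eta> x \<in> {1, - 1}" for x
      using *(3) by (simp add: block_init_def)
    obtain V where V: "skeleton \<omega> (block_init L\<^sub>0 \<eta>) V"
      "\<And>t x. 0 \<le> t \<Longrightarrow> glauber \<omega> (block_init L\<^sub>0 \<eta>) t x = V x (rings_upto \<omega> x t)"
      by (rule glauber_skeleton[OF *(1,2), of "block_init L\<^sub>0 \<eta>", OF init]) (rule that)
    have "0 \<in> block L (0 :: 'd site)" using L by (simp add: enlarged_block_def)
    then show "glauber \<omega> (block_init L\<^sub>0 \<eta>) s 0 = 1"
      using good[OF *(1,3) V(1) *(4) _ *(5,6)] V(2) t *(5) by simp
  qed
qed

lemma AE_block_spins: "AE z in (law \<epsilon> q :: 'd::finite sample measure). \<forall>i. fst z i \<in> {1, - 1}"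
proof -
  interpret N: prob_space "noise_law q :: 'd noise measure" by (rule prob_space_noise_law)
  interpret P: product_prob_space "\<lambda>_. measure_pmf (spin_pmf (1 - \<epsilon>))" "UNIV :: 'd site set"
    by unfold_locales
  have "AE \<eta> in (block_law \<epsilon> :: 'd config measure). \<eta> i \<in> {1, - 1}" for i
    unfolding block_law_def
    by (rule P.AE_component[of i "\<lambda>s. s \<in> {1, - 1}"]) (auto simp: AE_measure_pmf_iff spin_pmf_def)
  then have "AE \<eta> in (block_law \<epsilon> :: 'd config measure). \<forall>i. \<eta> i \<in> {1, - 1}"
    by (simp only: AE_all_countable) blast
  then show ?thesis
    unfolding random_init_law_def
    by (intro AE_distrD[where f = fst and M' = "block_law \<epsilon>"]) (simp, unfold N.distr_pair_fst)
qed

definition rate :: "real \<Rightarrow> real \<Rightarrow> real" where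
  "rate \<alpha> t = t powr (1 / \<alpha>) / (ln t) powr \<alpha>"

text \<open>
  The logarithm of the rate is \<open>u / \<alpha> - \<alpha> ln u\<close> in terms of \<open>u = ln t\<close>, which increases from $u = \alpha^2$ on.
\<close>

lemma rate_mono:
  assumes \<alpha>: "1 \<le> \<alpha>" and s: "exp (\<alpha>\<^sup>2) \<le> s" "s \<le> t"
  shows "rate \<alpha> s \<le> rate \<alpha> t"
proof -
  have s0: "0 < s" using s(1) exp_gt_zero[of "\<alpha>\<^sup>2"] by linarith
  have lns: "\<alpha>\<^sup>2 \<le> ln s" using s(1) s0 by (simp add: ln_ge_iff)
  have \<alpha>2: "0 < \<alpha>\<^sup>2" using \<alpha> by simp
  have ln0: "0 < ln s" "ln s \<le> ln t" using lns \<alpha>2 s s0 by (linarith, simp)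
  have eq: "rate \<alpha> r = exp (ln r / \<alpha> - \<alpha> * ln (ln r))" if "0 < r" "0 < ln r" for r
    using that by (simp add: rate_def powr_def exp_diff)
  have "ln (ln t) - ln (ln s) \<le> (ln t - ln s) / ln s"
    using ln0 by (intro ln_diff_le) auto
  also have "\<dots> \<le> (ln t - ln s) / \<alpha>\<^sup>2"
    using ln0 lns \<alpha>2 by (intro divide_left_mono mult_pos_pos) linarith+
  finally have "\<alpha> * (ln (ln t) - ln (ln s)) \<le> \<alpha> * ((ln t - ln s) / \<alpha>\<^sup>2)"
    using \<alpha> by (intro mult_left_mono) auto
  also have "\<dots> = ln t / \<alpha> - ln s / \<alpha>"
    using \<alpha> by (simp add: power2_eq_square field_simps)
  finally have "ln s / \<alpha> - \<alpha> * ln (ln s) \<le> ln t / \<alpha> - \<alpha> * ln (ln t)"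
    by (simp add: algebra_simps)
  then show ?thesis
    using eq[of s] eq[of t] s s0 ln0 by simp
qed

text \<open>
  The windows $[2^j t, 2^{j+1} t]$ cover all times after \<open>t\<close>. Half of the exponent pays for the
  factor $1 / (2^j t)$ that makes the sum over them converge.
\<close>

lemma prob_minus_later:
  fixes \<alpha> c \<epsilon> q :: real and L\<^sub>0 :: nat
  assumes \<alpha>: "1 \<le> \<alpha>" and c: "c > 0"
    and ctrl: "\<forall>\<^sub>F t in at_top. \<exists>L\<ge>1. controlled \<epsilon> q L\<^sub>0 TYPE('d::finite) L t (exp (- (c * rate \<alpha> t)))"
  shows "\<forall>\<^sub>F t in at_top. \<P>((\<eta>, \<omega>) in completion (law \<epsilon> q :: 'd sample measure).
    \<exists>s\<ge>t. glauber \<omega> (block_init L\<^sub>0 \<eta>) s 0 = - 1) \<le> exp (- (c / 2 * rate \<alpha> t))"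
proof -
  let ?L = "law \<epsilon> q :: 'd sample measure"
  interpret L: prob_space ?L by (rule prob_space_law)
  have "\<forall>\<^sub>F t in at_top. ln t \<le> c / 2 * rate \<alpha> t"
    unfolding rate_def using \<alpha> c by real_asymp
  moreover have "\<forall>\<^sub>F t in at_top. exp (\<alpha>\<^sup>2) \<le> t" "\<forall>\<^sub>F t in at_top. (2 :: real) \<le> t"
    by (rule eventually_ge_at_top)+
  ultimately have "\<forall>\<^sub>F t in at_top. (\<exists>L\<ge>1. controlled \<epsilon> q L\<^sub>0 TYPE('d) L t (exp (- (c * rate \<alpha> t)))) \<and>
      ln t \<le> c / 2 * rate \<alpha> t \<and> exp (\<alpha>\<^sup>2) \<le> t \<and> 2 \<le> t"
    using ctrl by eventually_elim blast
  then obtain t\<^sub>0 where t\<^sub>0: "\<And>t. t\<^sub>0 \<le> t \<Longrightarrow> (\<exists>L\<ge>1. controlled \<epsilon> q L\<^sub>0 TYPE('d) L t (exp (- (c * rate \<alpha> t)))) \<and>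
      ln t \<le> c / 2 * rate \<alpha> t \<and> exp (\<alpha>\<^sup>2) \<le> t \<and> 2 \<le> t"
    unfolding eventually_at_top_linorder by blast
  have "\<P>((\<eta>, \<omega>) in completion ?L. \<exists>s\<ge>t. glauber \<omega> (block_init L\<^sub>0 \<eta>) s 0 = - 1) \<le> exp (- (c / 2 * rate \<alpha> t))"
    if t: "t\<^sub>0 \<le> t" for t
  proof -
    have t2: "2 \<le> t" "exp (\<alpha>\<^sup>2) \<le> t" using t\<^sub>0[OF t] by auto
    define T where "T j = 2 ^ j * t" for j :: nat
    have T_ge: "t \<le> T j" for j
      using t2 one_le_power[of 2 j] by (simp add: T_def mult_le_cancel_right1)
    have "\<exists>A. A \<in> sets ?L \<and> measure ?L A \<le> exp (- (c * rate \<alpha> (T j))) \<and>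
      (\<forall>\<eta> \<omega> s. regular \<omega> \<longrightarrow> finite_influence \<omega> \<longrightarrow> (\<forall>i. \<eta> i \<in> {1, - 1}) \<longrightarrow> (\<eta>, \<omega>) \<notin> A \<longrightarrow> T j \<le> s \<longrightarrow>
        s \<le> 2 * T j \<longrightarrow> glauber \<omega> (block_init L\<^sub>0 \<eta>) s 0 = 1)" for j
    proof -
      have "t\<^sub>0 \<le> T j" using t T_ge[of j] by linarith
      then obtain L where L: "1 \<le> L" "controlled \<epsilon> q L\<^sub>0 TYPE('d) L (T j) (exp (- (c * rate \<alpha> (T j))))"
        using t\<^sub>0 by blast
      have "0 \<le> T j" using T_ge[of j] t2 by linarith
      from controlled_origin[OF L(2,1) this] show ?thesis by metis
    qed
    then obtain A where A: "\<And>j. A j \<in> sets ?L" "\<And>j. measure ?L (A j) \<le> exp (- (c * rate \<alpha> (T j)))"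
      and good: "\<And>j \<eta> \<omega> s. regular \<omega> \<Longrightarrow> finite_influence \<omega> \<Longrightarrow> \<forall>i. \<eta> i \<in> {1, - 1} \<Longrightarrow> (\<eta>, \<omega>) \<notin> A j \<Longrightarrow> T j \<le> s \<Longrightarrow>
        s \<le> 2 * T j \<Longrightarrow> glauber \<omega> (block_init L\<^sub>0 \<eta>) s 0 = 1"
      by metis
    have bound: "measure ?L (A j) \<le> exp (- (c / 2 * rate \<alpha> t)) * (1 / 2) * (1 / 2) ^ j" for j
    proof -
      have Tj: "t\<^sub>0 \<le> T j" "0 < T j" using t T_ge[of j] t2 by linarith+
      have r: "rate \<alpha> t \<le> rate \<alpha> (T j)" by (rule rate_mono[OF \<alpha> t2(2) T_ge])
      have "c / 2 * rate \<alpha> t \<le> c / 2 * rate \<alpha> (T j)" using r c by (intro mult_left_mono) auto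
      moreover have "c * rate \<alpha> (T j) = c / 2 * rate \<alpha> (T j) + c / 2 * rate \<alpha> (T j)" by simp
      ultimately have "c / 2 * rate \<alpha> t + ln (T j) \<le> c * rate \<alpha> (T j)"
        using t\<^sub>0[OF Tj(1)] by linarith
      then have "exp (- (c * rate \<alpha> (T j))) \<le> exp (- (c / 2 * rate \<alpha> t) - ln (T j))" by simp
      also have "\<dots> = exp (- (c / 2 * rate \<alpha> t)) * (1 / T j)" using Tj by (simp add: exp_diff)
      also have "\<dots> \<le> exp (- (c / 2 * rate \<alpha> t)) * ((1 / 2) * (1 / 2) ^ j)"
      proof (rule mult_left_mono)
        have "1 / T j \<le> 1 / (2 ^ j * 2)"
          unfolding T_def using t2 by (intro divide_left_mono mult_left_mono) auto
        then show "1 / T j \<le> 1 / 2 * (1 / 2) ^ j" by (simp add: power_divide)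
      qed simp
      finally show ?thesis using A(2)[of j] by simp
    qed
    have sums: "(\<lambda>j. exp (- (c / 2 * rate \<alpha> t)) * (1 / 2) * (1 / 2) ^ j) sums (exp (- (c / 2 * rate \<alpha> t)) * (1 / 2) * (1 / (1 - 1 / 2)))"
      by (intro sums_mult geometric_sums) simp
    have summable: "summable (\<lambda>j. measure ?L (A j))"
      by (rule summable_comparison_test'[OF sums_summable[OF sums], of 0]) (use bound in simp)
    have union: "measure ?L (\<Union>j. A j) \<le> exp (- (c / 2 * rate \<alpha> t))"
    proof -
      have "measure ?L (\<Union>j. A j) \<le> (\<Sum>j. measure ?L (A j))"
        using A summable by (intro L.finite_measure_subadditive_countably) auto
      also have "\<dots> \<le> (\<Sum>j. exp (- (c / 2 * rate \<alpha> t)) * (1 / 2) * (1 / 2) ^ j)"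
        by (intro suminf_le bound summable sums_summable[OF sums])
      also have "\<dots> = exp (- (c / 2 * rate \<alpha> t))"
        using sums_unique[OF sums] by simp
      finally show ?thesis .
    qed
    \<comment> \<open>If \<open>E\<close> is not measurable in the completion, then \<^const>\<open>measure\<close> is 0 on it.\<close>
    define E where "E = {x \<in> space (completion ?L). case x of (\<eta>, \<omega>) \<Rightarrow> \<exists>s\<ge>t. glauber \<omega> (block_init L\<^sub>0 \<eta>) s 0 = - 1}"
    have cover: "\<exists>j. T j \<le> s \<and> s \<le> 2 * T j" if s: "t \<le> s" for s
    proof -
      have t0: "0 < t" using t2 by simp
      obtain k where "s / t < 2 ^ k" using real_arch_pow[of 2 "s / t"] by auto
      then have ex: "\<exists>k. s \<le> T k" using t0 by (intro exI[of _ k]) (simp add: T_def divide_less_eq)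
      define k where "k = (LEAST k. s \<le> T k)"
      have k: "s \<le> T k" unfolding k_def by (rule LeastI_ex[OF ex])
      show ?thesis
      proof (cases k)
        case 0
        then have "s = T 0" using k s by (simp add: T_def)
        then show ?thesis using t0 by (intro exI[of _ 0]) (simp add: T_def)
      next
        case (Suc j)
        then have "\<not> s \<le> T j" using not_less_Least[of j "\<lambda>k. s \<le> T k"] by (simp add: k_def)
        then show ?thesis using k Suc by (intro exI[of _ j]) (simp add: T_def)
      qed
    qed
    have ae: "AE z in ?L. z \<in> E \<longrightarrow> z \<in> (\<Union>j. A j)"
      using AE_law_noise[OF AE_regular] AE_finite_influence AE_block_spins
    proof eventually_elim
      fix z :: "'d sample"
      assume z: "regular (snd z)" "finite_influence (snd z)" "\<forall>i. fst z i \<in> {1, - 1}"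
      show "z \<in> E \<longrightarrow> z \<in> (\<Union>j. A j)"
      proof
        assume "z \<in> E"
        then obtain s where s: "t \<le> s" "glauber (snd z) (block_init L\<^sub>0 (fst z)) s 0 = - 1"
          by (auto simp: E_def case_prod_beta')
        obtain j where j: "T j \<le> s" "s \<le> 2 * T j" using cover[OF s(1)] by blast
        show "z \<in> (\<Union>j. A j)"
        proof (rule ccontr)
          assume "z \<notin> (\<Union>j. A j)"
          then have "(fst z, snd z) \<notin> A j" by auto
          from good[OF z this j] s(2) show False by simp
        qed
      qed
    qed
    have UA: "(\<Union>j. A j) \<in> sets ?L" using A by auto
    have "measure (completion ?L) E \<le> measure ?L (\<Union>j. A j)"
    proof (cases "E \<in> sets (completion ?L)")
      case True
      interpret CL: prob_space "completion ?L" by (rule L.prob_space_completion)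
      have "measure (completion ?L) E \<le> measure (completion ?L) (\<Union>j. A j)"
        by (rule CL.finite_measure_mono_AE[OF AE_completion[OF ae]]) (use UA in auto)
      then show ?thesis using UA by simp
    qed (simp add: measure_notin_sets)
    then show ?thesis using union by (simp add: E_def)
  qed
  then show ?thesis
    unfolding eventually_at_top_linorder by blast
qed

text \<open>
  Both parts follow from this bound with the smaller power $(\ln t)^\alpha$ in the exponent, which
  holds for all \<open>L\<^sub>0\<close> up to any fixed power of \<open>1 / \<epsilon>\<^sub>0\<close>.
\<close>

lemma fixation_bound:
  fixes q \<alpha> C \<gamma> \<theta> :: real
  assumes d: "CARD('d::finite) \<ge> 2" and \<alpha>: "\<alpha> \<ge> 1" and C: "C > 0" and \<gamma>: "\<gamma> > 0"
    and erosion: "\<And>L::nat. L \<ge> 1 \<Longrightarrow>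
      \<P>(\<omega> in completion (noise_law q :: 'd noise measure).
        erosion_time L \<omega> > ereal (C * real L powr \<alpha>)) \<le> exp (- \<gamma> * real L)"
  shows "\<exists>\<epsilon>>0. \<forall>\<epsilon>\<^sub>0. 0 < \<epsilon>\<^sub>0 \<longrightarrow> \<epsilon>\<^sub>0 < \<epsilon> \<longrightarrow> (\<forall>L\<^sub>0::nat. L\<^sub>0 \<ge> 1 \<longrightarrow> real L\<^sub>0 \<le> \<epsilon>\<^sub>0 powr (- \<theta>) \<longrightarrow>
    (\<exists>c>0. \<forall>\<^sub>F t in at_top.
      \<P>((\<eta>, \<omega>) in completion (random_init_law \<epsilon>\<^sub>0 q :: ('d config \<times> 'd noise) measure).
        \<exists>s\<ge>t. glauber \<omega> (block_init L\<^sub>0 \<eta>) s 0 = - 1) \<le> exp (- (c * rate \<alpha> t))))"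
proof -
  \<comment> \<open>With a constant at least 1, the time allowed for the erosion of a cube is at least its side.\<close>
  define C' where "C' = max C 1"
  have survive: "measure (noise_law q :: 'd noise measure) {\<omega>. \<not> erodes m T \<omega>} \<le> exp (- \<gamma> * real m)"
    if m: "m \<ge> 1" "C' * real m powr \<alpha> \<le> T" for m T
  proof (rule prob_not_erodes[OF d _ _ erosion[OF m(1)]])
    show "0 \<le> C * real m powr \<alpha>" using C by simp
    have "C * real m powr \<alpha> \<le> C' * real m powr \<alpha>" by (intro mult_right_mono) (auto simp: C'_def)
    then show "C * real m powr \<alpha> \<le> T" using m(2) by linarith
  qed
  have C'1: "C' \<ge> 1" by (simp add: C'_def)
  \<comment> \<open>any value between \<open>1 / (\<alpha> + 1)\<close>, for the last step, and \<open>1 / \<alpha>\<close>, for the growth of the scales\<close>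
  define \<beta> where "\<beta> = 1 / (\<alpha> + 1 / 2)"
  have \<beta>: "1 < (\<alpha> + 1) * \<beta>" "0 < \<beta>" "\<beta> \<le> 1" "\<beta> < 1 / \<alpha>"
    using \<alpha> by (auto simp: \<beta>_def field_simps)
  obtain M\<^sub>0 :: nat where M\<^sub>0: "1 / (1 / \<alpha> - \<beta>) < real M\<^sub>0"
    using reals_Archimedean2 by blast
  define M where "M = max 2 M\<^sub>0"
  have M: "M \<ge> 2" "1 / (1 / \<alpha> - \<beta>) < real M" using M\<^sub>0 by (auto simp: M_def)
  have "1 / real M < 1 / \<alpha> - \<beta>"
    using M \<beta>(4) by (simp add: field_simps)
  then have \<beta>M: "\<beta> < 1 / \<alpha> - 1 / real M" by simp
  obtain P :: real and \<Lambda> :: nat where P: "P > 0" "\<Lambda> \<ge> 2" "\<And>x. real \<Lambda> \<le> x \<Longrightarrow> P * ln x \<le> x powr \<beta>"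
    and grow: "\<And>\<epsilon> L\<^sub>0 L' t' \<nu> L. controlled \<epsilon> q L\<^sub>0 TYPE('d) L' t' (exp (- \<nu>)) \<Longrightarrow> 1 \<le> L\<^sub>0 \<Longrightarrow> L\<^sub>0 \<le> L' \<Longrightarrow>
      0 \<le> t' \<Longrightarrow> t' \<le> real L' \<Longrightarrow> \<Lambda> \<le> L' \<Longrightarrow> P * ln (real L') \<le> \<nu> \<Longrightarrow> L' ^ M \<le> L \<Longrightarrow> L \<le> L' ^ (M ^ 2) \<Longrightarrow>
      \<exists>t\<ge>0. t \<le> real L \<and> controlled \<epsilon> q L\<^sub>0 TYPE('d) L t (exp (- (real L powr \<beta>)))"
    using controlled_growth[OF refl d \<alpha> C'1 \<gamma> survive refl refl refl \<beta>(2) \<beta>M M(1)] by blast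
  obtain \<epsilon> where \<epsilon>: "\<epsilon> > 0" and start: "\<And>\<epsilon>\<^sub>0 L\<^sub>0. 0 < \<epsilon>\<^sub>0 \<Longrightarrow> \<epsilon>\<^sub>0 < \<epsilon> \<Longrightarrow> L\<^sub>0 \<ge> 1 \<Longrightarrow> real L\<^sub>0 \<le> \<epsilon>\<^sub>0 powr (- \<theta>) \<Longrightarrow>
    \<exists>L t \<nu>. controlled \<epsilon>\<^sub>0 q L\<^sub>0 TYPE('d) L t (exp (- \<nu>)) \<and> L\<^sub>0 \<le> L \<and> 0 \<le> t \<and> t \<le> real L \<and> \<Lambda> \<le> L \<and>
      P * ln (real L) \<le> \<nu>"
    using controlled_start[OF refl d \<alpha> C'1 \<gamma> survive refl refl refl P(1), of \<theta> \<Lambda>] by metis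
  show ?thesis
  proof (rule exI[of _ \<epsilon>], intro conjI allI impI \<epsilon>)
    fix \<epsilon>\<^sub>0 :: real and L\<^sub>0 :: nat
    assume \<epsilon>\<^sub>0: "0 < \<epsilon>\<^sub>0" "\<epsilon>\<^sub>0 < \<epsilon>" and L\<^sub>0: "1 \<le> L\<^sub>0" "real L\<^sub>0 \<le> \<epsilon>\<^sub>0 powr (- \<theta>)"
    obtain L\<^sub>1 t \<nu> where L\<^sub>1: "controlled \<epsilon>\<^sub>0 q L\<^sub>0 TYPE('d) L\<^sub>1 t (exp (- \<nu>))" "L\<^sub>0 \<le> L\<^sub>1" "0 \<le> t" "t \<le> real L\<^sub>1"
      "\<Lambda> \<le> L\<^sub>1" "P * ln (real L\<^sub>1) \<le> \<nu>"
      using start[OF \<epsilon>\<^sub>0 L\<^sub>0] by blast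
    have two: "2 \<le> L\<^sub>1" using L\<^sub>1 P(2) by simp
    have scales: "\<exists>t\<ge>0. t \<le> real L \<and> controlled \<epsilon>\<^sub>0 q L\<^sub>0 TYPE('d) L t (exp (- (real L powr \<beta>)))"
      if "L\<^sub>1 ^ M \<le> L" for L
      by (rule controlled_all_scales[OF M(1) P(3) grow[OF _ L\<^sub>0(1)] L\<^sub>1 two that])
    have "L\<^sub>1 ^ 1 \<le> L\<^sub>1 ^ M" using two M by (intro power_increasing) auto
    then have L\<^sub>0': "L\<^sub>0 \<le> L\<^sub>1 ^ M" using L\<^sub>1(2) by simp
    obtain c where c: "c > 0" "\<forall>\<^sub>F t in at_top. \<exists>L\<ge>1.
        controlled \<epsilon>\<^sub>0 q L\<^sub>0 TYPE('d) L t (exp (- (c * (t powr (1 / \<alpha>) / (ln t) powr \<alpha>))))"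
      using controlled_at_time[OF refl d \<alpha> C'1 \<gamma> survive refl refl refl \<beta>(1-3) L\<^sub>0(1) L\<^sub>0' scales] by blast
    have "\<forall>\<^sub>F t in at_top. \<P>((\<eta>, \<omega>) in completion (law \<epsilon>\<^sub>0 q :: 'd sample measure).
        \<exists>s\<ge>t. glauber \<omega> (block_init L\<^sub>0 \<eta>) s 0 = - 1) \<le> exp (- (c / 2 * rate \<alpha> t))"
      by (rule prob_minus_later[OF \<alpha> c(1)]) (use c(2) in \<open>simp add: rate_def\<close>)
    then show "\<exists>c>0. \<forall>\<^sub>F t in at_top.
      \<P>((\<eta>, \<omega>) in completion (random_init_law \<epsilon>\<^sub>0 q :: ('d config \<times> 'd noise) measure).
        \<exists>s\<ge>t. glauber \<omega> (block_init L\<^sub>0 \<eta>) s 0 = - 1) \<le> exp (- (c * rate \<alpha> t))"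
      using c(1) by (intro exI[of _ "c / 2"]) auto
  qed
qed

lemma rate_ge:
  assumes "exp 1 \<le> t" "\<alpha> \<le> r"
  shows "t powr (1 / \<alpha>) / (ln t) powr r \<le> rate \<alpha> t"
proof -
  have "0 < t" using assms(1) exp_gt_zero[of "1 :: real"] by linarith
  then have "1 \<le> ln t" using assms(1) by (simp add: ln_ge_iff)
  then have "(ln t) powr \<alpha> \<le> (ln t) powr r" "0 < (ln t) powr \<alpha>" using assms(2) by (auto intro: powr_mono)
  then show ?thesis unfolding rate_def by (intro divide_left_mono) auto
qed

theorem theorem4p1:
  fixes q \<alpha> C \<gamma> :: real
  assumes d: "CARD('d::finite) \<ge> 2"
    and q: "0 \<le> q" "q \<le> 1"
    and \<alpha>: "\<alpha> \<ge> 1"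
    and C: "C > 0"
    and \<gamma>: "\<gamma> > 0"
    and erosion: "\<And>L::nat. L \<ge> 1 \<Longrightarrow>
      \<P>(\<omega> in completion (noise_law q :: 'd noise measure).
        erosion_time L \<omega> > ereal (C * real L powr \<alpha>)) \<le> exp (- \<gamma> * real L)"
  shows
    "(\<alpha> = 1 \<longrightarrow>
       (\<forall>L\<^sub>0::nat. L\<^sub>0 \<ge> 4 \<longrightarrow>
         (\<exists>\<epsilon>>0. \<forall>\<epsilon>\<^sub>0\<in>{0<..<min \<epsilon> 1}. \<exists>C\<^sub>1>0. \<forall>\<^sub>F t in at_top.
            \<P>((\<eta>, \<omega>) in completion (random_init_law \<epsilon>\<^sub>0 q :: ('d config \<times> 'd noise) measure).
              \<exists>s\<ge>t. glauber \<omega> (block_init L\<^sub>0 \<eta>) s 0 = - 1)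
            \<le> exp (- C\<^sub>1 * (t / (ln t)\<^sup>2))))) \<and>
     (\<alpha> > 1 \<longrightarrow>
       (\<forall>\<delta>>0. \<exists>\<epsilon>>0. \<forall>\<epsilon>\<^sub>0\<in>{0<..<min \<epsilon> 1}. \<forall>L\<^sub>0::nat.
          L\<^sub>0 \<ge> 1 \<and>
          real L\<^sub>0 \<le> (2 * exp 1) powr (\<alpha> / ((\<alpha> - 1) * (real CARD('d) - 1)))
                     / (32 * real CARD('d) * exp 1) powr (1 / (\<alpha> - 1))
                     * \<epsilon>\<^sub>0 powr (- (2 * \<delta> / ((real CARD('d) - 1) * (\<alpha> - 1)))) \<longrightarrow>
          (\<exists>C\<^sub>2>0. \<forall>\<^sub>F t in at_top.
            \<P>((\<eta>, \<omega>) in completion (random_init_law \<epsilon>\<^sub>0 q :: ('d config \<times> 'd noise) measure).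
              \<exists>s\<ge>t. glauber \<omega> (block_init L\<^sub>0 \<eta>) s 0 = - 1)
            \<le> exp (- C\<^sub>2 * (t powr (1 / \<alpha>) / (ln t) powr (\<alpha> + 3 * \<delta>))))))"
proof (intro conjI impI allI)
  let ?p = "\<lambda>\<epsilon>\<^sub>0 L\<^sub>0 t. \<P>((\<eta>, \<omega>) in completion (random_init_law \<epsilon>\<^sub>0 q :: ('d config \<times> 'd noise) measure).
    \<exists>s\<ge>t. glauber \<omega> (block_init L\<^sub>0 \<eta>) s 0 = - 1)"
  have bound: "\<exists>\<epsilon>>0. \<forall>\<epsilon>\<^sub>0. 0 < \<epsilon>\<^sub>0 \<longrightarrow> \<epsilon>\<^sub>0 < \<epsilon> \<longrightarrow> (\<forall>L\<^sub>0::nat. L\<^sub>0 \<ge> 1 \<longrightarrow> real L\<^sub>0 \<le> \<epsilon>\<^sub>0 powr (- \<theta>) \<longrightarrow>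
    (\<exists>c>0. \<forall>\<^sub>F t in at_top. ?p \<epsilon>\<^sub>0 L\<^sub>0 t \<le> exp (- (c * rate \<alpha> t))))" for \<theta>
    by (rule fixation_bound[OF d \<alpha> C \<gamma> erosion])
  have weaken: "\<forall>\<^sub>F t in at_top. f t \<le> exp (- c * (t powr (1 / \<alpha>) / (ln t) powr r))"
    if ev: "\<forall>\<^sub>F t in at_top. f t \<le> exp (- (c * rate \<alpha> t))" and c: "c > 0" and r: "\<alpha> \<le> r" for f :: "real \<Rightarrow> real" and c r
    using ev eventually_ge_at_top[of "exp 1"]
  proof eventually_elim
    fix t :: real assume t: "f t \<le> exp (- (c * rate \<alpha> t))" "exp 1 \<le> t"
    have "c * (t powr (1 / \<alpha>) / (ln t) powr r) \<le> c * rate \<alpha> t"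
      using rate_ge[OF t(2) r] c by (intro mult_left_mono) auto
    then have "exp (- (c * rate \<alpha> t)) \<le> exp (- c * (t powr (1 / \<alpha>) / (ln t) powr r))" by simp
    then show "f t \<le> exp (- c * (t powr (1 / \<alpha>) / (ln t) powr r))" using t(1) by linarith
  qed
  {
    fix L\<^sub>0 :: nat assume \<alpha>1: "\<alpha> = 1" and L\<^sub>0: "L\<^sub>0 \<ge> 4"
    from bound[of 1] obtain \<epsilon> where \<epsilon>: "\<epsilon> > 0" and b: "\<forall>\<epsilon>\<^sub>0. 0 < \<epsilon>\<^sub>0 \<longrightarrow> \<epsilon>\<^sub>0 < \<epsilon> \<longrightarrow>
      (\<forall>L\<^sub>0::nat. L\<^sub>0 \<ge> 1 \<longrightarrow> real L\<^sub>0 \<le> \<epsilon>\<^sub>0 powr (- 1) \<longrightarrow> (\<exists>c>0. \<forall>\<^sub>F t in at_top. ?p \<epsilon>\<^sub>0 L\<^sub>0 t \<le> exp (- (c * rate \<alpha> t))))"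
      by (elim exE conjE)
    show "\<exists>\<epsilon>>0. \<forall>\<epsilon>\<^sub>0\<in>{0<..<min \<epsilon> 1}. \<exists>C\<^sub>1>0. \<forall>\<^sub>F t in at_top.
            \<P>((\<eta>, \<omega>) in completion (random_init_law \<epsilon>\<^sub>0 q :: ('d config \<times> 'd noise) measure).
              \<exists>s\<ge>t. glauber \<omega> (block_init L\<^sub>0 \<eta>) s 0 = - 1)
            \<le> exp (- C\<^sub>1 * (t / (ln t)\<^sup>2))"
    proof (rule exI[of _ "min \<epsilon> (1 / real L\<^sub>0)"], intro conjI ballI)
      show "0 < min \<epsilon> (1 / real L\<^sub>0)" using \<epsilon> L\<^sub>0 by simp
      fix \<epsilon>\<^sub>0 assume "\<epsilon>\<^sub>0 \<in> {0<..<min (min \<epsilon> (1 / real L\<^sub>0)) 1}"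
      then have \<epsilon>\<^sub>0: "0 < \<epsilon>\<^sub>0" "\<epsilon>\<^sub>0 < \<epsilon>" "\<epsilon>\<^sub>0 < 1 / real L\<^sub>0" by auto
      then have "real L\<^sub>0 \<le> \<epsilon>\<^sub>0 powr (- 1)"
        using L\<^sub>0 by (simp add: powr_minus_divide field_simps)
      then obtain c where c: "c > 0" "\<forall>\<^sub>F t in at_top. ?p \<epsilon>\<^sub>0 L\<^sub>0 t \<le> exp (- (c * rate \<alpha> t))"
        using b[rule_format, OF \<epsilon>\<^sub>0(1,2), of L\<^sub>0] L\<^sub>0 by auto
      have "\<alpha> \<le> 2" using \<alpha>1 by simp
      from weaken[OF c(2,1) this] eventually_ge_at_top[of "exp 1"]
      have "\<forall>\<^sub>F t in at_top. ?p \<epsilon>\<^sub>0 L\<^sub>0 t \<le> exp (- c * (t / (ln t)\<^sup>2))"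
      proof eventually_elim
        fix t :: real
        assume t: "?p \<epsilon>\<^sub>0 L\<^sub>0 t \<le> exp (- c * (t powr (1 / \<alpha>) / (ln t) powr 2))" "exp 1 \<le> t"
        have t0: "0 < t" using t(2) exp_gt_zero[of "1 :: real"] by linarith
        then have "1 \<le> ln t" using t(2) by (simp add: ln_ge_iff)
        then have "0 < ln t" by linarith
        from powr_realpow[OF this, of 2] have "t powr (1 / \<alpha>) / (ln t) powr 2 = t / (ln t)\<^sup>2"
          using t0 \<alpha>1 by simp
        then show "?p \<epsilon>\<^sub>0 L\<^sub>0 t \<le> exp (- c * (t / (ln t)\<^sup>2))"
          using t(1) by (simp only:)
      qed
      then show "\<exists>C\<^sub>1>0. \<forall>\<^sub>F t in at_top.
            \<P>((\<eta>, \<omega>) in completion (random_init_law \<epsilon>\<^sub>0 q :: ('d config \<times> 'd noise) measure).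
              \<exists>s\<ge>t. glauber \<omega> (block_init L\<^sub>0 \<eta>) s 0 = - 1)
            \<le> exp (- C\<^sub>1 * (t / (ln t)\<^sup>2))"
        using c(1) by blast
    qed
  next
    fix \<delta> :: real assume \<alpha>1: "\<alpha> > 1" and \<delta>: "\<delta> > 0"
    define K where "K = (2 * exp 1) powr (\<alpha> / ((\<alpha> - 1) * (real CARD('d) - 1)))
                     / (32 * real CARD('d) * exp 1) powr (1 / (\<alpha> - 1))"
    define \<theta> where "\<theta> = 2 * \<delta> / ((real CARD('d) - 1) * (\<alpha> - 1))"
    have K: "0 \<le> K" by (simp add: K_def)
    from bound[of "\<theta> + 1"] obtain \<epsilon> where \<epsilon>: "\<epsilon> > 0" and b: "\<forall>\<epsilon>\<^sub>0. 0 < \<epsilon>\<^sub>0 \<longrightarrow> \<epsilon>\<^sub>0 < \<epsilon> \<longrightarrow>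
      (\<forall>L\<^sub>0::nat. L\<^sub>0 \<ge> 1 \<longrightarrow> real L\<^sub>0 \<le> \<epsilon>\<^sub>0 powr (- (\<theta> + 1)) \<longrightarrow> (\<exists>c>0. \<forall>\<^sub>F t in at_top. ?p \<epsilon>\<^sub>0 L\<^sub>0 t \<le> exp (- (c * rate \<alpha> t))))"
      by (elim exE conjE)
    show "\<exists>\<epsilon>>0. \<forall>\<epsilon>\<^sub>0\<in>{0<..<min \<epsilon> 1}. \<forall>L\<^sub>0::nat.
          L\<^sub>0 \<ge> 1 \<and>
          real L\<^sub>0 \<le> (2 * exp 1) powr (\<alpha> / ((\<alpha> - 1) * (real CARD('d) - 1)))
                     / (32 * real CARD('d) * exp 1) powr (1 / (\<alpha> - 1))
                     * \<epsilon>\<^sub>0 powr (- (2 * \<delta> / ((real CARD('d) - 1) * (\<alpha> - 1)))) \<longrightarrow>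
          (\<exists>C\<^sub>2>0. \<forall>\<^sub>F t in at_top.
            \<P>((\<eta>, \<omega>) in completion (random_init_law \<epsilon>\<^sub>0 q :: ('d config \<times> 'd noise) measure).
              \<exists>s\<ge>t. glauber \<omega> (block_init L\<^sub>0 \<eta>) s 0 = - 1)
            \<le> exp (- C\<^sub>2 * (t powr (1 / \<alpha>) / (ln t) powr (\<alpha> + 3 * \<delta>))))"
      unfolding K_def[symmetric] \<theta>_def[symmetric]
      \<comment> \<open>for \<open>\<epsilon>\<^sub>0 < 1 / (K + 1)\<close> the factor \<open>K\<close> is absorbed by one more power of \<open>1 / \<epsilon>\<^sub>0\<close>\<close>
    proof (rule exI[of _ "min \<epsilon> (1 / (K + 1))"], intro conjI ballI allI impI)
      show "0 < min \<epsilon> (1 / (K + 1))" using \<epsilon> K by simp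
      fix \<epsilon>\<^sub>0 :: real and L\<^sub>0 :: nat
      assume "\<epsilon>\<^sub>0 \<in> {0<..<min (min \<epsilon> (1 / (K + 1))) 1}" and L\<^sub>0: "1 \<le> L\<^sub>0 \<and> real L\<^sub>0 \<le> K * \<epsilon>\<^sub>0 powr (- \<theta>)"
      then have \<epsilon>\<^sub>0: "0 < \<epsilon>\<^sub>0" "\<epsilon>\<^sub>0 < \<epsilon>" "\<epsilon>\<^sub>0 < 1 / (K + 1)" by auto
      have "K \<le> 1 / \<epsilon>\<^sub>0"
      proof -
        have "\<epsilon>\<^sub>0 * (K + 1) < 1" using \<epsilon>\<^sub>0 K by (simp add: less_divide_eq)
        then show ?thesis using \<epsilon>\<^sub>0 by (simp add: le_divide_eq algebra_simps)
      qed
      then have "K * \<epsilon>\<^sub>0 powr (- \<theta>) \<le> \<epsilon>\<^sub>0 powr (- 1) * \<epsilon>\<^sub>0 powr (- \<theta>)"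
        using \<epsilon>\<^sub>0 by (intro mult_right_mono) (simp_all add: powr_minus_divide)
      also have "\<dots> = \<epsilon>\<^sub>0 powr (- 1 + - \<theta>)" by (rule powr_add[symmetric])
      also have "- 1 + - \<theta> = - (\<theta> + 1)" by simp
      finally have "real L\<^sub>0 \<le> \<epsilon>\<^sub>0 powr (- (\<theta> + 1))" using L\<^sub>0 by simp
      then obtain c where c: "c > 0" "\<forall>\<^sub>F t in at_top. ?p \<epsilon>\<^sub>0 L\<^sub>0 t \<le> exp (- (c * rate \<alpha> t))"
        using b[rule_format, OF \<epsilon>\<^sub>0(1,2), of L\<^sub>0] L\<^sub>0 by auto
      have "\<alpha> \<le> \<alpha> + 3 * \<delta>" using \<delta> by simp
      show "\<exists>C\<^sub>2>0. \<forall>\<^sub>F t in at_top.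
            \<P>((\<eta>, \<omega>) in completion (random_init_law \<epsilon>\<^sub>0 q :: ('d config \<times> 'd noise) measure).
              \<exists>s\<ge>t. glauber \<omega> (block_init L\<^sub>0 \<eta>) s 0 = - 1)
            \<le> exp (- C\<^sub>2 * (t powr (1 / \<alpha>) / (ln t) powr (\<alpha> + 3 * \<delta>)))"
        using weaken[OF c(2,1) \<open>\<alpha> \<le> \<alpha> + 3 * \<delta>\<close>] c(1) by blast
    qed
  }
qed

end
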